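(* Let $m:=\inf_{(x,y)\in\Omega^2} w_2(x,y)$ and $M:=\sup_{(x,y)\in\Omega^2} w_2(x,y)$. Then the essential spectrum of the bounded self-adjoint operator $H$ in $\mathcal{H}$ is $$\sigma_{\rm ess}(H)=\Sigma_1\cup\Sigma_2,$$ where $$\Sigma_1:=\mathrm{cl}(\mathrm{ran}\, w_2)=[m,M],\qquad \Sigma_2:=\mathrm{cl}\,\{z\in\mathbb{R}\setminus\Sigma_1:\ 0\in \mathrm{ess\,ran}\,\Delta(\cdot\,;z)\}.$$
   Context: Let $d\in\mathbb{N}$, $a\in(0,\infty)$, $\Omega=(-a,a)^d\subset\mathbb{R}^d$. Let $\mathcal{H}=\mathcal{H}_0\oplus\mathcal{H}_1\oplus\mathcal{H}_2$ with $\mathcal{H}_0=\mathbb{C}$, $\mathcal{H}_1=L^2(\Omega,\mathbb{C})$, and $\mathcal{H}_2=L^2_{\rm sym}(\Omega^2,\mathbb{C})$ the closed subspace of $L^2(\Omega^2,\mathbb{C})$ of functions with $f(x,y)=f(y,x)$ for almost all $x,y\in\Omega$. Here $\mathrm{cl}$ denotes closure, $\mathrm{ran}$ the range and $\mathrm{ess\,ran}$ the essential range of a measurable function, and $^*$ denotes complex conjugation for functions and the adjoint for operators. Standing assumptions on the parameter functions: $w_0\in\mathbb{R}$; $v_0\in L^2(\Omega,\mathbb{C})$; $w_1\in L^\infty(\Omega,\mathbb{R})$; $w_2\in C(\Omega^2)\cap L^\infty(\Omega^2,\mathbb{R})$ with $w_2(x,y)=w_2(y,x)$ for $x,y\in\Omega$;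 and $v_1$ is a complex-valued measurable function on $\Omega^2$ such that for some $\varepsilon>0$ $$\operatorname{ess\,sup}_{x\in\Omega}\|v_1(x,\cdot)\|_{L^{2+\varepsilon}(\Omega)}<\infty,\qquad \operatorname{ess\,sup}_{y\in\Omega}\|v_1(\cdot,y)\|_{L^{2+4/\varepsilon}(\Omega)}<\infty.$$ The operator $H$ in $\mathcal{H}$ is the operator matrix $$H=\begin{pmatrix}H_{00}&H_{01}&0\\ H_{01}^*&H_{11}&H_{12}\\ 0&H_{12}^*&H_{22}\end{pmatrix},$$ where $H_{ij}:\mathcal{H}_j\to\mathcal{H}_i$ are given by $H_{00}f_0=w_0f_0$, $H_{01}f_1=\int_\Omega v_0(s)f_1(s)\,ds$, $(H_{11}f_1)(x)=w_1(x)f_1(x)$, $(H_{12}f_2)(x)=\int_\Omega v_1(x,s)f_2(x,s)\,ds$, $(H_{22}f_2)(x,y)=w_2(x,y)f_2(x,y)$ for almost all $x,y\in\Omega$. It is an everywhere defined bounded self-adjoint operator. For $z\in\mathbb{R}\setminus\mathrm{cl}(\mathrm{ran}\,w_2)$ define $$\Delta(x;z):=w_1(x)-z-\frac12\int_\Omega\frac{|v_1(x,y)|^2}{w_2(x,y)-z}\,dy,\qquad x\in\Omega.$$ *)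

theory Defs
  imports "HOL-Analysis.Analysis" "HOL-Probability.Essential_Supremum"
begin

section \<open>Complex inner product spaces\<close>

text \<open>
  The inner product is linear in the first argument. The norm, the topology and the real inner
  product are those of the underlying real space.
\<close>

class complex_inner = real_inner +
  fixes scaleC :: "complex \<Rightarrow> 'a \<Rightarrow> 'a" (infixr "*\<^sub>C" 75)
    and cinner :: "'a \<Rightarrow> 'a \<Rightarrow> complex"
  assumes scaleC_add_right: "c *\<^sub>C (x + y) = c *\<^sub>C x + c *\<^sub>C y"
    and scaleC_add_left: "(c + d) *\<^sub>C x = c *\<^sub>C x + d *\<^sub>C x"
    and scaleC_scaleC: "c *\<^sub>C d *\<^sub>C x = (c * d) *\<^sub>C x"
    and scaleC_of_real: "complex_of_real r *\<^sub>C x = r *\<^sub>R x"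
    and cinner_commute: "cinner x y = cnj (cinner y x)"
    and cinner_add_left: "cinner (x + y) z = cinner x z + cinner y z"
    and cinner_scaleC_left: "cinner (c *\<^sub>C x) y = c * cinner x y"
    and inner_eq_Re_cinner: "inner x y = Re (cinner x y)"

global_interpretation complex_vector: vector_space "scaleC :: complex \<Rightarrow> 'a::complex_inner \<Rightarrow> 'a"
  defines cspan = complex_vector.span
proof
  fix c d :: complex and x y :: 'a
  show "c *\<^sub>C (x + y) = c *\<^sub>C x + c *\<^sub>C y" by (rule scaleC_add_right)
  show "(c + d) *\<^sub>C x = c *\<^sub>C x + d *\<^sub>C x" by (rule scaleC_add_left)
  show "c *\<^sub>C d *\<^sub>C x = (c * d) *\<^sub>C x" by (rule scaleC_scaleC)
  show "1 *\<^sub>C x = x" using scaleC_of_real[of 1 x] by simp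
qed

instantiation complex :: complex_inner
begin

definition scaleC_complex :: "complex \<Rightarrow> complex \<Rightarrow> complex"
  where "scaleC_complex c x = c * x"

definition cinner_complex :: "complex \<Rightarrow> complex \<Rightarrow> complex"
  where "cinner_complex x y = x * cnj y"

instance
  by standard
    (auto simp: scaleC_complex_def cinner_complex_def inner_complex_def algebra_simps scaleR_conv_of_real)

end

instantiation prod :: (complex_inner, complex_inner) complex_inner
begin

definition scaleC_prod :: "complex \<Rightarrow> 'a \<times> 'b \<Rightarrow> 'a \<times> 'b"
  where "scaleC_prod c x = (c *\<^sub>C fst x, c *\<^sub>C snd x)"

definition cinner_prod :: "'a \<times> 'b \<Rightarrow> 'a \<times> 'b \<Rightarrow> complex"
  where "cinner_prod x y = cinner (fst x) (fst y) + cinner (snd x) (snd y)"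

instance
proof
  fix c d :: complex and r :: real and x y z :: "'a \<times> 'b"
  show "c *\<^sub>C (x + y) = c *\<^sub>C x + c *\<^sub>C y"
    by (simp add: scaleC_prod_def scaleC_add_right)
  show "(c + d) *\<^sub>C x = c *\<^sub>C x + d *\<^sub>C x"
    by (simp add: scaleC_prod_def scaleC_add_left)
  show "c *\<^sub>C d *\<^sub>C x = (c * d) *\<^sub>C x"
    by (simp add: scaleC_prod_def scaleC_scaleC)
  show "complex_of_real r *\<^sub>C x = r *\<^sub>R x"
    by (simp add: scaleC_prod_def scaleC_of_real scaleR_prod_def)
  show "cinner x y = cnj (cinner y x)"
    unfolding cinner_prod_def
    by (subst (1 2) cinner_commute) simp
  show "cinner (x + y) z = cinner x z + cinner y z"
    by (simp add: cinner_prod_def cinner_add_left)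
  show "cinner (c *\<^sub>C x) y = c * cinner x y"
    by (simp add: cinner_prod_def scaleC_prod_def cinner_scaleC_left distrib_left)
  show "inner x y = Re (cinner x y)"
    by (simp add: cinner_prod_def inner_prod_def inner_eq_Re_cinner)
qed

end

section \<open>Adjoint and essential spectrum on a closed subspace\<close>

text \<open>
  The Hilbert spaces below are closed complex subspaces of complete spaces; an operator
  between two of them is a function that is only looked at on its domain.
\<close>

definition adjoint_on ::
  "'a::complex_inner set \<Rightarrow> ('a \<Rightarrow> 'b::complex_inner) \<Rightarrow> 'b \<Rightarrow> 'a"
  where "adjoint_on U A g = (THE h. h \<in> U \<and> (\<forall>f\<in>U. cinner (A f) g = cinner f h))"

text \<open>
  For a bounded linear operator on the Hilbert space \<open>U\<close>: finite-dimensional kernel,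
  closed range, range of finite codimension.
\<close>

definition fredholm_on :: "'a::complex_inner set \<Rightarrow> ('a \<Rightarrow> 'a) \<Rightarrow> bool"
  where "fredholm_on U A \<longleftrightarrow>
    (\<exists>B. finite B \<and> {f \<in> U. A f = 0} \<subseteq> cspan B) \<and>
    closedin (top_of_set U) (A ` U) \<and>
    (\<exists>B. finite B \<and> B \<subseteq> U \<and> U \<subseteq> cspan (A ` U \<union> B))"

definition ess_spectrum_on :: "'a::complex_inner set \<Rightarrow> ('a \<Rightarrow> 'a) \<Rightarrow> complex set"
  where "ess_spectrum_on U A = {z. \<not> fredholm_on U (\<lambda>f. A f - z *\<^sub>C f)}"

section \<open>The space of square-integrable functions\<close>

definition sq_integrable :: "'a measure \<Rightarrow> ('a \<Rightarrow> complex) \<Rightarrow> bool"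
  where "sq_integrable M f \<longleftrightarrow>
    f \<in> borel_measurable M \<and> integrable M (\<lambda>x. (cmod (f x))\<^sup>2)"

lemma sq_integrable_zero: "sq_integrable M (\<lambda>_. 0)"
  by (simp add: sq_integrable_def)

lemma sq_integrable_cmult:
  assumes "sq_integrable M f"
  shows "sq_integrable M (\<lambda>x. c * f x)"
  using assms by (auto simp: sq_integrable_def norm_mult power_mult_distrib)

lemma borel_measurable_cnj [measurable]: "cnj \<in> borel_measurable borel"
  by (intro borel_measurable_continuous_onI continuous_intros)

lemma sq_integrable_mult_cnj:
  assumes "sq_integrable M f" "sq_integrable M g"
  shows "integrable M (\<lambda>x. f x * cnj (g x))"
proof (rule Bochner_Integration.integrable_bound)
  show "integrable M (\<lambda>x. (cmod (f x))\<^sup>2 + (cmod (g x))\<^sup>2)"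
    using assms by (auto simp: sq_integrable_def)
  have [measurable]: "f \<in> borel_measurable M" "g \<in> borel_measurable M"
    using assms by (auto simp: sq_integrable_def)
  show "(\<lambda>x. f x * cnj (g x)) \<in> borel_measurable M"
    by measurable
  have "a * b \<le> a\<^sup>2 + b\<^sup>2" if "a \<ge> 0" "b \<ge> 0" for a b :: real
  proof -
    have "2 * (a * b) \<le> a\<^sup>2 + b\<^sup>2"
      using sum_squares_bound[of a b] by (simp add: mult.assoc)
    moreover have "0 \<le> a * b" using that by simp
    ultimately show ?thesis by linarith
  qed
  then show "AE x in M. norm (f x * cnj (g x)) \<le> norm ((cmod (f x))\<^sup>2 + (cmod (g x))\<^sup>2)"
    by (intro AE_I2) (simp add: norm_mult)
qed

lemma sq_integrable_add:
  assumes "sq_integrable M f" "sq_integrable M g"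
  shows "sq_integrable M (\<lambda>x. f x + g x)"
proof -
  have [measurable]: "f \<in> borel_measurable M" "g \<in> borel_measurable M"
    using assms by (auto simp: sq_integrable_def)
  have "integrable M (\<lambda>x. (cmod (f x + g x))\<^sup>2)"
  proof (rule Bochner_Integration.integrable_bound)
    show "integrable M (\<lambda>x. 2 * (cmod (f x))\<^sup>2 + 2 * (cmod (g x))\<^sup>2)"
      using assms by (auto simp: sq_integrable_def)
    show "(\<lambda>x. (cmod (f x + g x))\<^sup>2) \<in> borel_measurable M"
      by measurable
    have "(cmod (u + v))\<^sup>2 \<le> 2 * (cmod u)\<^sup>2 + 2 * (cmod v)\<^sup>2" for u v :: complex
    proof -
      have "(cmod (u + v))\<^sup>2 \<le> (cmod u + cmod v)\<^sup>2"
        by (intro power_mono norm_triangle_ineq) simp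
      also have "\<dots> \<le> 2 * (cmod u)\<^sup>2 + 2 * (cmod v)\<^sup>2"
        using sum_squares_bound[of "cmod u" "cmod v"] by (simp add: power2_sum)
      finally show ?thesis .
    qed
    then show "AE x in M. norm ((cmod (f x + g x))\<^sup>2) \<le> norm (2 * (cmod (f x))\<^sup>2 + 2 * (cmod (g x))\<^sup>2)"
      by (intro AE_I2) simp
  qed
  then show ?thesis by (simp add: sq_integrable_def)
qed

quotient_type (overloaded) 'a l2 = "'a::euclidean_space \<Rightarrow> complex" / partial:
  "\<lambda>f g. sq_integrable lebesgue f \<and> sq_integrable lebesgue g \<and> (AE x in lebesgue. f x = g x)"
proof (rule part_equivpI)
  show "\<exists>f :: 'a \<Rightarrow> complex. sq_integrable lebesgue f \<and> sq_integrable lebesgue f \<and>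
      (AE x in lebesgue. f x = f x)"
    using sq_integrable_zero by (intro exI[of _ "\<lambda>_. 0"]) auto
  show "symp (\<lambda>f g :: 'a \<Rightarrow> complex. sq_integrable lebesgue f \<and> sq_integrable lebesgue g \<and>
      (AE x in lebesgue. f x = g x))"
    by (rule sympI) (auto elim: eventually_mono)
  show "transp (\<lambda>f g :: 'a \<Rightarrow> complex. sq_integrable lebesgue f \<and> sq_integrable lebesgue g \<and>
      (AE x in lebesgue. f x = g x))"
    by (rule transpI) (auto elim: eventually_elim2)
qed

lemma sq_integrable_rep_l2: "sq_integrable lebesgue (rep_l2 f)"
  using Quotient3_rep_reflp[OF Quotient3_l2] by blast

lemma rep_abs_l2:
  assumes "sq_integrable lebesgue f"
  shows "AE x in lebesgue. rep_l2 (abs_l2 f) x = f x"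
  using rep_abs_rsp_left[OF Quotient3_l2, of f f] assms by simp

lemma abs_rep_l2: "abs_l2 (rep_l2 f) = f"
  by (rule Quotient3_abs_rep[OF Quotient3_l2])

lemma l2_eqI:
  assumes "AE x in lebesgue. rep_l2 f x = rep_l2 g x"
  shows "f = g"
  using Quotient3_rel_rep[OF Quotient3_l2, of f g] assms sq_integrable_rep_l2 by blast

instantiation l2 :: (euclidean_space) complex_inner
begin

definition zero_l2 :: "'a l2" where "zero_l2 = abs_l2 (\<lambda>_. 0)"

definition plus_l2 :: "'a l2 \<Rightarrow> 'a l2 \<Rightarrow> 'a l2"
  where "plus_l2 f g = abs_l2 (\<lambda>x. rep_l2 f x + rep_l2 g x)"

definition scaleC_l2 :: "complex \<Rightarrow> 'a l2 \<Rightarrow> 'a l2"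
  where "scaleC_l2 c f = abs_l2 (\<lambda>x. c * rep_l2 f x)"

definition cinner_l2 :: "'a l2 \<Rightarrow> 'a l2 \<Rightarrow> complex"
  where "cinner_l2 f g = (LINT x|lebesgue. rep_l2 f x * cnj (rep_l2 g x))"

definition uminus_l2 :: "'a l2 \<Rightarrow> 'a l2" where "uminus_l2 f = (-1) *\<^sub>C f"

definition minus_l2 :: "'a l2 \<Rightarrow> 'a l2 \<Rightarrow> 'a l2" where "minus_l2 f g = f + (- g)"

definition scaleR_l2 :: "real \<Rightarrow> 'a l2 \<Rightarrow> 'a l2"
  where "scaleR_l2 r f = complex_of_real r *\<^sub>C f"

definition inner_l2 :: "'a l2 \<Rightarrow> 'a l2 \<Rightarrow> real" where "inner_l2 f g = Re (cinner f g)"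

definition norm_l2 :: "'a l2 \<Rightarrow> real" where "norm_l2 f = sqrt (inner f f)"

definition dist_l2 :: "'a l2 \<Rightarrow> 'a l2 \<Rightarrow> real" where "dist_l2 f g = norm (f - g)"

definition sgn_l2 :: "'a l2 \<Rightarrow> 'a l2" where "sgn_l2 f = inverse (norm f) *\<^sub>R f"

definition uniformity_l2 :: "('a l2 \<times> 'a l2) filter"
  where "uniformity_l2 = (INF e\<in>{0<..}. principal {(f, g). dist f g < e})"

definition open_l2 :: "'a l2 set \<Rightarrow> bool"
  where "open_l2 S \<longleftrightarrow> (\<forall>f\<in>S. \<forall>\<^sub>F (f', g) in uniformity. f' = f \<longrightarrow> g \<in> S)"

lemma rep_zero_l2: "AE x in lebesgue. rep_l2 (0 :: 'a l2) x = 0"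
  unfolding zero_l2_def by (rule rep_abs_l2[OF sq_integrable_zero])

lemma rep_plus_l2: "AE x in lebesgue. rep_l2 (f + g :: 'a l2) x = rep_l2 f x + rep_l2 g x"
  unfolding plus_l2_def by (intro rep_abs_l2 sq_integrable_add sq_integrable_rep_l2)

lemma rep_scaleC_l2: "AE x in lebesgue. rep_l2 (c *\<^sub>C f :: 'a l2) x = c * rep_l2 f x"
  unfolding scaleC_l2_def by (intro rep_abs_l2 sq_integrable_cmult sq_integrable_rep_l2)

lemma cinner_l2_cong:
  fixes f g :: "'a l2"
  assumes "AE x in lebesgue. rep_l2 f x * cnj (rep_l2 g x) = h x"
    and [measurable]: "h \<in> borel_measurable lebesgue"
  shows "cinner f g = (LINT x|lebesgue. h x)"
proof -
  have [measurable]: "rep_l2 f \<in> borel_measurable lebesgue" "rep_l2 g \<in> borel_measurable lebesgue"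
    using sq_integrable_rep_l2 by (auto simp: sq_integrable_def)
  show ?thesis
    unfolding cinner_l2_def by (rule integral_cong_AE) (use assms in measurable)
qed

instance
proof
  fix c d :: complex and r s :: real and f g h :: "'a l2"
  have [measurable]: "rep_l2 k \<in> borel_measurable lebesgue" for k :: "'a l2"
    using sq_integrable_rep_l2 by (auto simp: sq_integrable_def)
  note int = sq_integrable_mult_cnj[OF sq_integrable_rep_l2 sq_integrable_rep_l2]
  show C_add: "c *\<^sub>C (f + g) = c *\<^sub>C f + c *\<^sub>C g" for f g :: "'a l2"
    by (rule l2_eqI)
      (use rep_plus_l2[of f g] rep_plus_l2[of "c *\<^sub>C f" "c *\<^sub>C g"] rep_scaleC_l2[of c f]
        rep_scaleC_l2[of c g] rep_scaleC_l2[of c "f + g"] in eventually_elim, simp add: algebra_simps)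
  show add_C: "(c + d) *\<^sub>C f = c *\<^sub>C f + d *\<^sub>C f" for c d
    by (rule l2_eqI)
      (use rep_plus_l2[of "c *\<^sub>C f" "d *\<^sub>C f"] rep_scaleC_l2[of c f]
        rep_scaleC_l2[of d f] rep_scaleC_l2[of "c + d" f] in eventually_elim, simp add: algebra_simps)
  show C_C: "c *\<^sub>C d *\<^sub>C f = (c * d) *\<^sub>C f" for c d
    by (rule l2_eqI)
      (use rep_scaleC_l2[of d f] rep_scaleC_l2[of c "d *\<^sub>C f"]
        rep_scaleC_l2[of "c * d" f] in eventually_elim, simp)
  have C_one: "1 *\<^sub>C f = f" for f :: "'a l2"
    by (rule l2_eqI) (use rep_scaleC_l2[of 1 f] in eventually_elim, simp)
  show "complex_of_real r *\<^sub>C f = r *\<^sub>R f"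
    by (simp add: scaleR_l2_def)
  show "f + g + h = f + (g + h)"
    by (rule l2_eqI)
      (use rep_plus_l2[of f g] rep_plus_l2[of "f + g" h] rep_plus_l2[of g h]
        rep_plus_l2[of f "g + h"] in eventually_elim, simp)
  show "f + g = g + f"
    by (simp add: plus_l2_def add.commute)
  show "0 + f = f"
    by (rule l2_eqI) (use rep_zero_l2 rep_plus_l2[of 0 f] in eventually_elim, simp)
  show "- f + f = 0"
    unfolding uminus_l2_def
    by (rule l2_eqI)
      (use rep_zero_l2 rep_scaleC_l2[of "-1" f] rep_plus_l2[of "(-1) *\<^sub>C f" f] in eventually_elim, simp)
  show "f - g = f + - g"
    by (rule minus_l2_def)
  show "r *\<^sub>R (f + g) = r *\<^sub>R f + r *\<^sub>R g"
    unfolding scaleR_l2_def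
    by (rule l2_eqI)
      (use rep_plus_l2[of f g] rep_plus_l2[of "r *\<^sub>C f" "r *\<^sub>C g"] rep_scaleC_l2[of r f]
        rep_scaleC_l2[of r g] rep_scaleC_l2[of r "f + g"] in eventually_elim, simp add: algebra_simps)
  show "(r + s) *\<^sub>R f = r *\<^sub>R f + s *\<^sub>R f"
    by (simp add: scaleR_l2_def add_C)
  show "r *\<^sub>R s *\<^sub>R f = (r * s) *\<^sub>R f"
    by (simp add: scaleR_l2_def C_C)
  show "1 *\<^sub>R f = f"
    by (simp add: scaleR_l2_def C_one)
  show "dist f g = norm (f - g)"
    by (rule dist_l2_def)
  show "sgn f = inverse (norm f) *\<^sub>R f"
    by (rule sgn_l2_def)
  show "uniformity = (INF e\<in>{0<..}. principal {(f :: 'a l2, g). dist f g < e})"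
    by (rule uniformity_l2_def)
  show "open S \<longleftrightarrow> (\<forall>f\<in>S. \<forall>\<^sub>F (f', g) in uniformity. f' = f \<longrightarrow> g \<in> S)" for S :: "'a l2 set"
    by (rule open_l2_def)
  show sym: "cinner f g = cnj (cinner g f)" for f g :: "'a l2"
    unfolding cinner_l2_def
    by (subst Bochner_Integration.integral_cnj[symmetric]) (simp add: mult.commute)
  show add: "cinner (f + g) h = cinner f h + cinner g h"
  proof -
    have "cinner (f + g) h =
        (LINT x|lebesgue. rep_l2 f x * cnj (rep_l2 h x) + rep_l2 g x * cnj (rep_l2 h x))"
      by (rule cinner_l2_cong)
        (use rep_plus_l2[of f g] in eventually_elim, simp add: algebra_simps, measurable)
    also have "\<dots> = cinner f h + cinner g h"
      unfolding cinner_l2_def by (rule Bochner_Integration.integral_add[OF int int])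
    finally show ?thesis .
  qed
  show mult: "cinner (c *\<^sub>C f) g = c * cinner f g" for c
  proof -
    have "cinner (c *\<^sub>C f) g = (LINT x|lebesgue. c * (rep_l2 f x * cnj (rep_l2 g x)))"
      by (rule cinner_l2_cong)
        (use rep_scaleC_l2[of c f] in eventually_elim, simp, measurable)
    then show ?thesis by (simp add: cinner_l2_def)
  qed
  show "inner f g = Re (cinner f g)"
    by (rule inner_l2_def)
  show "inner f g = inner g f"
    unfolding inner_l2_def by (subst sym) simp
  show "inner (f + g) h = inner f h + inner g h"
    by (simp add: inner_l2_def add)
  show "inner (r *\<^sub>R f) g = r * inner f g"
    by (simp add: inner_l2_def scaleR_l2_def mult)
  have inner_self: "inner f f = (LINT x|lebesgue. (cmod (rep_l2 f x))\<^sup>2)"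
  proof -
    have "cinner f f = (LINT x|lebesgue. complex_of_real ((cmod (rep_l2 f x))\<^sup>2))"
      unfolding cinner_l2_def by (simp only: complex_norm_square)
    then show ?thesis by (simp add: inner_l2_def del: of_real_power)
  qed
  then show "0 \<le> inner f f" by simp
  show "inner f f = 0 \<longleftrightarrow> f = 0"
  proof
    assume "inner f f = 0"
    moreover have "integrable lebesgue (\<lambda>x. (cmod (rep_l2 f x))\<^sup>2)"
      using sq_integrable_rep_l2 by (auto simp: sq_integrable_def)
    ultimately have "AE x in lebesgue. (cmod (rep_l2 f x))\<^sup>2 = 0"
      using integral_nonneg_eq_0_iff_AE[of lebesgue "\<lambda>x. (cmod (rep_l2 f x))\<^sup>2"] inner_self by simp
    then have "AE x in lebesgue. rep_l2 f x = 0" by simp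
    with rep_zero_l2 have "AE x in lebesgue. rep_l2 f x = rep_l2 0 x"
      by eventually_elim simp
    then show "f = 0" by (rule l2_eqI)
  next
    assume "f = 0"
    then have "AE x in lebesgue. (cmod (rep_l2 f x))\<^sup>2 = 0"
      using rep_zero_l2 by (auto elim: eventually_mono)
    then show "inner f f = 0"
      unfolding inner_self by (rule integral_eq_zero_AE)
  qed
  show "norm f = sqrt (inner f f)"
    by (rule norm_l2_def)
qed

end

text \<open>
  \<open>L2_on S\<close> is \<open>L\<^sup>2(S)\<close>, identified with the square-integrable functions on the whole space that
  vanish outside \<open>S\<close>; \<open>l2_class S g\<close> is the class of the extension by zero of \<open>g\<close>, and is
  meaningful when \<open>g\<close> is square-integrable over \<open>S\<close>.
\<close>

definition L2_on :: "'a::euclidean_space set \<Rightarrow> 'a l2 set"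
  where "L2_on S = {f. AE x in lebesgue. x \<notin> S \<longrightarrow> rep_l2 f x = 0}"

definition l2_class :: "'a::euclidean_space set \<Rightarrow> ('a \<Rightarrow> complex) \<Rightarrow> 'a l2"
  where "l2_class S g = abs_l2 (\<lambda>x. if x \<in> S then g x else 0)"

definition L2_sym :: "'a::euclidean_space set \<Rightarrow> ('a \<times> 'a) l2 set"
  where "L2_sym S = {f \<in> L2_on (S \<times> S).
    AE (x, y) in lebesgue_on (S \<times> S). rep_l2 f (x, y) = rep_l2 f (y, x)}"

definition Lp_norm :: "'a measure \<Rightarrow> real \<Rightarrow> ('a \<Rightarrow> complex) \<Rightarrow> ennreal"
  where "Lp_norm M p f =
    (let I = (\<integral>\<^sup>+ x. ennreal (cmod (f x) powr p) \<partial>M)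
     in if I = \<infinity> then \<infinity> else ennreal (enn2real I powr (1 / p)))"

definition ess_range :: "'a measure \<Rightarrow> ('a \<Rightarrow> real) \<Rightarrow> real set"
  where "ess_range M f = {c. \<forall>e>0. emeasure M {x \<in> space M. \<bar>f x - c\<bar> < e} > 0}"

section \<open>The operator matrix\<close>

text \<open>The dimension is \<open>CARD('n)\<close>.\<close>

definition cube :: "real \<Rightarrow> (real ^ 'n) set"
  where "cube a = {x. \<forall>i. - a < x $ i \<and> x $ i < a}"

type_synonym 'n fock = "complex \<times> (real ^ 'n) l2 \<times> ((real ^ 'n) \<times> (real ^ 'n)) l2"

definition fock_space :: "real \<Rightarrow> ('n::finite) fock set"
  where "fock_space a = UNIV \<times> L2_on (cube a) \<times> L2_sym (cube a)"

definition H00 :: "real \<Rightarrow> complex \<Rightarrow> complex"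
  where "H00 w0 f0 = complex_of_real w0 * f0"

definition H01 :: "real \<Rightarrow> (real ^ 'n \<Rightarrow> complex) \<Rightarrow> (real ^ 'n) l2 \<Rightarrow> complex"
  where "H01 a v0 f1 = (LINT s|lebesgue_on (cube a). v0 s * rep_l2 f1 s)"

definition H11 :: "real \<Rightarrow> (real ^ 'n \<Rightarrow> real) \<Rightarrow> (real ^ 'n) l2 \<Rightarrow> (real ^ 'n) l2"
  where "H11 a w1 f1 = l2_class (cube a) (\<lambda>x. complex_of_real (w1 x) * rep_l2 f1 x)"

definition H12 :: "real \<Rightarrow> ((real ^ 'n) \<times> (real ^ 'n) \<Rightarrow> complex) \<Rightarrow>
    ((real ^ 'n) \<times> (real ^ 'n)) l2 \<Rightarrow> (real ^ 'n) l2"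
  where "H12 a v1 f2 =
    l2_class (cube a) (\<lambda>x. LINT s|lebesgue_on (cube a). v1 (x, s) * rep_l2 f2 (x, s))"

definition H22 :: "real \<Rightarrow> ((real ^ 'n) \<times> (real ^ 'n) \<Rightarrow> real) \<Rightarrow>
    ((real ^ 'n) \<times> (real ^ 'n)) l2 \<Rightarrow> ((real ^ 'n) \<times> (real ^ 'n)) l2"
  where "H22 a w2 f2 = l2_class (cube a \<times> cube a) (\<lambda>p. complex_of_real (w2 p) * rep_l2 f2 p)"

definition Hmat :: "real \<Rightarrow> real \<Rightarrow> (real ^ 'n \<Rightarrow> complex) \<Rightarrow> (real ^ 'n \<Rightarrow> real) \<Rightarrow>
    ((real ^ 'n) \<times> (real ^ 'n) \<Rightarrow> complex) \<Rightarrow> ((real ^ 'n) \<times> (real ^ 'n) \<Rightarrow> real) \<Rightarrow>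
    ('n::finite) fock \<Rightarrow> 'n fock"
  where "Hmat a w0 v0 w1 v1 w2 = (\<lambda>(f0, f1, f2).
    (H00 w0 f0 + H01 a v0 f1,
     adjoint_on (L2_on (cube a)) (H01 a v0) f0 + H11 a w1 f1 + H12 a v1 f2,
     adjoint_on (L2_sym (cube a)) (H12 a v1) f1 + H22 a w2 f2))"

definition Delta :: "real \<Rightarrow> (real ^ 'n \<Rightarrow> real) \<Rightarrow> ((real ^ 'n) \<times> (real ^ 'n) \<Rightarrow> complex) \<Rightarrow>
    ((real ^ 'n) \<times> (real ^ 'n) \<Rightarrow> real) \<Rightarrow> real ^ 'n \<Rightarrow> real \<Rightarrow> real"
  where "Delta a w1 v1 w2 x z = w1 x - z -
    1 / 2 * (LINT y|lebesgue_on (cube a). (cmod (v1 (x, y)))\<^sup>2 / (w2 (x, y) - z))"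

definition Sigma1 :: "real \<Rightarrow> ((real ^ 'n) \<times> (real ^ 'n) \<Rightarrow> real) \<Rightarrow> real set"
  where "Sigma1 a w2 = closure (w2 ` (cube a \<times> cube a))"

definition Sigma2 :: "real \<Rightarrow> (real ^ 'n \<Rightarrow> real) \<Rightarrow> ((real ^ 'n) \<times> (real ^ 'n) \<Rightarrow> complex) \<Rightarrow>
    ((real ^ 'n) \<times> (real ^ 'n) \<Rightarrow> real) \<Rightarrow> real set"
  where "Sigma2 a w1 v1 w2 = closure
    {z. z \<notin> Sigma1 a w2 \<and> 0 \<in> ess_range (lebesgue_on (cube a)) (\<lambda>x. Delta a w1 v1 w2 x z)}"

end

theory Submission
  imports Defs
begin

text \<open>
  Fix a complex number \<open>z\<close>. The question is when \<open>H - z\<close> is Fredholm.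

  Let \<open>z\<close> lie off \<open>\<Sigma>\<^sub>1\<close>. Then the last diagonal entry of \<open>H - z\<close>, multiplication by \<open>w\<^sub>2 - z\<close>, is
  invertible on symmetric functions, and elimination of the last component replaces the middle entry
  by the Schur complement \<open>w\<^sub>1 - z - H\<^sub>1\<^sub>2 (w\<^sub>2 - z)\<^sup>-\<^sup>1 H\<^sub>1\<^sub>2\<^sup>*\<close>. The adjoint of \<open>H\<^sub>1\<^sub>2\<close> sends \<open>f\<close> to the
  symmetrization of \<open>cnj (v\<^sub>1 (x, y)) f(x)\<close>, so the product has two halves. In one of them the factor
  \<open>f(x)\<close> leaves the integral, which makes this half a multiplication operator; together with \<open>w\<^sub>1 - z\<close>
  it is multiplication by \<open>\<Delta>(\<cdot>; z)\<close> (\<open>row_integral_mul_row_extend\<close>, \<open>schur_complement\<close>). The other half is the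
  integral operator with kernel \<open>v\<^sub>1(x, s) cnj (v\<^sub>1(s, x)) / (2 (w\<^sub>2(x, s) - z))\<close>. Since
  \<open>1 / (2 + \<epsilon>) + 1 / (2 + 4 / \<epsilon>) = 1 / 2\<close>, the two moment conditions on \<open>v\<^sub>1\<close> make
  this kernel square-integrable (\<open>swapped_product_integrable\<close>), and the operator is Hilbert--Schmidt.
  The first component of \<open>H\<close> contributes only finite rank. After the elimination \<open>H - z\<close> is thus a compact
  perturbation of multiplication by \<open>\<Delta>(\<cdot>; z)\<close>, and it is Fredholm if and only if \<open>\<Delta>(\<cdot>; z)\<close> is essentially bounded
  away from \<open>0\<close> (\<open>block_fredholm\<close>, \<open>block_not_fredholm\<close>). For nonreal \<open>z\<close> this always holds, as
  \<open>\<bar>Im \<Delta>(x; z)\<bar> \<ge> \<bar>Im z\<bar>\<close> (\<open>symbol_nonreal\<close>); for real \<open>z\<close> it says that \<open>0\<close> is not in the essential range.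
  Off \<open>\<Sigma>\<^sub>1\<close> the symbol is locally Lipschitz in \<open>z\<close>, uniformly in \<open>x\<close>, so taking the closure in the definition
  of \<open>\<Sigma>\<^sub>2\<close> adds no further points off \<open>\<Sigma>\<^sub>1\<close> (\<open>Sigma2_symbol_degenerate\<close>).

  Let \<open>z\<close> lie in \<open>\<Sigma>\<^sub>1\<close>. Symmetric functions \<open>f\<close> that live on a tiny set where \<open>w\<^sub>2\<close> is close to \<open>z\<close> make
  \<open>(w\<^sub>2 - z) f\<close> small. They also make \<open>H\<^sub>1\<^sub>2 f\<close> small if the slices of the set are thin, because the
  functions \<open>v\<^sub>1(x, \<cdot>)\<close> are uniformly square-integrable (\<open>thin_set_in_open\<close>). This is an
  infinite-dimensional supply of vectors on which \<open>H - z\<close> is small (\<open>Hop_not_fredholm_two_particle\<close>).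

  Two facts about operators connect this to the definition of Fredholm operators. A bijection with bounded
  inverse stays Fredholm under a finite-rank perturbation (\<open>fredholm_on_finite_rank_perturbation\<close>);
  the compact part is absorbed by splitting it into a finite-rank part and a part of small norm. A
  symmetric operator that is arbitrarily small on unit vectors orthogonal to any given finite set has a
  range of infinite codimension (\<open>not_fredholm_on_singular\<close>).
\<close>

section \<open>Complex inner product spaces and bounded linear maps\<close>

lemma cinner_add_right: "cinner x (y + z) = cinner x y + cinner x (z :: 'a::complex_inner)"
  by (metis cinner_add_left cinner_commute complex_cnj_add)

lemma cinner_scaleC_right: "cinner x (c *\<^sub>C y) = cnj c * cinner x (y :: 'a::complex_inner)"
  by (metis cinner_scaleC_left cinner_commute complex_cnj_mult)

lemma cinner_zero_left [simp]: "cinner 0 (y :: 'a::complex_inner) = 0"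
  using cinner_add_left[of 0 0 y] by simp

lemma cinner_zero_right [simp]: "cinner x (0 :: 'a::complex_inner) = 0"
  using cinner_add_right[of x 0 0] by simp

lemma cinner_minus_left: "cinner (- x) (y :: 'a::complex_inner) = - cinner x y"
  using cinner_add_left[of x "- x" y] by (simp add: eq_neg_iff_add_eq_0 add.commute)

lemma cinner_diff_left: "cinner (x - y) (z :: 'a::complex_inner) = cinner x z - cinner y z"
  using cinner_add_left[of x "- y" z] by (simp add: cinner_minus_left)

lemma cinner_sum_left: "cinner (\<Sum>i\<in>I. f i) (y :: 'a::complex_inner) = (\<Sum>i\<in>I. cinner (f i) y)"
  by (induction I rule: infinite_finite_induct) (auto simp: cinner_add_left)

lemma cinner_self: "cinner x (x :: 'a::complex_inner) = complex_of_real ((norm x)\<^sup>2)"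
proof (rule complex_eqI)
  show "Re (cinner x x) = Re (complex_of_real ((norm x)\<^sup>2))"
    by (simp add: inner_eq_Re_cinner[symmetric] power2_norm_eq_inner del: of_real_power)
  have "Im (cinner x x) = - Im (cinner x x)"
    by (metis cinner_commute cnj.sel(2))
  then show "Im (cinner x x) = Im (complex_of_real ((norm x)\<^sup>2))"
    by (simp del: of_real_power)
qed

lemma cinner_self_eq_0_iff: "cinner x (x :: 'a::complex_inner) = 0 \<longleftrightarrow> x = 0"
  by (simp add: cinner_self)

lemma norm_scaleC: "norm (c *\<^sub>C (x :: 'a::complex_inner)) = cmod c * norm x"
proof -
  have "complex_of_real ((norm (c *\<^sub>C x))\<^sup>2) = complex_of_real ((cmod c * norm x)\<^sup>2)"
    unfolding cinner_self[symmetric] cinner_scaleC_left cinner_scaleC_right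
    using complex_norm_square[of c]
    by (simp add: cinner_self power_mult_distrib mult.assoc[symmetric] mult.commute[of "cnj c"])
  then show ?thesis
    unfolding of_real_eq_iff by (simp add: power2_eq_iff_nonneg)
qed

lemma scaleR_scaleC: "r *\<^sub>R (x :: 'a::complex_inner) = complex_of_real r *\<^sub>C x"
  by (simp add: scaleC_of_real)

lemma cmod_cinner_le: "cmod (cinner x y) \<le> norm x * norm (y :: 'a::complex_inner)"
proof (cases "cinner x y = 0")
  case False
  \<comment> \<open>Rotating \<open>x\<close> makes the inner product real, and then the real Cauchy--Schwarz inequality applies.\<close>
  define c where "c = cnj (cinner x y) / cmod (cinner x y)"
  have "c * cinner x y = complex_of_real (cmod (cinner x y))"
    using False complex_norm_square[of "cinner x y"]
    by (simp add: c_def field_simps power2_eq_square)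
  then have "cmod (cinner x y) = inner (c *\<^sub>C x) y"
    by (simp add: inner_eq_Re_cinner cinner_scaleC_left)
  also have "\<dots> \<le> norm (c *\<^sub>C x) * norm y"
    by (rule norm_cauchy_schwarz)
  also have "\<dots> = norm x * norm y"
    using False by (simp add: norm_scaleC c_def norm_divide)
  finally show ?thesis .
qed simp

lemma orthogonal_norm_add:
  fixes x y :: "'a::complex_inner"
  assumes "cinner x y = 0"
  shows "(norm (x + y))\<^sup>2 = (norm x)\<^sup>2 + (norm y)\<^sup>2"
proof -
  have "inner x y = 0" using assms by (simp add: inner_eq_Re_cinner)
  then show ?thesis
    by (simp add: power2_norm_eq_inner inner_add_left inner_add_right inner_commute)
qed

definition bounded_clinear :: "('a::complex_inner \<Rightarrow> 'b::complex_inner) \<Rightarrow> bool"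
  where "bounded_clinear T \<longleftrightarrow> bounded_linear T \<and> (\<forall>c x. T (c *\<^sub>C x) = c *\<^sub>C T x)"

lemma bounded_clinearI:
  assumes add: "\<And>x y. T (x + y) = T x + T y" and scale: "\<And>c x. T (c *\<^sub>C x) = c *\<^sub>C T x"
    and bound: "\<And>x. norm (T x) \<le> C * norm x"
  shows "bounded_clinear T"
  unfolding bounded_clinear_def
proof (intro conjI allI)
  show "bounded_linear T"
    by (rule bounded_linear_intro[where K = C])
      (use add scale bound in \<open>auto simp: scaleR_scaleC mult.commute\<close>)
qed (rule scale)

lemma bounded_clinear_bounded_linear: "bounded_clinear T \<Longrightarrow> bounded_linear T"
  by (simp add: bounded_clinear_def)

lemma bounded_clinear_scaleC: "bounded_clinear T \<Longrightarrow> T (c *\<^sub>C x) = c *\<^sub>C T x"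
  by (simp add: bounded_clinear_def)

lemma bounded_clinear_add: "bounded_clinear T \<Longrightarrow> T (x + y) = T x + T y"
  by (simp add: bounded_clinear_def linear_simps)

lemma bounded_clinear_diff: "bounded_clinear T \<Longrightarrow> T (x - y) = T x - T y"
  by (simp add: bounded_clinear_def linear_simps)

lemma bounded_clinear_minus: "bounded_clinear T \<Longrightarrow> T (- x) = - T x"
  by (simp add: bounded_clinear_def linear_simps)

lemma bounded_clinear_0 [simp]: "bounded_clinear T \<Longrightarrow> T 0 = 0"
  by (simp add: bounded_clinear_def linear_simps)

lemma bounded_clinear_bound:
  assumes "bounded_clinear T"
  obtains C where "C > 0" "\<And>x. norm (T x) \<le> C * norm x"
  using bounded_linear.pos_bounded[OF bounded_clinear_bounded_linear[OF assms]]
  by (metis mult.commute)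

lemma bounded_clinear_zero: "bounded_clinear (\<lambda>_. 0)"
  by (rule bounded_clinearI[where C = 0]) auto

lemma bounded_clinear_plus:
  "bounded_clinear S \<Longrightarrow> bounded_clinear T \<Longrightarrow> bounded_clinear (\<lambda>x. S x + T x)"
  by (auto simp: bounded_clinear_def bounded_linear_add scaleC_add_right)

lemma bounded_clinear_sub:
  "bounded_clinear S \<Longrightarrow> bounded_clinear T \<Longrightarrow> bounded_clinear (\<lambda>x. S x - T x)"
  by (auto simp: bounded_clinear_def bounded_linear_sub complex_vector.scale_right_diff_distrib)

lemma bounded_clinear_compose:
  "bounded_clinear S \<Longrightarrow> bounded_clinear T \<Longrightarrow> bounded_clinear (\<lambda>x. S (T x))"
  by (auto simp: bounded_clinear_def intro: bounded_linear_compose)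

lemma bounded_clinear_id: "bounded_clinear (\<lambda>x. x)"
  by (rule bounded_clinearI[where C = 1]) auto

lemma bounded_clinear_scale:
  "bounded_clinear T \<Longrightarrow> bounded_clinear (\<lambda>x. c *\<^sub>C T x)"
proof (rule bounded_clinear_compose[of "(*\<^sub>C) c"])
  show "bounded_clinear ((*\<^sub>C) c :: 'b \<Rightarrow> 'b)"
    by (rule bounded_clinearI[where C = "cmod c"])
      (auto simp: scaleC_add_right norm_scaleC scaleC_scaleC mult.commute)
qed

lemma bounded_clinear_cinner: "bounded_clinear (\<lambda>x. cinner x y)"
  by (rule bounded_clinearI[where C = "norm y"])
    (auto simp: cinner_add_left cinner_scaleC_left scaleC_complex_def cmod_cinner_le mult.commute[of "norm y"])

lemma bounded_clinear_scaleC_left: "bounded_clinear (\<lambda>c :: complex. c *\<^sub>C y)"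
  by (rule bounded_clinearI[where C = "norm y"])
    (auto simp: scaleC_add_left scaleC_complex_def scaleC_scaleC norm_scaleC)

lemma bounded_clinear_fst: "bounded_clinear (fst :: 'a::complex_inner \<times> 'b::complex_inner \<Rightarrow> 'a)"
  by (auto simp: bounded_clinear_def bounded_linear_fst scaleC_prod_def)

lemma bounded_clinear_snd: "bounded_clinear (snd :: 'a::complex_inner \<times> 'b::complex_inner \<Rightarrow> 'b)"
  by (auto simp: bounded_clinear_def bounded_linear_snd scaleC_prod_def)

lemma bounded_clinear_Pair:
  "bounded_clinear S \<Longrightarrow> bounded_clinear T \<Longrightarrow> bounded_clinear (\<lambda>x. (S x, T x))"
  by (auto simp: bounded_clinear_def scaleC_prod_def intro: bounded_linear_Pair)

lemma bounded_clinear_complex_mult: "bounded_clinear (\<lambda>x :: complex. c * x)"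
  using bounded_clinear_scale[OF bounded_clinear_id[where ?'a = complex], of c]
  by (simp add: scaleC_complex_def)

lemmas bounded_clinear_intros =
  bounded_clinear_zero bounded_clinear_plus bounded_clinear_sub bounded_clinear_id
  bounded_clinear_scale bounded_clinear_Pair bounded_clinear_fst bounded_clinear_snd
  bounded_clinear_compose[OF bounded_clinear_fst] bounded_clinear_compose[OF bounded_clinear_snd]
  bounded_clinear_cinner bounded_clinear_compose[OF bounded_clinear_cinner]
  bounded_clinear_compose[OF bounded_clinear_scaleC_left]

lemma continuous_on_bounded_clinear: "bounded_clinear T \<Longrightarrow> continuous_on S T"
  by (simp add: bounded_clinear_bounded_linear linear_continuous_on)

lemma bounded_clinear_span_image:
  assumes "bounded_clinear T"
  shows "cspan (T ` B) = T ` cspan B"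
proof -
  have "Vector_Spaces.linear scaleC scaleC T"
    using assms by unfold_locales (auto simp: bounded_clinear_add bounded_clinear_scaleC)
  then show ?thesis
    using vector_space_pair.linear_span_image[of scaleC scaleC T B]
    by (simp add: vector_space_pair_def complex_vector.vector_space_axioms cspan_def)
qed

section \<open>Finite-dimensional subspaces and finite-rank perturbations\<close>

text \<open>
  If \<open>c\<close> has a positive distance from \<open>S\<close>, then the coefficient of \<open>c\<close> is controlled by the norm of the
  vector, so along a convergent sequence the coefficients converge as well.
\<close>

lemma closed_subspace_extend:
  fixes S :: "'a::complex_inner set"
  assumes S: "complex_vector.subspace S" and cl: "closed S"
  shows "closed {x. \<exists>k. x - k *\<^sub>C c \<in> S}"
proof (cases "c \<in> S")
  case True
  have "{x. \<exists>k. x - k *\<^sub>C c \<in> S} = S"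
    using True complex_vector.subspace_add[OF S] complex_vector.subspace_scale[OF S]
      complex_vector.subspace_diff[OF S]
    by (auto intro!: exI[of _ 0]) (metis diff_add_cancel)
  with cl show ?thesis by simp
next
  case False
  then obtain e where e: "e > 0" "\<And>s. s \<in> S \<Longrightarrow> e \<le> dist s c"
  proof -
    obtain e where "e > 0" "ball c e \<subseteq> - S"
      using False cl open_contains_ball[of "- S"] by (auto simp: open_Compl)
    then show ?thesis
      using that[of e] by (force simp: dist_commute not_less[symmetric])
  qed
  have lower: "cmod k * e \<le> norm y" if "y - k *\<^sub>C c \<in> S" for y k
  proof (cases "k = 0")
    case False
    have "inverse k *\<^sub>C (k *\<^sub>C c - y) \<in> S"
      using that complex_vector.subspace_scale[OF S] complex_vector.subspace_neg[OF S]
      by (metis minus_diff_eq)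
    also have "inverse k *\<^sub>C (k *\<^sub>C c - y) = c - inverse k *\<^sub>C y"
      using False by (simp add: complex_vector.scale_right_diff_distrib)
    finally have "e \<le> norm (inverse k *\<^sub>C y)"
      using e(2) by (fastforce simp: dist_norm)
    then show ?thesis
      using False by (simp add: norm_scaleC norm_inverse norm_divide field_simps)
  qed simp
  show ?thesis
  proof (unfold closed_sequential_limits, intro allI impI, elim conjE)
    fix x l assume "\<forall>n. x n \<in> {x. \<exists>k. x - k *\<^sub>C c \<in> S}" and x: "x \<longlonglongrightarrow> l"
    then obtain k where k: "\<And>n. x n - k n *\<^sub>C c \<in> S" by (auto simp: choice_iff)
    have "cmod (k m - k n) * e \<le> norm (x m - x n)" for m n
      using complex_vector.subspace_diff[OF S k[of m] k[of n]]
      by (intro lower) (simp add: algebra_simps complex_vector.scale_left_diff_distrib)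
    then have bnd: "dist (k m) (k n) \<le> dist (x m) (x n) / e" for m n
      using e(1) by (simp add: dist_norm field_simps)
    have "Cauchy k"
    proof (rule metric_CauchyI)
      fix d :: real assume "d > 0"
      then obtain N where "\<forall>m\<ge>N. \<forall>n\<ge>N. dist (x m) (x n) < d * e"
        using metric_CauchyD[OF LIMSEQ_imp_Cauchy[OF x], of "d * e"] e(1) by auto
      then show "\<exists>M. \<forall>m\<ge>M. \<forall>n\<ge>M. dist (k m) (k n) < d"
        using bnd e(1) by (metis le_less_trans pos_divide_less_eq)
    qed
    then obtain \<kappa> where "k \<longlonglongrightarrow> \<kappa>" using Cauchy_convergent convergent_def by blast
    then have "(\<lambda>n. x n - k n *\<^sub>C c) \<longlonglongrightarrow> l - \<kappa> *\<^sub>C c"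
      by (intro tendsto_diff x bounded_linear.tendsto[OF bounded_clinear_bounded_linear[OF bounded_clinear_scaleC_left]])
    then have "l - \<kappa> *\<^sub>C c \<in> S"
      by (rule closed_sequentially[OF cl k])
    then show "l \<in> {x. \<exists>k. x - k *\<^sub>C c \<in> S}" by blast
  qed
qed

lemma closed_cspan_finite:
  assumes "finite B"
  shows "closed (cspan (B :: 'a::complex_inner set))"
  using assms
proof induction
  case empty
  then show ?case by (simp add: complex_vector.span_empty)
next
  case (insert b B)
  then show ?case
    unfolding complex_vector.span_insert
    by (intro closed_subspace_extend complex_vector.subspace_span)
qed

text \<open>
  A vector \<open>u = T g\<close> lies in the range of \<open>T + F\<close> exactly if the equation can be solved with a
  correction \<open>g - f\<close> from the finite-dimensional space \<open>T\<^sup>-\<^sup>1 (ran F)\<close>. The range is thus the preimage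
  of a finite-dimensional, hence closed, space under a continuous map.
\<close>

lemma fredholm_on_finite_rank_perturbation:
  fixes T F :: "'a::complex_inner \<Rightarrow> 'a"
  assumes U: "complex_vector.subspace U"
    and T: "bounded_clinear T" and F: "bounded_clinear F"
    and TU: "\<And>f. f \<in> U \<Longrightarrow> T f \<in> U"
    and onto: "\<And>g. g \<in> U \<Longrightarrow> \<exists>f\<in>U. T f = g"
    and below: "\<And>f. f \<in> U \<Longrightarrow> norm f \<le> C * norm (T f)"
    and B: "finite B" "B \<subseteq> U" and FB: "\<And>f. f \<in> U \<Longrightarrow> F f \<in> cspan B"
  shows "fredholm_on U (\<lambda>f. T f + F f)"
proof -
  define A where "A = (\<lambda>f. T f + F f)"
  have A: "bounded_clinear A" unfolding A_def by (intro bounded_clinear_intros T F)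
  have inj: "f = g" if "f \<in> U" "g \<in> U" "T f = T g" for f g
    using below[OF complex_vector.subspace_diff[OF U that(1,2)]] that
    by (simp add: bounded_clinear_diff[OF T])
  define S where "S = inv_into U T"
  have S: "S g \<in> U" "T (S g) = g" if "g \<in> U" for g
    using onto[OF that] unfolding S_def by (metis image_eqI inv_into_into f_inv_into_f)+
  define B' where "B' = S ` B"
  have B': "finite B'" "B' \<subseteq> U" "T ` B' = B"
    using B S by (force simp: B'_def)+
  have spU: "cspan B \<subseteq> U" "cspan B' \<subseteq> U"
    using complex_vector.span_minimal[OF _ U] B B' by blast+
  have spT: "cspan B = T ` cspan B'"
    using bounded_clinear_span_image[OF T, of B'] B'(3) by simp
  have "{f \<in> U. A f = 0} \<subseteq> cspan B'"
  proof clarify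
    fix f assume f: "f \<in> U" "A f = 0"
    obtain s where s: "s \<in> cspan B'" "F f = T s" using FB[OF f(1)] spT by auto
    then have "- s \<in> cspan B'" by (rule_tac complex_vector.span_neg)
    moreover have "T f = T (- s)"
      using f(2) s(2) by (simp add: A_def bounded_clinear_minus[OF T] eq_neg_iff_add_eq_0)
    ultimately show "f \<in> cspan B'"
      using inj[of f "- s"] f(1) spU by auto
  qed
  moreover have "U \<subseteq> cspan (A ` U \<union> B)"
  proof
    fix g assume "g \<in> U"
    then obtain f where f: "f \<in> U" "T f = g" using onto by blast
    have "A f \<in> cspan (A ` U \<union> B)" using f by (intro complex_vector.span_base) auto
    moreover have "F f \<in> cspan (A ` U \<union> B)"
      using FB[OF f(1)] complex_vector.span_mono[of B "A ` U \<union> B"] by auto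
    moreover have "g = A f - F f" using f by (simp add: A_def)
    ultimately show "g \<in> cspan (A ` U \<union> B)"
      by (simp only: complex_vector.span_diff)
  qed
  moreover have "closedin (top_of_set U) (A ` U)"
  proof -
    have lip: "norm (S u - S v) \<le> C * norm (u - v)" if "u \<in> U" "v \<in> U" for u v
      using below[OF complex_vector.subspace_diff[OF U S(1) S(1)], of u v] that S
      by (simp add: bounded_clinear_diff[OF T])
    have "continuous_on U S"
    proof (rule continuous_onI)
      fix x :: 'a and e :: real assume x: "x \<in> U" "e > 0"
      have "dist (S x') (S x) \<le> e" if "x' \<in> U" "dist x' x < e / (\<bar>C\<bar> + 1)" for x'
      proof -
        have "dist (S x') (S x) \<le> C * dist x' x"
          using lip[OF that(1) x(1)] by (simp add: dist_norm)
        also have "\<dots> \<le> (\<bar>C\<bar> + 1) * dist x' x"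
          by (intro mult_right_mono) auto
        also have "\<dots> \<le> e"
          using that(2) by (simp add: field_simps)
        finally show ?thesis .
      qed
      then show "\<exists>d>0. \<forall>x'\<in>U. dist x' x < d \<longrightarrow> dist (S x') (S x) \<le> e"
        using x by (intro exI[of _ "e / (\<bar>C\<bar> + 1)"]) (auto intro!: divide_pos_pos)
    qed
    then have cont: "continuous_on U (\<lambda>u. F (S u))"
      by (rule continuous_on_compose2[OF continuous_on_bounded_clinear[OF F, of UNIV]]) auto
    have "A ` U = U \<inter> (\<lambda>u. F (S u)) -` cspan (A ` B')"
    proof (intro equalityI subsetI)
      fix u assume "u \<in> A ` U"
      then obtain f where f: "f \<in> U" "u = A f" by blast
      obtain s where s: "s \<in> cspan B'" "F f = T s" using FB[OF f(1)] spT by auto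
      have "u = T (f + s)" using f s by (simp add: A_def bounded_clinear_add[OF T])
      moreover have fs: "f + s \<in> U" using f s spU complex_vector.subspace_add[OF U] by blast
      ultimately have u: "u \<in> U" "S u = f + s" using TU S inj by metis+
      have "F (S u) = A s" using u(2) s(2) by (simp add: A_def bounded_clinear_add[OF F])
      then show "u \<in> U \<inter> (\<lambda>u. F (S u)) -` cspan (A ` B')"
        using u s(1) bounded_clinear_span_image[OF A, of B'] by auto
    next
      fix u assume u: "u \<in> U \<inter> (\<lambda>u. F (S u)) -` cspan (A ` B')"
      then obtain s where s: "s \<in> cspan B'" "F (S u) = A s"
        using bounded_clinear_span_image[OF A, of B'] by auto
      have "A (S u - s) = u"
        using s u S[of u] by (simp add: A_def bounded_clinear_diff T F)
      moreover have "S u - s \<in> U" using s u S[of u] spU complex_vector.subspace_diff[OF U] by blast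
      ultimately show "u \<in> A ` U" by (metis image_eqI)
    qed
    then show ?thesis
      using continuous_closedin_preimage[OF cont closed_cspan_finite[of "A ` B'"]] B'(1) by simp
  qed
  ultimately show ?thesis
    unfolding fredholm_on_def A_def[symmetric] using B B' by blast
qed

lemma fredholm_on_cong:
  assumes "\<And>f. f \<in> U \<Longrightarrow> A f = A' f"
  shows "fredholm_on U A = fredholm_on U A'"
proof -
  have "{f \<in> U. A f = 0} = {f \<in> U. A' f = 0}" "A ` U = A' ` U"
    using assms by auto
  then show ?thesis by (simp add: fredholm_on_def)
qed

section \<open>Infinite-dimensional subspaces and singular sequences\<close>

text \<open>
  Infinite-dimensional spaces serve as a supply of singular vectors: finitely many linear conditions on
  such a space leave a nonzero vector.
\<close>

definition inf_dim :: "'a::complex_inner set \<Rightarrow> bool"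
  where "inf_dim V \<longleftrightarrow> \<not> (\<exists>B. finite B \<and> V \<subseteq> cspan B)"

lemma inf_dim_orthogonal_sequence:
  fixes g :: "nat \<Rightarrow> 'a::complex_inner"
  assumes orth: "\<And>i j. i \<noteq> j \<Longrightarrow> cinner (g i) (g j) = 0" and nz: "\<And>i. g i \<noteq> 0"
    and V: "range g \<subseteq> V"
  shows "inf_dim V"
  unfolding inf_dim_def
proof (intro notI, elim exE conjE)
  fix B assume B: "finite B" "V \<subseteq> cspan B"
  have inj: "inj g"
    using orth nz by (metis cinner_self_eq_0_iff injI)
  have "\<not> complex_vector.dependent (range g)"
    unfolding complex_vector.dependent_def
  proof (intro notI, elim bexE imageE)
    fix a i assume "a \<in> cspan (range g - {a})" "a = g i"
    then have "g i \<in> cspan (range g - {g i})" by simp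
    then have "cinner (g i) (g i) = 0"
    proof (rule complex_vector.span_induct[where P = "\<lambda>x. cinner x (g i) = 0"])
      show "complex_vector.subspace {x. cinner x (g i) = 0}"
        by (auto simp: complex_vector.subspace_def cinner_add_left cinner_scaleC_left)
      show "cinner x (g i) = 0" if "x \<in> range g - {g i}" for x
        using that orth by (metis Diff_iff imageE insertI1)
    qed
    then show False using nz cinner_self_eq_0_iff by blast
  qed
  then have "finite (range g)"
    using complex_vector.independent_span_bound[OF B(1)] B(2) V by blast
  then show False using inj finite_imageD by blast
qed

lemma inf_dim_mono: "inf_dim V \<Longrightarrow> V \<subseteq> W \<Longrightarrow> inf_dim W"
  unfolding inf_dim_def by blast

lemma inf_dim_nonzero:
  assumes "inf_dim V"
  obtains v where "v \<in> V" "v \<noteq> 0"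
proof -
  have "\<not> V \<subseteq> cspan {}" using assms unfolding inf_dim_def by blast
  then show ?thesis using that by (auto simp: complex_vector.span_empty)
qed

lemma inf_dim_codim_one:
  assumes "inf_dim V" and "V \<subseteq> cspan (insert v V')"
  shows "inf_dim V'"
  unfolding inf_dim_def
proof (intro notI, elim exE conjE)
  fix B assume B: "finite B" "V' \<subseteq> cspan B"
  have "insert v V' \<subseteq> cspan (insert v B)"
    using B(2) complex_vector.span_mono[of B "insert v B"] complex_vector.span_base[of v "insert v B"]
    by auto
  then have "cspan (insert v V') \<subseteq> cspan (insert v B)"
    by (simp add: complex_vector.span_minimal complex_vector.subspace_span)
  with assms B show False unfolding inf_dim_def by (meson finite_insert order_trans)
qed

lemma subspace_bounded_clinear_kernel:
  assumes "complex_vector.subspace V" "bounded_clinear \<phi>"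
  shows "complex_vector.subspace {f \<in> V. \<phi> f = 0}"
  using assms(1)
  by (auto simp: complex_vector.subspace_def bounded_clinear_add[OF assms(2)]
      bounded_clinear_scaleC[OF assms(2)] bounded_clinear_0[OF assms(2)])

lemma inf_dim_kernel:
  fixes \<phi> :: "'a::complex_inner \<Rightarrow> complex"
  assumes V: "complex_vector.subspace V" "inf_dim V" and \<phi>: "bounded_clinear \<phi>"
  shows "inf_dim {f \<in> V. \<phi> f = 0}"
proof (cases "\<exists>v\<in>V. \<phi> v \<noteq> 0")
  case False
  then have "{f \<in> V. \<phi> f = 0} = V" by auto
  with V show ?thesis by simp
next
  case True
  then obtain v where v: "v \<in> V" "\<phi> v \<noteq> 0" by blast
  have "V \<subseteq> cspan (insert v {f \<in> V. \<phi> f = 0})"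
  proof
    fix f assume f: "f \<in> V"
    define k where "k = \<phi> f / \<phi> v"
    have "f - k *\<^sub>C v \<in> V"
      using f v V(1) by (simp add: complex_vector.subspace_diff complex_vector.subspace_scale)
    moreover have "\<phi> (f - k *\<^sub>C v) = 0"
      using v by (simp add: bounded_clinear_diff[OF \<phi>] bounded_clinear_scaleC[OF \<phi>] scaleC_complex_def k_def)
    ultimately have "f - k *\<^sub>C v \<in> cspan {f \<in> V. \<phi> f = 0}"
      by (intro complex_vector.span_base) simp
    then show "f \<in> cspan (insert v {f \<in> V. \<phi> f = 0})"
      unfolding complex_vector.span_insert by blast
  qed
  with V(2) show ?thesis by (rule inf_dim_codim_one)
qed

lemma inf_dim_common_kernel:
  fixes \<Phi> :: "('a::complex_inner \<Rightarrow> complex) set"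
  assumes "finite \<Phi>" "complex_vector.subspace V" "inf_dim V" "\<And>\<phi>. \<phi> \<in> \<Phi> \<Longrightarrow> bounded_clinear \<phi>"
  shows "\<exists>f\<in>V. f \<noteq> 0 \<and> (\<forall>\<phi>\<in>\<Phi>. \<phi> f = 0)"
  using assms
proof (induction arbitrary: V rule: finite_induct)
  case empty
  then show ?case using inf_dim_nonzero by (metis empty_iff)
next
  case (insert \<phi> \<Phi>)
  have "\<exists>f\<in>{f \<in> V. \<phi> f = 0}. f \<noteq> 0 \<and> (\<forall>\<phi>\<in>\<Phi>. \<phi> f = 0)"
    using insert.prems
    by (intro insert.IH subspace_bounded_clinear_kernel inf_dim_kernel) auto
  then show ?case by auto
qed

text \<open>
  The range of a Fredholm operator has finite codimension and hence cannot avoid an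
  infinite-dimensional space.
\<close>

lemma inf_dim_finite_codim:
  assumes "finite B" "complex_vector.subspace R" "complex_vector.subspace V" "inf_dim V"
    "V \<subseteq> cspan (R \<union> B)"
  shows "inf_dim (V \<inter> R)"
  using assms
proof (induction arbitrary: V rule: finite_induct)
  case empty
  then have "V \<inter> R = V" by (auto simp: complex_vector.span_eq_iff[THEN iffD2])
  with empty show ?case by simp
next
  case (insert b B)
  define V' where "V' = V \<inter> cspan (R \<union> B)"
  have "inf_dim V'"
  proof (cases "V \<subseteq> cspan (R \<union> B)")
    case True
    then show ?thesis using insert.prems by (simp add: V'_def Int_absorb2)
  next
    case False
    then obtain v where v: "v \<in> V" "v \<notin> cspan (R \<union> B)" by blast
    have dec: "\<exists>k. u - k *\<^sub>C b \<in> cspan (R \<union> B)" if "u \<in> V" for u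
      using that insert.prems(4) by (auto simp: complex_vector.span_insert)
    obtain k where k: "v - k *\<^sub>C b \<in> cspan (R \<union> B)" using dec[OF v(1)] by blast
    have k0: "k \<noteq> 0" using k v by auto
    have "V \<subseteq> cspan (insert v V')"
    proof
      fix u assume u: "u \<in> V"
      obtain l where l: "u - l *\<^sub>C b \<in> cspan (R \<union> B)" using dec[OF u] by blast
      have "u - l *\<^sub>C b - (l / k) *\<^sub>C (v - k *\<^sub>C b) \<in> cspan (R \<union> B)"
        by (intro complex_vector.span_diff complex_vector.span_scale k l)
      also have "u - l *\<^sub>C b - (l / k) *\<^sub>C (v - k *\<^sub>C b) = u - (l / k) *\<^sub>C v"
        using k0 by (simp add: complex_vector.scale_right_diff_distrib)
      finally have "u - (l / k) *\<^sub>C v \<in> V'"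
        unfolding V'_def using u v(1) insert.prems(2)
        by (simp add: complex_vector.subspace_diff complex_vector.subspace_scale)
      then have "u - (l / k) *\<^sub>C v \<in> cspan V'"
        by (rule complex_vector.span_base)
      then show "u \<in> cspan (insert v V')"
        unfolding complex_vector.span_insert by blast
    qed
    with insert.prems(3) show ?thesis by (rule inf_dim_codim_one)
  qed
  moreover have "complex_vector.subspace V'"
    unfolding V'_def by (intro complex_vector.subspace_inter insert.prems complex_vector.subspace_span)
  ultimately have "inf_dim (V' \<inter> R)"
    by (intro insert.IH insert.prems) (auto simp: V'_def)
  then show ?case by (rule inf_dim_mono) (auto simp: V'_def)
qed

text \<open>
  The prescribed finite set in the hypothesis on \<open>A\<close> is used for the part of the sequence that has
  already been chosen.
\<close>

lemma orthonormal_singular_sequence: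
  fixes A :: "'a::complex_inner \<Rightarrow> 'a"
  assumes U: "complex_vector.subspace U" and A: "bounded_clinear A"
    and sing: "\<And>F \<epsilon>. finite F \<Longrightarrow> F \<subseteq> U \<Longrightarrow> \<epsilon> > 0 \<Longrightarrow>
      \<exists>e\<in>U. e \<noteq> 0 \<and> (\<forall>h\<in>F. cinner e h = 0) \<and> norm (A e) \<le> \<epsilon> * norm e"
    and d: "\<And>k. \<delta> k > 0"
  shows "\<exists>e. \<forall>k :: nat. e k \<in> U \<and> norm (e k) = 1 \<and> (\<forall>i<k. cinner (e k) (e i) = 0) \<and> norm (A (e k)) \<le> \<delta> k"
proof (rule dependent_wellorder_choice)
  fix e :: "nat \<Rightarrow> 'a" and k
  assume "\<And>y. y < k \<Longrightarrow> e y \<in> U \<and> norm (e y) = 1 \<and> (\<forall>i<y. cinner (e y) (e i) = 0) \<and> norm (A (e y)) \<le> \<delta> y"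
  then obtain x where x: "x \<in> U" "x \<noteq> 0" "\<forall>h\<in>e ` {..<k}. cinner x h = 0" "norm (A x) \<le> \<delta> k * norm x"
    using sing[of "e ` {..<k}" "\<delta> k"] d by force
  define c where "c = complex_of_real (1 / norm x)"
  have "c *\<^sub>C x \<in> U" "norm (c *\<^sub>C x) = 1" "\<forall>i<k. cinner (c *\<^sub>C x) (e i) = 0"
    using x U by (auto simp: complex_vector.subspace_scale norm_scaleC c_def cinner_scaleC_left norm_divide)
  moreover have "norm (A (c *\<^sub>C x)) \<le> \<delta> k"
    using x by (simp add: bounded_clinear_scaleC[OF A] norm_scaleC c_def norm_divide field_simps)
  ultimately show "\<exists>r. r \<in> U \<and> norm r = 1 \<and> (\<forall>i<k. cinner r (e i) = 0) \<and> norm (A r) \<le> \<delta> k"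
    by blast
qed auto

text \<open>
  Only the finite codimension of the range has to be contradicted, so the open mapping theorem is
  avoided: along an orthonormal sequence \<open>e\<close> with \<open>A (e k)\<close> tiny, the coefficients
  \<open>cinner (A f) (e k) = cinner f (A (e k))\<close> of a vector in the range are tiny. Splitting the sequence
  into infinitely many infinite blocks yields an infinite-dimensional space of vectors all of whose
  nonzero elements have coefficients that decay too slowly.
\<close>

lemma not_fredholm_on_singular:
  fixes A :: "'a::{complex_inner, banach} \<Rightarrow> 'a"
  assumes U: "complex_vector.subspace U" "closed U" and A: "bounded_clinear A"
    and sym: "\<And>f g. f \<in> U \<Longrightarrow> g \<in> U \<Longrightarrow> cinner (A f) g = cinner f (A g)"
    and sing: "\<And>F \<epsilon>. finite F \<Longrightarrow> F \<subseteq> U \<Longrightarrow> \<epsilon> > 0 \<Longrightarrow>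
      \<exists>e\<in>U. e \<noteq> 0 \<and> (\<forall>h\<in>F. cinner e h = 0) \<and> norm (A e) \<le> \<epsilon> * norm e"
  shows "\<not> fredholm_on U A"
proof
  assume "fredholm_on U A"
  then obtain B where B: "finite B" "B \<subseteq> U" "U \<subseteq> cspan (A ` U \<union> B)"
    unfolding fredholm_on_def by blast
  obtain e where e: "\<And>k :: nat. e k \<in> U" "\<And>k. norm (e k) = 1"
    "\<And>k i. i < k \<Longrightarrow> cinner (e k) (e i) = 0" "\<And>k. norm (A (e k)) \<le> (1/4) ^ k"
    using orthonormal_singular_sequence[OF U(1) A sing, of "\<lambda>k. (1/4) ^ k"] by auto
  have orth: "cinner (e k) (e i) = (if i = k then 1 else 0)" for i k
  proof -
    have "cinner (e k) (e i) = 0" if "k < i"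
      using e(3)[OF that] cinner_commute[of "e k" "e i"] by simp
    then show ?thesis using e(3)[of i k] cinner_self[of "e k"] e(2) by (cases i k rule: linorder_cases) auto
  qed
  (* The block j consists of the vectors b j n. Since prod_encode (j, n) >= n, the operator shrinks
     b j n by 1/4^n, while the vector g j has the much larger coefficient 1/2^n along it. *)
  define b where "b j n = e (prod_encode (j, n))" for j n
  have b_orth: "cinner (b j n) (b j' n') = (if j = j' \<and> n = n' then 1 else 0)" for j n j' n'
    by (auto simp: b_def orth)
  define g where "g j = (\<Sum>n. (1/2 :: real) ^ n *\<^sub>R b j n)" for j
  have sums: "(\<lambda>n. (1/2 :: real) ^ n *\<^sub>R b j n) sums g j" for j
  proof -
    have "summable (\<lambda>n. norm ((1/2 :: real) ^ n *\<^sub>R b j n))"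
      by (simp add: b_def e(2) summable_geometric power_divide[symmetric])
    then have "summable (\<lambda>n. (1/2 :: real) ^ n *\<^sub>R b j n)"
      by (rule summable_norm_cancel)
    then show ?thesis unfolding g_def by (rule summable_sums)
  qed
  have gU: "g j \<in> U" for j
  proof (rule closed_sequentially[OF U(2)])
    show "(\<Sum>n<N. (1/2 :: real) ^ n *\<^sub>R b j n) \<in> U" for N
      unfolding scaleR_scaleC b_def
      by (intro complex_vector.subspace_sum complex_vector.subspace_scale U(1) e)
    show "(\<lambda>N. \<Sum>n<N. (1/2 :: real) ^ n *\<^sub>R b j n) \<longlonglongrightarrow> g j"
      using sums unfolding sums_def .
  qed
  have cg: "(\<lambda>n. complex_of_real ((1/2) ^ n) * cinner (b j n) h) sums cinner (g j) h" for j h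
    using bounded_linear.sums[OF bounded_clinear_bounded_linear[OF bounded_clinear_cinner[of h]] sums[of j]]
    by (simp add: scaleR_scaleC cinner_scaleC_left)
  have gb: "cinner (g j) (b i n) = (if i = j then (1/2) ^ n else 0)" for i j n
  proof -
    have eq: "(\<lambda>m. complex_of_real ((1/2) ^ m) * cinner (b j m) (b i n)) =
        (\<lambda>m. if m = n then (if i = j then (1/2) ^ n else 0) else 0)"
      by (auto simp: b_orth)
    have "(\<lambda>m. if m = n then (if i = j then (1/2) ^ n else 0) else 0 :: complex) sums cinner (g j) (b i n)"
      using cg[of j "b i n"] unfolding eq .
    then show ?thesis
      using sums_single[of n "\<lambda>_. if i = j then (1/2) ^ n else 0 :: complex"] by (rule sums_unique2)
  qed
  have cg0: "cinner (g j) h = 0" if "\<And>n. cinner (b j n) h = 0" for j h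
  proof -
    have "(\<lambda>_. 0) sums cinner (g j) h" using cg[of j h] that by simp
    then show ?thesis using sums_zero by (rule sums_unique2)
  qed
  have gg: "cinner (g j) (g i) = 0" if "i \<noteq> j" for i j
  proof (rule cg0)
    show "cinner (b j n) (g i) = 0" for n
      using gb[of i j n] that cinner_commute[of "b j n" "g i"] by simp
  qed
  have g0: "g j \<noteq> 0" for j
    using gb[of j j 0] by auto
  define V where "V = cspan (range g)"
  have "inf_dim V"
    by (rule inf_dim_orthogonal_sequence[of g]) (auto simp: gg g0 V_def intro: complex_vector.span_base)
  moreover have AU: "complex_vector.subspace (A ` U)"
    unfolding complex_vector.subspace_def
  proof (intro conjI ballI allI)
    show "0 \<in> A ` U" using U(1) A by (metis bounded_clinear_0 complex_vector.subspace_0 image_eqI)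
    show "x + y \<in> A ` U" if "x \<in> A ` U" "y \<in> A ` U" for x y
      using that U(1) by (auto simp: bounded_clinear_add[OF A, symmetric] complex_vector.subspace_add)
    show "c *\<^sub>C x \<in> A ` U" if "x \<in> A ` U" for c x
      using that U(1) by (auto simp: bounded_clinear_scaleC[OF A, symmetric] complex_vector.subspace_scale)
  qed
  moreover have "V \<subseteq> U"
    unfolding V_def using gU by (intro complex_vector.span_minimal U) auto
  ultimately have "inf_dim (V \<inter> A ` U)"
    using B unfolding V_def
    by (intro inf_dim_finite_codim[OF B(1)] complex_vector.subspace_span) auto
  then obtain v where v: "v \<in> V" "v \<in> A ` U" "v \<noteq> 0"
    by (auto elim: inf_dim_nonzero)
  from v(2) obtain f where f: "f \<in> U" "v = A f" by blast
  have geom: "cinner u (b i n) = cinner u (b i 0) * (1/2) ^ n" if "u \<in> V" for u i n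
    using that unfolding V_def
  proof (rule complex_vector.span_induct)
    show "complex_vector.subspace {x. cinner x (b i n) = cinner x (b i 0) * (1/2) ^ n}"
      by (simp add: complex_vector.subspace_def cinner_add_left cinner_scaleC_left distrib_right)
    show "cinner x (b i n) = cinner x (b i 0) * (1/2) ^ n" if "x \<in> range g" for x
      using that by (auto simp: gb)
  qed
  have decay: "cmod (cinner v (b i n)) \<le> norm f * (1/4) ^ n" for i n
  proof -
    have "cmod (cinner v (b i n)) = cmod (cinner f (A (b i n)))"
      using f e(1) by (simp add: sym b_def)
    also have "\<dots> \<le> norm f * norm (A (b i n))" by (rule cmod_cinner_le)
    also have "norm (A (b i n)) \<le> (1/4) ^ prod_encode (i, n)" by (simp add: b_def e(4))
    also have "(1/4 :: real) ^ prod_encode (i, n) \<le> (1/4) ^ n"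
      by (intro power_decreasing le_prod_encode_2) auto
    finally show ?thesis by (simp add: mult_left_mono)
  qed
  have vb: "cinner v (b i n) = 0" for i n
  proof -
    define c where "c = cinner v (b i 0)"
    have c: "cinner v (b i n) = c * (1/2) ^ n" for n
      unfolding c_def by (rule geom[OF v(1)])
    have le: "cmod c \<le> norm f * (1/2) ^ n" for n
    proof -
      have "cmod c * (1/2) ^ n \<le> norm f * (1/4) ^ n"
        using decay[of i n] by (simp add: c norm_mult norm_power)
      also have "(1/4 :: real) ^ n = (1/2) ^ n * (1/2) ^ n"
        by (simp add: power_mult_distrib[symmetric])
      finally show ?thesis by simp
    qed
    have "(\<lambda>n. norm f * (1/2) ^ n) \<longlonglongrightarrow> norm f * 0"
      by (intro tendsto_mult_left LIMSEQ_realpow_zero) auto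
    then have "cmod c \<le> norm f * 0" using le by (intro LIMSEQ_le_const) blast+
    then show ?thesis using c by simp
  qed
  have vg: "cinner (g j) v = 0" for j
  proof (rule cg0)
    show "cinner (b j n) v = 0" for n
      using vb[of j n] cinner_commute[of "b j n" v] by simp
  qed
  have "cinner v v = 0"
    using v(1) unfolding V_def
  proof (rule complex_vector.span_induct[where P = "\<lambda>x. cinner x v = 0"])
    show "complex_vector.subspace {x. cinner x v = 0}"
      by (auto simp: complex_vector.subspace_def cinner_add_left cinner_scaleC_left)
  qed (use vg in auto)
  then show False using v(3) cinner_self_eq_0_iff by blast
qed

section \<open>Borel representatives of square-integrable functions\<close>

abbreviation sqn :: "('a::euclidean_space \<Rightarrow> complex) \<Rightarrow> ennreal"
  where "sqn g \<equiv> \<integral>\<^sup>+x. ennreal ((cmod (g x))\<^sup>2) \<partial>lborel"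

lemma complex_borel_version:
  fixes f :: "'a::euclidean_space \<Rightarrow> complex"
  assumes "f \<in> borel_measurable lebesgue"
  shows "\<exists>g\<in>borel_measurable borel. AE x in lborel. f x = g x"
proof -
  obtain r where r: "r \<in> borel_measurable lborel" "AE x in lborel. Re (f x) = r x"
    using completion_ex_borel_measurable_real[of "\<lambda>x. Re (f x)" lborel] assms by auto
  obtain i where i: "i \<in> borel_measurable lborel" "AE x in lborel. Im (f x) = i x"
    using completion_ex_borel_measurable_real[of "\<lambda>x. Im (f x)" lborel] assms by auto
  have "(\<lambda>x. Complex (r x) (i x)) \<in> borel_measurable borel"
    using r(1) i(1) by (simp add: borel_measurable_complex_iff)
  moreover have "AE x in lborel. f x = Complex (r x) (i x)"
    using r(2) i(2) by eventually_elim (simp add: complex_eq_iff)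
  ultimately show ?thesis by (intro bexI[where x = "\<lambda>x. Complex (r x) (i x)"])
qed

text \<open>
  Lebesgue measurability does not pass to slices, so Fubini's theorem is applied to
  Borel representatives throughout.
\<close>

definition brep :: "'a::euclidean_space l2 \<Rightarrow> 'a \<Rightarrow> complex"
  where "brep f = (SOME g. g \<in> borel_measurable borel \<and> (AE x in lborel. rep_l2 f x = g x))"

lemma brep_props: "brep f \<in> borel_measurable borel \<and> (AE x in lborel. rep_l2 f x = brep f x)"
proof -
  have "\<exists>g. g \<in> borel_measurable borel \<and> (AE x in lborel. rep_l2 f x = g x)"
    using complex_borel_version[of "rep_l2 f"] sq_integrable_rep_l2[of f]
    by (auto simp: sq_integrable_def)
  from someI_ex[OF this] show ?thesis unfolding brep_def .
qed

lemma measurable_brep [measurable]: "brep f \<in> borel_measurable borel"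
  by (rule conjunct1[OF brep_props])

lemma AE_rep_eq_brep: "AE x in lborel. rep_l2 f x = brep f x"
  by (rule conjunct2[OF brep_props])

lemma AE_lebesgue_iff: "(AE x in lebesgue. P x) \<longleftrightarrow> (AE x in lborel. P x)"
  by (rule AE_completion_iff)

lemma sq_integrable_lebesgueI:
  assumes [measurable]: "g \<in> borel_measurable borel" and "sqn g < \<infinity>"
  shows "sq_integrable lebesgue g"
proof -
  have [measurable]: "g \<in> borel_measurable lebesgue"
    by (simp add: assms measurable_completion)
  show ?thesis
    using assms by (auto simp: sq_integrable_def nn_integral_completion intro!: integrableI_bounded)
qed

lemma brep_abs_lebesgue:
  assumes "sq_integrable lebesgue g"
  shows "AE x in lborel. brep (abs_l2 g) x = g x"
  using rep_abs_l2[OF assms, unfolded AE_lebesgue_iff] AE_rep_eq_brep[of "abs_l2 g"]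
  by eventually_elim simp

lemma brep_abs:
  assumes "g \<in> borel_measurable borel" "sqn g < \<infinity>"
  shows "AE x in lborel. brep (abs_l2 g) x = g x"
  by (intro brep_abs_lebesgue sq_integrable_lebesgueI assms)

lemma l2_eqI_brep:
  assumes "AE x in lborel. brep f x = brep g x"
  shows "f = g"
  using assms AE_rep_eq_brep[of f] AE_rep_eq_brep[of g]
  by (intro l2_eqI, unfold AE_lebesgue_iff, eventually_elim) simp

lemma cinner_brep: "cinner f g = (LINT x|lborel. brep f x * cnj (brep g x))"
proof -
  have "cinner f g = (LINT x|lebesgue. brep f x * cnj (brep g x))"
  proof (rule cinner_l2_cong)
    show "AE x in lebesgue. rep_l2 f x * cnj (rep_l2 g x) = brep f x * cnj (brep g x)"
      unfolding AE_lebesgue_iff using AE_rep_eq_brep[of f] AE_rep_eq_brep[of g]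
      by eventually_elim simp
    show "(\<lambda>x. brep f x * cnj (brep g x)) \<in> borel_measurable lebesgue"
      by (intro measurable_completion) simp
  qed
  also have "\<dots> = (LINT x|lborel. brep f x * cnj (brep g x))"
    by (rule integral_completion) simp
  finally show ?thesis .
qed

lemma sq_integrable_brep: "sq_integrable lborel (brep f)"
proof -
  have [measurable]: "rep_l2 f \<in> borel_measurable lebesgue" "brep f \<in> borel_measurable lebesgue"
    using sq_integrable_rep_l2 by (auto simp: sq_integrable_def intro: measurable_completion)
  have "integrable lebesgue (\<lambda>x. (cmod (brep f x))\<^sup>2)"
  proof (rule Bochner_Integration.integrable_cong_AE_imp)
    show "integrable lebesgue (\<lambda>x. (cmod (rep_l2 f x))\<^sup>2)"
      using sq_integrable_rep_l2 by (auto simp: sq_integrable_def)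
    show "AE x in lebesgue. (cmod (rep_l2 f x))\<^sup>2 = (cmod (brep f x))\<^sup>2"
      unfolding AE_lebesgue_iff using AE_rep_eq_brep[of f] by eventually_elim simp
  qed simp
  then show ?thesis
    by (simp add: sq_integrable_def integrable_completion)
qed

lemma sqn_brep: "sqn (brep f) = ennreal ((norm f)\<^sup>2)"
proof -
  have "complex_of_real ((norm f)\<^sup>2) = cinner f f"
    by (rule cinner_self[symmetric])
  also have "\<dots> = (LINT x|lborel. complex_of_real ((cmod (brep f x))\<^sup>2))"
    unfolding cinner_brep by (simp only: complex_norm_square)
  finally have "complex_of_real ((norm f)\<^sup>2) = (LINT x|lborel. complex_of_real ((cmod (brep f x))\<^sup>2))" .
  then have "(norm f)\<^sup>2 = (LINT x|lborel. (cmod (brep f x))\<^sup>2)"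
    unfolding integral_complex_of_real of_real_eq_iff .
  then show ?thesis
    using sq_integrable_brep[of f] unfolding sq_integrable_def
    by (subst nn_integral_eq_integral) auto
qed

lemma sqn_brep_finite: "sqn (brep f) < \<infinity>"
  by (simp add: sqn_brep)

lemma sqn_cong_AE: "AE x in lborel. f x = g x \<Longrightarrow> sqn f = sqn g"
  by (intro nn_integral_cong_AE) (auto elim: eventually_mono)

lemma norm_le_from_sqn:
  assumes "sqn (brep f) \<le> ennreal (c\<^sup>2) * sqn (brep g)" "c \<ge> 0"
  shows "norm f \<le> c * norm g"
proof -
  have "ennreal ((norm f)\<^sup>2) \<le> ennreal ((c * norm g)\<^sup>2)"
    using assms by (simp add: sqn_brep ennreal_mult[symmetric] power_mult_distrib)
  then have "(norm f)\<^sup>2 \<le> (c * norm g)\<^sup>2" by (subst (asm) ennreal_le_iff) auto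
  then show ?thesis using assms(2) by (simp add: power2_le_iff_abs_le)
qed

lemma brep_add: "AE x in lborel. brep (f + g) x = brep f x + brep g x"
  using rep_plus_l2[of f g, unfolded AE_lebesgue_iff] AE_rep_eq_brep[of f] AE_rep_eq_brep[of g]
    AE_rep_eq_brep[of "f + g"]
  by eventually_elim simp

lemma brep_scaleC: "AE x in lborel. brep (c *\<^sub>C f) x = c * brep f x"
  using rep_scaleC_l2[of c f, unfolded AE_lebesgue_iff] AE_rep_eq_brep[of f]
    AE_rep_eq_brep[of "c *\<^sub>C f"]
  by eventually_elim simp

lemma brep_diff: "AE x in lborel. brep (f - g) x = brep f x - brep g x"
  using brep_add[of "f - g" g] by eventually_elim simp

lemma brep_zero: "AE x in lborel. brep 0 x = 0"
  using rep_zero_l2[unfolded AE_lebesgue_iff] AE_rep_eq_brep[of 0]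
  by eventually_elim simp

section \<open>Completeness of the space of square-integrable functions\<close>

lemma convergent_from_summable_increments:
  fixes u :: "nat \<Rightarrow> 'a::real_normed_vector"
  assumes "summable (\<lambda>k. u (Suc k) - u k)"
  shows "convergent u"
proof -
  have "(\<lambda>n. \<Sum>k<n. u (Suc k) - u k) \<longlonglongrightarrow> (\<Sum>k. u (Suc k) - u k)"
    using summable_LIMSEQ[OF assms] .
  then have "(\<lambda>n. (u n - u 0) + u 0) \<longlonglongrightarrow> (\<Sum>k. u (Suc k) - u k) + u 0"
    unfolding sum_lessThan_telescope by (intro tendsto_add tendsto_const)
  then show ?thesis by (auto simp: convergent_def)
qed

lemma Cauchy_fast_subsequence:
  fixes X :: "nat \<Rightarrow> 'a::metric_space" and \<delta> :: "nat \<Rightarrow> real"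
  assumes "Cauchy X" and d: "\<And>k. \<delta> k > 0"
  shows "\<exists>r. strict_mono r \<and> (\<forall>k n. n \<ge> r k \<longrightarrow> dist (X n) (X (r k)) < \<delta> k)"
proof -
  have "\<forall>k. \<exists>N. \<forall>m\<ge>N. \<forall>n\<ge>N. dist (X m) (X n) < \<delta> k"
    using metric_CauchyD[OF assms(1) d] by blast
  then obtain N where N: "\<And>k m n. m \<ge> N k \<Longrightarrow> n \<ge> N k \<Longrightarrow> dist (X m) (X n) < \<delta> k"
    by metis
  define r where "r k = (\<Sum>i\<le>k. N i) + k" for k
  have "strict_mono r" by (auto simp: strict_mono_Suc_iff r_def)
  moreover have "N k \<le> r k" for k
    using member_le_sum[of k "{..k}" N] by (simp add: r_def)
  ultimately show ?thesis using N by (meson order_trans)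
qed

text \<open>
  The squared increments have integrals at most \<open>16\<^sup>-\<^sup>k\<close>, so even with the weights \<open>4\<^sup>k\<close> their sum is finite
  almost everywhere. The increments are then of order \<open>2\<^sup>-\<^sup>k\<close> at almost every point.
\<close>

lemma l2_fast_Cauchy_AE_convergent:
  fixes u :: "nat \<Rightarrow> 'a::euclidean_space l2"
  assumes "\<And>k. norm (u (Suc k) - u k) \<le> (1/4) ^ k"
  shows "AE x in lborel. convergent (\<lambda>k. brep (u k) x)"
proof -
  define a where "a k x = (cmod (brep (u (Suc k) - u k) x))\<^sup>2" for k x
  have [measurable]: "a k \<in> borel_measurable borel" for k unfolding a_def by measurable
  have "(\<integral>\<^sup>+x. ennreal (4 ^ k * a k x) \<partial>lborel) \<le> ennreal ((1/4) ^ k)" for k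
  proof -
    have "(\<integral>\<^sup>+x. ennreal (4 ^ k * a k x) \<partial>lborel) = ennreal (4 ^ k) * (\<integral>\<^sup>+x. ennreal (a k x) \<partial>lborel)"
      by (simp add: ennreal_mult nn_integral_cmult a_def)
    also have "\<dots> = ennreal (4 ^ k * (norm (u (Suc k) - u k))\<^sup>2)"
      unfolding a_def sqn_brep by (simp add: ennreal_mult)
    also have "\<dots> \<le> ennreal (4 ^ k * ((1/4) ^ k)\<^sup>2)"
      by (intro ennreal_leI mult_left_mono power_mono assms) auto
    also have "(4 :: real) ^ k * ((1/4) ^ k)\<^sup>2 = (1/4) ^ k"
      by (simp add: power2_eq_square power_mult_distrib[symmetric] mult.assoc[symmetric])
    finally show ?thesis .
  qed
  then have "(\<Sum>k. \<integral>\<^sup>+x. ennreal (4 ^ k * a k x) \<partial>lborel) \<le> (\<Sum>k. ennreal ((1/4) ^ k))"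
    by (intro suminf_le) auto
  also have "\<dots> = ennreal (\<Sum>k. (1/4) ^ k)"
    by (intro suminf_ennreal2) (auto intro: summable_geometric)
  finally have fin: "(\<integral>\<^sup>+x. (\<Sum>k. ennreal (4 ^ k * a k x)) \<partial>lborel) \<noteq> \<infinity>"
    by (subst nn_integral_suminf) (auto simp: top_unique)
  have "AE x in lborel. (\<Sum>k. ennreal (4 ^ k * a k x)) \<noteq> \<infinity>"
    by (rule nn_integral_noteq_infinite[OF _ fin]) measurable
  moreover have "AE x in lborel. \<forall>k. brep (u (Suc k) - u k) x = brep (u (Suc k)) x - brep (u k) x"
    unfolding AE_all_countable by (auto intro: brep_diff)
  ultimately show ?thesis
  proof eventually_elim
    case (elim x)
    define S where "S = enn2real (\<Sum>k. ennreal (4 ^ k * a k x))"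
    have bound: "norm (brep (u (Suc k)) x - brep (u k) x) \<le> sqrt S * (1/2) ^ k" for k
    proof -
      have "ennreal (4 ^ k * a k x) \<le> (\<Sum>k. ennreal (4 ^ k * a k x))"
        using sum_le_suminf[of "\<lambda>k. ennreal (4 ^ k * a k x)" "{k}"] by simp
      also have "\<dots> = ennreal S" using elim(1) by (simp add: S_def less_top)
      finally have "4 ^ k * a k x \<le> S" by (subst (asm) ennreal_le_iff) (auto simp: S_def)
      moreover have "4 ^ k * a k x = (2 ^ k * norm (brep (u (Suc k)) x - brep (u k) x))\<^sup>2"
        using elim(2) by (simp add: a_def power_mult_distrib power_mult[symmetric] mult.commute[of k])
          (simp add: power_mult)
      ultimately have "2 ^ k * norm (brep (u (Suc k)) x - brep (u k) x) \<le> sqrt S"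
        by (simp add: real_le_rsqrt)
      then show ?thesis by (simp add: field_simps power_divide)
    qed
    have "summable (\<lambda>k. sqrt S * (1/2) ^ k)" by (intro summable_mult summable_geometric) simp
    then have "summable (\<lambda>k. brep (u (Suc k)) x - brep (u k) x)"
      by (rule summable_comparison_test[rotated]) (use bound in blast)
    then show ?case by (rule convergent_from_summable_increments)
  qed
qed

text \<open>
  This is the Riesz--Fischer theorem. A fast subsequence has a limit almost everywhere, and Fatou's
  lemma shows that it is also the limit in norm.
\<close>

instance l2 :: (euclidean_space) complete_space
proof
  fix X :: "nat \<Rightarrow> 'a l2" assume "Cauchy X"
  obtain r where r: "strict_mono r" "\<And>k n. n \<ge> r k \<Longrightarrow> dist (X n) (X (r k)) < (1/4) ^ k"
    using Cauchy_fast_subsequence[OF \<open>Cauchy X\<close>, of "\<lambda>k. (1/4) ^ k"] by auto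
  define u where "u k = X (r k)" for k
  have u: "norm (u l - u k) \<le> (1/4) ^ k" if "k \<le> l" for k l
    using r(2)[of k "r l"] r(1) that by (simp add: u_def dist_norm strict_mono_less_eq less_imp_le)
  have conv: "AE x in lborel. convergent (\<lambda>k. brep (u k) x)"
    by (rule l2_fast_Cauchy_AE_convergent) (simp add: u)
  define g where "g x = lim (\<lambda>k. brep (u k) x)" for x
  have [measurable]: "g \<in> borel_measurable borel" unfolding g_def by measurable
  have lim: "AE x in lborel. (\<lambda>k. brep (u k) x) \<longlonglongrightarrow> g x"
    using conv by eventually_elim (simp add: g_def convergent_LIMSEQ_iff)
  have dist_g: "sqn (\<lambda>x. g x - brep (u k) x) \<le> ennreal (((1/4) ^ k)\<^sup>2)" for k
  proof -
    have "sqn (\<lambda>x. g x - brep (u k) x) =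
        (\<integral>\<^sup>+x. liminf (\<lambda>l. ennreal ((cmod (brep (u l) x - brep (u k) x))\<^sup>2)) \<partial>lborel)"
    proof (rule nn_integral_cong_AE, use lim in eventually_elim)
      case (elim x)
      have "(\<lambda>l. ennreal ((cmod (brep (u l) x - brep (u k) x))\<^sup>2)) \<longlonglongrightarrow>
          ennreal ((cmod (g x - brep (u k) x))\<^sup>2)"
        by (intro tendsto_ennrealI tendsto_power tendsto_norm tendsto_diff elim tendsto_const)
      then show ?case by (intro lim_imp_Liminf[symmetric]) auto
    qed
    also have "\<dots> \<le> liminf (\<lambda>l. sqn (\<lambda>x. brep (u l) x - brep (u k) x))"
      by (rule nn_integral_liminf) measurable
    also have "\<dots> \<le> ennreal (((1/4) ^ k)\<^sup>2)"
    proof (rule order_trans[OF Liminf_mono])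
      have "sqn (\<lambda>x. brep (u l) x - brep (u k) x) \<le> ennreal (((1/4) ^ k)\<^sup>2)" if "k \<le> l" for l
      proof -
        have "sqn (\<lambda>x. brep (u l) x - brep (u k) x) = sqn (brep (u l - u k))"
          by (rule sqn_cong_AE) (use brep_diff[of "u l" "u k"] in eventually_elim, simp)
        also have "\<dots> \<le> ennreal (((1/4) ^ k)\<^sup>2)"
          unfolding sqn_brep by (intro ennreal_leI power_mono u that) simp
        finally show ?thesis .
      qed
      then show "eventually (\<lambda>l. sqn (\<lambda>x. brep (u l) x - brep (u k) x) \<le> ennreal (((1/4) ^ k)\<^sup>2)) sequentially"
        by (auto simp: eventually_sequentially)
    qed (simp add: Liminf_const)
    finally show ?thesis .
  qed
  define Y where "Y = abs_l2 (\<lambda>x. g x - brep (u 0) x) + u 0"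
  have Y: "AE x in lborel. brep Y x = g x"
  proof -
    have fin: "sqn (\<lambda>x. g x - brep (u 0) x) < \<infinity>"
      using dist_g[of 0] by (rule le_less_trans) simp
    have "AE x in lborel. brep (abs_l2 (\<lambda>x. g x - brep (u 0) x)) x = g x - brep (u 0) x"
      by (rule brep_abs[OF _ fin]) measurable
    with brep_add[of "abs_l2 (\<lambda>x. g x - brep (u 0) x)" "u 0"] show ?thesis
      unfolding Y_def by eventually_elim simp
  qed
  have "norm (u k - Y) \<le> (1/4) ^ k" for k
  proof -
    have "sqn (brep (Y - u k)) = sqn (\<lambda>x. g x - brep (u k) x)"
      by (rule sqn_cong_AE) (use brep_diff[of Y "u k"] Y in eventually_elim, simp)
    then have "ennreal ((norm (Y - u k))\<^sup>2) \<le> ennreal (((1/4) ^ k)\<^sup>2)"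
      using dist_g[of k] unfolding sqn_brep by metis
    then have "(norm (Y - u k))\<^sup>2 \<le> ((1/4) ^ k)\<^sup>2"
      by (subst (asm) ennreal_le_iff) auto
    then have "norm (Y - u k) \<le> (1/4) ^ k"
      by (rule power2_le_imp_le) simp
    then show ?thesis
      by (simp add: norm_minus_commute)
  qed
  moreover have "(\<lambda>k. (1/4 :: real) ^ k) \<longlonglongrightarrow> 0" by (intro LIMSEQ_realpow_zero) auto
  ultimately have "(\<lambda>k. u k - Y) \<longlonglongrightarrow> 0"
    by (intro Lim_null_comparison[of "\<lambda>k. u k - Y"]) auto
  then have "(X \<circ> r) \<longlonglongrightarrow> Y"
    by (simp add: u_def o_def LIM_zero_iff)
  then show "convergent X"
    using Cauchy_converges_subseq[OF \<open>Cauchy X\<close> r(1)] by (auto simp: convergent_def)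
qed

instance l2 :: (euclidean_space) banach ..

section \<open>Multiplication operators\<close>

definition mul :: "('a::euclidean_space \<Rightarrow> complex) \<Rightarrow> 'a l2 \<Rightarrow> 'a l2"
  where "mul \<phi> f = abs_l2 (\<lambda>x. \<phi> x * brep f x)"

definition bounded_mult :: "('a::euclidean_space \<Rightarrow> complex) \<Rightarrow> bool"
  where "bounded_mult \<phi> \<longleftrightarrow> \<phi> \<in> borel_measurable borel \<and> (\<exists>C. AE x in lborel. cmod (\<phi> x) \<le> C)"

lemma bounded_multI:
  "\<phi> \<in> borel_measurable borel \<Longrightarrow> AE x in lborel. cmod (\<phi> x) \<le> C \<Longrightarrow> bounded_mult \<phi>"
  by (auto simp: bounded_mult_def)

lemma sqn_mult_le:
  assumes [measurable]: "g \<in> borel_measurable borel" "AE x in lborel. g x = 0 \<or> cmod (\<phi> x) \<le> c"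
  shows "sqn (\<lambda>x. \<phi> x * g x) \<le> ennreal (c\<^sup>2) * sqn g"
proof -
  have "sqn (\<lambda>x. \<phi> x * g x) \<le> (\<integral>\<^sup>+x. ennreal (c\<^sup>2) * ennreal ((cmod (g x))\<^sup>2) \<partial>lborel)"
  proof (rule nn_integral_mono_AE, use assms(2) in eventually_elim)
    case (elim x)
    then show ?case
      by (cases "g x = 0")
        (auto simp: norm_mult power_mult_distrib ennreal_mult[symmetric] intro!: mult_right_mono power_mono ennreal_leI)
  qed
  also have "\<dots> = ennreal (c\<^sup>2) * sqn g"
    by (rule nn_integral_cmult) measurable
  finally show ?thesis .
qed

lemma brep_mul:
  assumes "bounded_mult \<phi>"
  shows "AE x in lborel. brep (mul \<phi> f) x = \<phi> x * brep f x"
proof -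
  obtain C where [measurable]: "\<phi> \<in> borel_measurable borel" and C: "AE x in lborel. cmod (\<phi> x) \<le> C"
    using assms by (auto simp: bounded_mult_def)
  have "sqn (\<lambda>x. \<phi> x * brep f x) \<le> ennreal (C\<^sup>2) * sqn (brep f)"
    by (rule sqn_mult_le) (use C in auto)
  also have "\<dots> < \<infinity>" by (simp add: sqn_brep ennreal_mult_less_top)
  finally show ?thesis
    unfolding mul_def by (intro brep_abs) auto
qed

lemma norm_mul_le:
  assumes "bounded_mult \<phi>" "AE x in lborel. brep f x = 0 \<or> cmod (\<phi> x) \<le> c" "c \<ge> 0"
  shows "norm (mul \<phi> f) \<le> c * norm f"
proof (rule norm_le_from_sqn)
  have "sqn (brep (mul \<phi> f)) = sqn (\<lambda>x. \<phi> x * brep f x)"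
    by (rule sqn_cong_AE) (rule brep_mul[OF assms(1)])
  also have "\<dots> \<le> ennreal (c\<^sup>2) * sqn (brep f)"
    by (rule sqn_mult_le) (use assms in auto)
  finally show "sqn (brep (mul \<phi> f)) \<le> ennreal (c\<^sup>2) * sqn (brep f)" .
qed fact

lemma bounded_clinear_mul:
  assumes "bounded_mult \<phi>"
  shows "bounded_clinear (mul \<phi>)"
proof -
  obtain C where C: "AE x in lborel. cmod (\<phi> x) \<le> C"
    using assms by (auto simp: bounded_mult_def)
  show ?thesis
  proof (rule bounded_clinearI)
    fix f g c
    show "mul \<phi> (f + g) = mul \<phi> f + mul \<phi> g"
      by (rule l2_eqI_brep, use brep_mul[OF assms, of "f + g"] brep_mul[OF assms, of f]
          brep_mul[OF assms, of g] brep_add[of f g] brep_add[of "mul \<phi> f" "mul \<phi> g"] in eventually_elim)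
        (simp add: algebra_simps)
    show "mul \<phi> (c *\<^sub>C f) = c *\<^sub>C mul \<phi> f"
      by (rule l2_eqI_brep, use brep_mul[OF assms, of "c *\<^sub>C f"] brep_mul[OF assms, of f]
          brep_scaleC[of c f] brep_scaleC[of c "mul \<phi> f"] in eventually_elim)
        (simp add: algebra_simps)
    show "norm (mul \<phi> f) \<le> \<bar>C\<bar> * norm f"
      by (rule norm_mul_le[OF assms]) (use C in \<open>auto elim: eventually_mono\<close>)
  qed
qed

lemma cinner_mul_left:
  assumes "bounded_mult \<phi>"
  shows "cinner (mul \<phi> f) g = (LINT x|lborel. \<phi> x * brep f x * cnj (brep g x))"
proof -
  have [measurable]: "\<phi> \<in> borel_measurable borel" using assms by (simp add: bounded_mult_def)
  show ?thesis unfolding cinner_brep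
    by (rule integral_cong_AE) (use brep_mul[OF assms, of f] in \<open>auto elim: eventually_mono\<close>)
qed

lemma cinner_mul_right:
  assumes "bounded_mult \<phi>"
  shows "cinner f (mul \<phi> g) = (LINT x|lborel. cnj (\<phi> x) * brep f x * cnj (brep g x))"
proof -
  have [measurable]: "\<phi> \<in> borel_measurable borel" using assms by (simp add: bounded_mult_def)
  show ?thesis unfolding cinner_brep
    by (rule integral_cong_AE) (use brep_mul[OF assms, of g] in \<open>auto elim!: eventually_mono simp: mult_ac\<close>)
qed

lemma cinner_mul_real:
  assumes "bounded_mult \<phi>" "\<And>x. \<phi> x \<in> \<real>"
  shows "cinner (mul \<phi> f) g = cinner f (mul \<phi> g)"
  using assms by (simp add: cinner_mul_left cinner_mul_right Reals_cnj_iff)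

lemma mul_diff_const:
  assumes "bounded_mult \<phi>" "bounded_mult (\<lambda>x. \<phi> x - z)"
  shows "mul (\<lambda>x. \<phi> x - z) f = mul \<phi> f - z *\<^sub>C f"
  by (rule l2_eqI_brep, use brep_mul[OF assms(2), of f] brep_mul[OF assms(1), of f]
      brep_scaleC[of z f] brep_diff[of "mul \<phi> f" "z *\<^sub>C f"] in eventually_elim)
    (simp add: left_diff_distrib)

lemma L2_on_brep: "f \<in> L2_on S \<longleftrightarrow> (AE x in lborel. x \<notin> S \<longrightarrow> brep f x = 0)"
  unfolding L2_on_def mem_Collect_eq AE_lebesgue_iff
proof
  assume "AE x in lborel. x \<notin> S \<longrightarrow> rep_l2 f x = 0"
  with AE_rep_eq_brep[of f] show "AE x in lborel. x \<notin> S \<longrightarrow> brep f x = 0"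
    by eventually_elim simp
next
  assume "AE x in lborel. x \<notin> S \<longrightarrow> brep f x = 0"
  with AE_rep_eq_brep[of f] show "AE x in lborel. x \<notin> S \<longrightarrow> rep_l2 f x = 0"
    by eventually_elim simp
qed

section \<open>Orthonormal families and Hilbert--Schmidt operators\<close>

definition orthonormal :: "'a::complex_inner set \<Rightarrow> bool"
  where "orthonormal E \<longleftrightarrow>
    finite E \<and> (\<forall>e\<in>E. norm e = 1) \<and> (\<forall>e\<in>E. \<forall>e'\<in>E. e \<noteq> e' \<longrightarrow> cinner e e' = 0)"

text \<open>The orthogonal projection onto the span of an orthonormal family.\<close>

definition proj :: "'a::complex_inner set \<Rightarrow> 'a \<Rightarrow> 'a"
  where "proj E x = (\<Sum>e\<in>E. cinner x e *\<^sub>C e)"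

lemma cinner_proj:
  assumes "orthonormal E" "e \<in> E"
  shows "cinner (proj E x) e = cinner x e"
proof -
  have "cinner (proj E x) e = (\<Sum>e'\<in>E. if e' = e then cinner x e else 0)"
    unfolding proj_def cinner_sum_left
    by (rule sum.cong) (use assms in \<open>auto simp: cinner_scaleC_left orthonormal_def cinner_self\<close>)
  then show ?thesis using assms by (simp add: orthonormal_def)
qed

lemma cinner_diff_proj: "orthonormal E \<Longrightarrow> e \<in> E \<Longrightarrow> cinner (x - proj E x) e = 0"
  by (simp add: cinner_diff_left cinner_proj)

lemma cinner_diff_proj_proj:
  assumes "orthonormal E"
  shows "cinner (x - proj E x) (proj E y) = 0"
proof -
  have "cinner (proj E y) (x - proj E x) = 0"
    unfolding proj_def[of E y] cinner_sum_left
  proof (rule sum.neutral, rule ballI)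
    fix e assume "e \<in> E"
    then have "cinner e (x - proj E x) = 0"
      using cinner_diff_proj[OF assms, of e x] cinner_commute[of e "x - proj E x"] by simp
    then show "cinner (cinner y e *\<^sub>C e) (x - proj E x) = 0"
      by (simp add: cinner_scaleC_left)
  qed
  then show ?thesis using cinner_commute[of "x - proj E x" "proj E y"] by simp
qed

lemma norm_proj_pythagoras:
  assumes "orthonormal E"
  shows "(norm x)\<^sup>2 = (norm (x - proj E x))\<^sup>2 + (norm (proj E x))\<^sup>2"
  using orthogonal_norm_add[OF cinner_diff_proj_proj[OF assms], of x x] by simp

lemma norm_diff_proj_le:
  assumes "orthonormal E"
  shows "norm (x - proj E x) \<le> norm x"
  by (rule power2_le_imp_le) (use norm_proj_pythagoras[OF assms, of x] in auto)

lemma bessel: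
  assumes "orthonormal E"
  shows "(\<Sum>e\<in>E. (cmod (cinner x e))\<^sup>2) \<le> (norm x)\<^sup>2"
proof -
  have "complex_of_real ((norm (proj E x))\<^sup>2) = cinner (proj E x) (proj E x)"
    by (rule cinner_self[symmetric])
  also have "\<dots> = (\<Sum>e\<in>E. cinner x e * cinner e (proj E x))"
    by (subst (1) proj_def) (simp add: cinner_sum_left cinner_scaleC_left)
  also have "\<dots> = (\<Sum>e\<in>E. complex_of_real ((cmod (cinner x e))\<^sup>2))"
  proof (rule sum.cong[OF refl])
    fix e assume "e \<in> E"
    then have "cinner e (proj E x) = cnj (cinner x e)"
      using cinner_proj[OF assms] cinner_commute[of e "proj E x"] by simp
    then show "cinner x e * cinner e (proj E x) = complex_of_real ((cmod (cinner x e))\<^sup>2)"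
      by (simp only: complex_norm_square)
  qed
  finally have "complex_of_real ((norm (proj E x))\<^sup>2) = complex_of_real (\<Sum>e\<in>E. (cmod (cinner x e))\<^sup>2)"
    by simp
  then have "(norm (proj E x))\<^sup>2 = (\<Sum>e\<in>E. (cmod (cinner x e))\<^sup>2)"
    unfolding of_real_eq_iff .
  then show ?thesis using norm_proj_pythagoras[OF assms, of x] by simp
qed

lemma bounded_clinear_proj:
  assumes "orthonormal E"
  shows "bounded_clinear (proj E)"
proof (rule bounded_clinearI)
  show "norm (proj E x) \<le> 1 * norm x" for x
    unfolding mult_1 by (rule power2_le_imp_le) (use norm_proj_pythagoras[OF assms, of x] in auto)
qed (simp_all add: proj_def cinner_add_left cinner_scaleC_left scaleC_add_left sum.distrib
    complex_vector.scale_sum_right scaleC_scaleC)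

lemma proj_in_cspan: "proj E x \<in> cspan E"
  unfolding proj_def
  by (intro complex_vector.span_sum complex_vector.span_scale complex_vector.span_base)

text \<open>
  A Hilbert--Schmidt bound limits the length of orthonormal families on which the operator is not
  small. On the orthogonal complement of a maximal such family the operator is small.
\<close>

lemma hilbert_schmidt_small_complement:
  fixes K :: "'a::complex_inner \<Rightarrow> 'b::complex_inner"
  assumes U: "complex_vector.subspace U" and K: "bounded_clinear K"
    and hs: "\<And>E. orthonormal E \<Longrightarrow> E \<subseteq> U \<Longrightarrow> (\<Sum>e\<in>E. (norm (K e))\<^sup>2) \<le> C"
    and \<epsilon>: "\<epsilon> > 0"
  shows "\<exists>E. orthonormal E \<and> E \<subseteq> U \<and>
    (\<forall>f\<in>U. (\<forall>e\<in>E. cinner f e = 0) \<longrightarrow> norm (K f) \<le> \<epsilon> * norm f)"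
proof -
  define good where "good E \<longleftrightarrow> orthonormal E \<and> E \<subseteq> U \<and> (\<forall>e\<in>E. norm (K e) > \<epsilon>)" for E
  have bound: "real (card E) \<le> C / \<epsilon>\<^sup>2" if "good E" for E
  proof -
    have "real (card E) * \<epsilon>\<^sup>2 = (\<Sum>e\<in>E. \<epsilon>\<^sup>2)" by simp
    also have "\<dots> \<le> (\<Sum>e\<in>E. (norm (K e))\<^sup>2)"
      using that \<epsilon> by (intro sum_mono power_mono) (auto simp: good_def less_imp_le)
    also have "\<dots> \<le> C" using that hs by (simp add: good_def)
    finally show ?thesis using \<epsilon> by (simp add: field_simps)
  qed
  have "good {}" by (simp add: good_def orthonormal_def)
  moreover have "\<forall>E. good E \<longrightarrow> card E < Suc (nat \<lceil>C / \<epsilon>\<^sup>2\<rceil>)"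
    using order_trans[OF bound real_nat_ceiling_ge] by (metis of_nat_le_iff less_Suc_eq_le)
  ultimately have "\<exists>E. good E \<and> (\<forall>E'. good E' \<longrightarrow> card E' \<le> card E)"
    by (rule ex_has_greatest_nat[of good "{}" card])
  then obtain E where E: "good E" "\<And>E'. good E' \<Longrightarrow> card E' \<le> card E"
    by auto
  have "norm (K f) \<le> \<epsilon> * norm f" if f: "f \<in> U" "\<forall>e\<in>E. cinner f e = 0" for f
  proof (rule ccontr)
    assume less: "\<not> norm (K f) \<le> \<epsilon> * norm f"
    then have f0: "f \<noteq> 0" using K by auto
    define e where "e = complex_of_real (1 / norm f) *\<^sub>C f"
    have e: "norm e = 1" "e \<in> U" "norm (K e) > \<epsilon>"
      using less f0 f(1) U
      by (auto simp: e_def norm_scaleC norm_divide complex_vector.subspace_scale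
          bounded_clinear_scaleC[OF K] field_simps)
    have orth: "cinner e e' = 0" "cinner e' e = 0" if "e' \<in> E" for e'
    proof -
      show *: "cinner e e' = 0" using f(2) that by (simp add: e_def cinner_scaleC_left)
      show "cinner e' e = 0" using cinner_commute[of e' e] * by simp
    qed
    have "e \<notin> E" using orth[of e] e(1) cinner_self_eq_0_iff[of e] by auto
    moreover have "good (insert e E)"
      using E(1) e orth by (auto simp: good_def orthonormal_def)
    ultimately show False
      using E(2)[of "insert e E"] E(1) by (simp add: good_def orthonormal_def)
  qed
  then show ?thesis using E(1) unfolding good_def by blast
qed

section \<open>Fubini's theorem for Borel functions\<close>

lemma measurable_lborel_pairI:
  "f \<in> measurable (borel :: ('a::euclidean_space \<times> 'b::euclidean_space) measure) N \<Longrightarrow>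
    f \<in> measurable (lborel \<Otimes>\<^sub>M lborel) N"
  by (simp add: lborel_prod)

lemma borel_measurable_fst_snd [measurable]:
  "fst \<in> measurable (borel :: ('a::euclidean_space \<times> 'b::euclidean_space) measure) borel"
  "snd \<in> measurable (borel :: ('a::euclidean_space \<times> 'b::euclidean_space) measure) borel"
  by (intro borel_measurable_continuous_onI continuous_intros)+

lemma measurable_nn_integral_slice [measurable (raw)]:
  fixes f :: "'a::euclidean_space \<times> 'b::euclidean_space \<Rightarrow> ennreal"
  assumes "f \<in> borel_measurable borel"
  shows "(\<lambda>x. \<integral>\<^sup>+s. f (x, s) \<partial>lborel) \<in> borel_measurable borel"
  using lborel.borel_measurable_nn_integral_fst[OF measurable_lborel_pairI[OF assms]] by simp

lemma measurable_integral_slice: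
  fixes f :: "'a::euclidean_space \<times> 'b::euclidean_space \<Rightarrow> complex"
  assumes "f \<in> borel_measurable borel"
  shows "(\<lambda>x. LINT s|lborel. f (x, s)) \<in> borel_measurable borel"
  using lborel.borel_measurable_lebesgue_integral[of "\<lambda>x s. f (x, s)" lborel]
    measurable_lborel_pairI[OF assms] by simp

lemma tonelli_borel:
  fixes f :: "'a::euclidean_space \<times> 'b::euclidean_space \<Rightarrow> ennreal"
  assumes "f \<in> borel_measurable borel"
  shows "(\<integral>\<^sup>+p. f p \<partial>lborel) = (\<integral>\<^sup>+x. \<integral>\<^sup>+s. f (x, s) \<partial>lborel \<partial>lborel)"
  using lborel.nn_integral_fst[OF measurable_lborel_pairI[OF assms]] by (simp add: lborel_prod)

lemma AE_slices:
  assumes "AE p in (lborel :: ('a::euclidean_space \<times> 'b::euclidean_space) measure). Q p"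
  shows "AE x in lborel. AE s in lborel. Q (x, s)"
proof (rule lborel_pair.AE_pair)
  show "AE p in (lborel :: 'a measure) \<Otimes>\<^sub>M (lborel :: 'b measure). Q p"
    using assms by (simp only: lborel_prod)
qed

lemma integral_cauchy_schwarz:
  fixes u w :: "'a::euclidean_space \<Rightarrow> complex"
  assumes [measurable]: "u \<in> borel_measurable borel" "w \<in> borel_measurable borel"
    and fin: "sqn u < \<infinity>" "sqn w < \<infinity>"
  shows "integrable lborel (\<lambda>s. u s * w s)"
    and "ennreal ((cmod (LINT s|lborel. u s * w s))\<^sup>2) \<le> sqn u * sqn w"
proof -
  have cs: "(\<integral>\<^sup>+s. ennreal (norm (u s * w s)) \<partial>lborel)\<^sup>2 \<le> sqn u * sqn w"
    using Cauchy_Schwarz_nn_integral[of "\<lambda>s. ennreal (cmod (u s))" lborel "\<lambda>s. ennreal (cmod (w s))"]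
    by (simp add: norm_mult ennreal_mult ennreal_power)
  also have "\<dots> < \<infinity>" using fin by (simp add: ennreal_mult_less_top)
  finally have "(\<integral>\<^sup>+s. ennreal (norm (u s * w s)) \<partial>lborel) < \<infinity>"
    by (auto simp: power2_eq_square ennreal_mult_less_top)
  then show int: "integrable lborel (\<lambda>s. u s * w s)"
    by (intro integrableI_bounded) auto
  have "ennreal ((cmod (LINT s|lborel. u s * w s))\<^sup>2) = (ennreal (cmod (LINT s|lborel. u s * w s)))\<^sup>2"
    by (simp add: ennreal_power)
  also have "\<dots> \<le> (\<integral>\<^sup>+s. ennreal (norm (u s * w s)) \<partial>lborel)\<^sup>2"
    by (intro power_mono integral_norm_bound_ennreal int) simp
  finally show "ennreal ((cmod (LINT s|lborel. u s * w s))\<^sup>2) \<le> sqn u * sqn w"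
    using cs by (rule order_trans)
qed

section \<open>Partial integral operators\<close>

definition row_bounded :: "('a::euclidean_space \<times> 'b::euclidean_space \<Rightarrow> complex) \<Rightarrow> real \<Rightarrow> bool"
  where "row_bounded v C \<longleftrightarrow> v \<in> borel_measurable borel \<and> C \<ge> 0 \<and>
    (AE x in lborel. sqn (\<lambda>s. v (x, s)) \<le> ennreal C)"

text \<open>
  On symmetric functions, \<open>row_integral v\<close> is the operator that annihilates one particle;
  \<open>row_extend v\<close> is its adjoint on the space of all square-integrable functions.
\<close>

definition row_integral ::
    "('a::euclidean_space \<times> 'b::euclidean_space \<Rightarrow> complex) \<Rightarrow> ('a \<times> 'b) l2 \<Rightarrow> 'a l2"
  where "row_integral v f = abs_l2 (\<lambda>x. LINT s|lborel. v (x, s) * brep f (x, s))"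

definition row_extend ::
    "('a::euclidean_space \<times> 'b::euclidean_space \<Rightarrow> complex) \<Rightarrow> 'a l2 \<Rightarrow> ('a \<times> 'b) l2"
  where "row_extend v g = abs_l2 (\<lambda>p. cnj (v p) * brep g (fst p))"

lemma row_bounded_measurable [measurable_dest]: "row_bounded v C \<Longrightarrow> v \<in> borel_measurable borel"
  by (simp add: row_bounded_def)

lemma row_integral_pointwise:
  fixes h :: "'a::euclidean_space \<times> 'b::euclidean_space \<Rightarrow> complex"
  assumes v: "row_bounded v C" and [measurable]: "h \<in> borel_measurable borel" and fin: "sqn h < \<infinity>"
  shows "AE x in lborel. integrable lborel (\<lambda>s. v (x, s) * h (x, s)) \<and>
    ennreal ((cmod (LINT s|lborel. v (x, s) * h (x, s)))\<^sup>2) \<le> ennreal C * sqn (\<lambda>s. h (x, s))"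
proof -
  note [measurable] = row_bounded_measurable[OF v]
  have "(\<integral>\<^sup>+x. sqn (\<lambda>s. h (x, s)) \<partial>lborel) \<noteq> \<infinity>"
    using fin by (subst (asm) tonelli_borel) auto
  then have "AE x in lborel. sqn (\<lambda>s. h (x, s)) \<noteq> \<infinity>"
    by (intro nn_integral_noteq_infinite) auto
  moreover have "AE x in lborel. sqn (\<lambda>s. v (x, s)) \<le> ennreal C"
    using v by (simp add: row_bounded_def)
  ultimately show ?thesis
  proof eventually_elim
    case (elim x)
    have fin: "sqn (\<lambda>s. v (x, s)) < \<infinity>" "sqn (\<lambda>s. h (x, s)) < \<infinity>"
      using elim by (auto simp: less_top intro: le_less_trans)
    note cs = integral_cauchy_schwarz[OF _ _ fin, simplified]
    show ?case
      using cs order_trans[OF cs(2) mult_right_mono[OF elim(2)]] by auto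
  qed
qed

lemma sqn_row_integral:
  fixes h :: "'a::euclidean_space \<times> 'b::euclidean_space \<Rightarrow> complex"
  assumes v: "row_bounded v C" and [measurable]: "h \<in> borel_measurable borel" and fin: "sqn h < \<infinity>"
  shows "sqn (\<lambda>x. LINT s|lborel. v (x, s) * h (x, s)) \<le> ennreal C * sqn h"
proof -
  have "sqn (\<lambda>x. LINT s|lborel. v (x, s) * h (x, s)) \<le> (\<integral>\<^sup>+x. ennreal C * sqn (\<lambda>s. h (x, s)) \<partial>lborel)"
    using row_integral_pointwise[OF assms]
    by (intro nn_integral_mono_AE) (auto elim: eventually_mono)
  also have "\<dots> = ennreal C * sqn h"
    by (simp add: nn_integral_cmult tonelli_borel[of "\<lambda>p. ennreal ((cmod (h p))\<^sup>2)"])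
  finally show ?thesis .
qed

lemma brep_row_integral:
  fixes f :: "('a::euclidean_space \<times> 'b::euclidean_space) l2"
  assumes v: "row_bounded v C"
  shows "AE x in lborel. brep (row_integral v f) x = (LINT s|lborel. v (x, s) * brep f (x, s))"
proof -
  note [measurable] = row_bounded_measurable[OF v]
  have "sqn (\<lambda>x. LINT s|lborel. v (x, s) * brep f (x, s)) \<le> ennreal C * sqn (brep f)"
    by (rule sqn_row_integral[OF v _ sqn_brep_finite]) measurable
  also have "\<dots> < \<infinity>" by (simp add: sqn_brep ennreal_mult_less_top)
  finally show ?thesis
    unfolding row_integral_def
    by (intro brep_abs measurable_integral_slice[of "\<lambda>p. v p * brep f p"]) measurable
qed

lemma norm_row_integral:
  fixes f :: "('a::euclidean_space \<times> 'b::euclidean_space) l2"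
  assumes v: "row_bounded v C"
  shows "norm (row_integral v f) \<le> sqrt C * norm f"
proof (rule norm_le_from_sqn)
  have "sqn (brep (row_integral v f)) = sqn (\<lambda>x. LINT s|lborel. v (x, s) * brep f (x, s))"
    by (rule sqn_cong_AE) (rule brep_row_integral[OF v])
  also have "\<dots> \<le> ennreal C * sqn (brep f)"
    by (rule sqn_row_integral[OF v _ sqn_brep_finite]) measurable
  finally show "sqn (brep (row_integral v f)) \<le> ennreal ((sqrt C)\<^sup>2) * sqn (brep f)"
    using v by (simp add: row_bounded_def)
qed (use v in \<open>simp add: row_bounded_def\<close>)

lemma row_integral_integrable:
  fixes f :: "('a::euclidean_space \<times> 'b::euclidean_space) l2"
  assumes v: "row_bounded v C"
  shows "AE x in lborel. integrable lborel (\<lambda>s. v (x, s) * brep f (x, s))"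
  using row_integral_pointwise[OF v measurable_brep sqn_brep_finite] by (auto elim: eventually_mono)

lemma integral_slice_cong:
  fixes h h' :: "'a::euclidean_space \<times> 'b::euclidean_space \<Rightarrow> complex"
  assumes [measurable]: "h \<in> borel_measurable borel" "h' \<in> borel_measurable borel"
    and "AE p in lborel. h p = h' p"
  shows "AE x in lborel. (LINT s|lborel. h (x, s)) = (LINT s|lborel. h' (x, s))"
  using AE_slices[OF assms(3)]
proof eventually_elim
  case (elim x)
  then show ?case by (intro integral_cong_AE) auto
qed

lemma bounded_clinear_row_integral:
  fixes v :: "'a::euclidean_space \<times> 'b::euclidean_space \<Rightarrow> complex"
  assumes v: "row_bounded v C"
  shows "bounded_clinear (row_integral v)"
proof (rule bounded_clinearI[OF _ _ norm_row_integral[OF v]])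
  note [measurable] = row_bounded_measurable[OF v]
  note br = brep_row_integral[OF v]
  fix f g :: "('a \<times> 'b) l2" and c :: complex
  have "AE x in lborel. (LINT s|lborel. v (x, s) * brep (f + g) (x, s)) =
      (LINT s|lborel. v (x, s) * (brep f (x, s) + brep g (x, s)))"
    by (rule integral_slice_cong[of "\<lambda>p. v p * brep (f + g) p" "\<lambda>p. v p * (brep f p + brep g p)"])
      (use brep_add[of f g] in \<open>auto elim: eventually_mono\<close>)
  then show "row_integral v (f + g) = row_integral v f + row_integral v g"
    using br[of "f + g"] br[of f] br[of g] row_integral_integrable[OF v, of f]
      row_integral_integrable[OF v, of g] brep_add[of "row_integral v f" "row_integral v g"]
    by (intro l2_eqI_brep, eventually_elim) (simp add: distrib_left)
  have "AE x in lborel. (LINT s|lborel. v (x, s) * brep (c *\<^sub>C f) (x, s)) =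
      (LINT s|lborel. v (x, s) * (c * brep f (x, s)))"
    by (rule integral_slice_cong[of "\<lambda>p. v p * brep (c *\<^sub>C f) p" "\<lambda>p. v p * (c * brep f p)"])
      (use brep_scaleC[of c f] in \<open>auto elim: eventually_mono\<close>)
  then show "row_integral v (c *\<^sub>C f) = c *\<^sub>C row_integral v f"
    using br[of "c *\<^sub>C f"] br[of f] brep_scaleC[of c "row_integral v f"]
    by (intro l2_eqI_brep, eventually_elim) (simp add: mult.left_commute)
qed

lemma row_integral_cong:
  assumes v: "row_bounded v C" and w: "row_bounded w C'"
    and eq: "AE p in lborel. v p * brep f p = w p * brep f p"
  shows "row_integral v f = row_integral w f"
proof -
  note [measurable] = row_bounded_measurable[OF v] row_bounded_measurable[OF w]
  have "AE x in lborel. (LINT s|lborel. v (x, s) * brep f (x, s)) = (LINT s|lborel. w (x, s) * brep f (x, s))"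
    by (rule integral_slice_cong[of "\<lambda>p. v p * brep f p" "\<lambda>p. w p * brep f p"]) (use eq in auto)
  then show ?thesis
    using brep_row_integral[OF v, of f] brep_row_integral[OF w, of f]
    by (intro l2_eqI_brep, eventually_elim) simp
qed

lemma sqn_row_extend:
  fixes g :: "'a::euclidean_space \<Rightarrow> complex" and v :: "'a \<times> 'b::euclidean_space \<Rightarrow> complex"
  assumes v: "row_bounded v C" and [measurable]: "g \<in> borel_measurable borel"
  shows "sqn (\<lambda>p. cnj (v p) * g (fst p)) \<le> ennreal C * sqn g"
proof -
  note [measurable] = row_bounded_measurable[OF v]
  have "sqn (\<lambda>p. cnj (v p) * g (fst p)) =
      (\<integral>\<^sup>+x. \<integral>\<^sup>+s. ennreal ((cmod (g x))\<^sup>2) * ennreal ((cmod (v (x, s)))\<^sup>2) \<partial>lborel \<partial>lborel)"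
    by (subst tonelli_borel) (auto simp: norm_mult power_mult_distrib ennreal_mult mult.commute)
  also have "\<dots> = (\<integral>\<^sup>+x. ennreal ((cmod (g x))\<^sup>2) * sqn (\<lambda>s. v (x, s)) \<partial>lborel)"
    by (simp add: nn_integral_cmult)
  also have "\<dots> \<le> (\<integral>\<^sup>+x. ennreal ((cmod (g x))\<^sup>2) * ennreal C \<partial>lborel)"
    using v unfolding row_bounded_def
    by (intro nn_integral_mono_AE) (auto elim!: eventually_mono intro: mult_left_mono)
  also have "\<dots> = ennreal C * sqn g"
    by (subst mult.commute) (simp add: nn_integral_cmult)
  finally show ?thesis .
qed

lemma brep_row_extend:
  fixes g :: "'a::euclidean_space l2" and v :: "'a \<times> 'b::euclidean_space \<Rightarrow> complex"
  assumes v: "row_bounded v C"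
  shows "AE p in lborel. brep (row_extend v g) p = cnj (v p) * brep g (fst p)"
proof -
  note [measurable] = row_bounded_measurable[OF v]
  have "sqn (\<lambda>p. cnj (v p) * brep g (fst p)) \<le> ennreal C * sqn (brep g)"
    by (rule sqn_row_extend[OF v]) measurable
  also have "\<dots> < \<infinity>" by (simp add: sqn_brep ennreal_mult_less_top)
  finally show ?thesis
    unfolding row_extend_def by (intro brep_abs) measurable
qed

lemma AE_fst:
  assumes "AE x in (lborel :: 'a::euclidean_space measure). P x"
  shows "AE p in (lborel :: ('a \<times> 'b::euclidean_space) measure). P (fst p)"
proof -
  obtain N where N: "N \<in> null_sets lborel" "{x \<in> space lborel. \<not> P x} \<subseteq> N"
    using assms by (auto simp: eventually_ae_filter)
  have "emeasure (lborel :: ('a \<times> 'b) measure) (N \<times> UNIV) = emeasure lborel N * emeasure lborel (UNIV :: 'b set)"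
    using N(1) by (subst lborel_prod[symmetric]) (rule lborel.emeasure_pair_measure_Times, auto)
  then have "N \<times> UNIV \<in> null_sets (lborel :: ('a \<times> 'b) measure)"
    using N(1) by (auto simp: null_sets_def borel_prod[symmetric])
  then show ?thesis by (rule AE_I') (use N(2) in auto)
qed

lemma bounded_clinear_row_extend:
  fixes v :: "'a::euclidean_space \<times> 'b::euclidean_space \<Rightarrow> complex"
  assumes v: "row_bounded v C"
  shows "bounded_clinear (row_extend v)"
proof (rule bounded_clinearI)
  note br = brep_row_extend[OF v]
  fix f g :: "'a l2" and c :: complex
  show "row_extend v (f + g) = row_extend v f + row_extend v g"
    by (rule l2_eqI_brep, use br[of "f + g"] br[of f] br[of g] AE_fst[OF brep_add[of f g]]
        brep_add[of "row_extend v f" "row_extend v g"] in eventually_elim) (simp add: distrib_left)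
  show "row_extend v (c *\<^sub>C f) = c *\<^sub>C row_extend v f"
    by (rule l2_eqI_brep, use br[of "c *\<^sub>C f"] br[of f] AE_fst[OF brep_scaleC[of c f]]
        brep_scaleC[of c "row_extend v f"] in eventually_elim) (simp add: mult.left_commute)
  show "norm (row_extend v f) \<le> sqrt C * norm f"
  proof (rule norm_le_from_sqn)
    have "sqn (brep (row_extend v f)) = sqn (\<lambda>p. cnj (v p) * brep f (fst p))"
      by (rule sqn_cong_AE) (rule br)
    also have "\<dots> \<le> ennreal C * sqn (brep f)"
      by (rule sqn_row_extend[OF v]) measurable
    finally show "sqn (brep (row_extend v f)) \<le> ennreal ((sqrt C)\<^sup>2) * sqn (brep f)"
      using v by (simp add: row_bounded_def)
  qed (use v in \<open>simp add: row_bounded_def\<close>)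
qed

lemma cinner_row_integral:
  fixes f :: "('a::euclidean_space \<times> 'b::euclidean_space) l2"
  assumes v: "row_bounded v C"
  shows "cinner (row_integral v f) g = cinner f (row_extend v g)"
proof -
  note [measurable] = row_bounded_measurable[OF v]
  define k where "k p = brep f p * cnj (brep (row_extend v g) p)" for p
  have [measurable]: "k \<in> borel_measurable borel" unfolding k_def by measurable
  have k: "integrable lborel k"
    unfolding k_def by (intro sq_integrable_mult_cnj sq_integrable_brep)
  have "AE p in lborel. v p * brep f p * cnj (brep g (fst p)) = k p"
    unfolding k_def using brep_row_extend[OF v, of g] by eventually_elim simp
  then have slices: "AE x in lborel. (LINT s|lborel. v (x, s) * brep f (x, s) * cnj (brep g x)) = (LINT s|lborel. k (x, s))"
    using integral_slice_cong[of "\<lambda>p. v p * brep f p * cnj (brep g (fst p))" k] by simp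
  have "cinner (row_integral v f) g = (LINT x|lborel. LINT s|lborel. k (x, s))"
    unfolding cinner_brep
  proof (rule integral_cong_AE)
    show "(\<lambda>x. LINT s|lborel. k (x, s)) \<in> borel_measurable lborel"
      using measurable_integral_slice[of k] by simp
    show "AE x in lborel. brep (row_integral v f) x * cnj (brep g x) = (LINT s|lborel. k (x, s))"
      using slices brep_row_integral[OF v, of f] row_integral_integrable[OF v, of f]
      by eventually_elim simp
  qed measurable
  also have "\<dots> = (LINT p|lborel. k p)"
    using lborel_pair.integral_fst'[of k] k by (simp add: lborel_prod)
  finally show ?thesis unfolding k_def cinner_brep .
qed

text \<open>Bessel's inequality for each row of the kernel gives the Hilbert--Schmidt bound.\<close>

lemma integral_operator_hilbert_schmidt:
  fixes K :: "'b::euclidean_space l2 \<Rightarrow> 'a::euclidean_space l2"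
  assumes [measurable]: "k \<in> borel_measurable borel" and fin: "sqn k < \<infinity>"
    and K: "\<And>e. AE x in lborel. brep (K e) x = (LINT s|lborel. k (x, s) * brep e s)"
    and E: "orthonormal E"
  shows "(\<Sum>e\<in>E. (norm (K e))\<^sup>2) \<le> enn2real (sqn k)"
proof -
  have finE: "finite E" using E by (simp add: orthonormal_def)
  have "(\<integral>\<^sup>+x. sqn (\<lambda>s. k (x, s)) \<partial>lborel) \<noteq> \<infinity>"
    using fin by (subst (asm) tonelli_borel) auto
  then have row: "AE x in lborel. sqn (\<lambda>s. k (x, s)) \<noteq> \<infinity>"
    by (intro nn_integral_noteq_infinite) auto
  have "AE x in lborel. \<forall>e\<in>E. brep (K e) x = (LINT s|lborel. k (x, s) * brep e s)"
    using K finE by (simp add: AE_ball_countable countable_finite)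
  with row have *: "AE x in lborel. (\<Sum>e\<in>E. ennreal ((cmod (brep (K e) x))\<^sup>2)) \<le> sqn (\<lambda>s. k (x, s))"
  proof eventually_elim
    case (elim x)
    define \<kappa> where "\<kappa> = abs_l2 (\<lambda>s. cnj (k (x, s)))"
    have \<kappa>: "AE s in lborel. brep \<kappa> s = cnj (k (x, s))"
      unfolding \<kappa>_def using elim(1) by (intro brep_abs) (auto simp: less_top)
    have "brep (K e) x = cinner e \<kappa>" if "e \<in> E" for e
    proof -
      have "brep (K e) x = (LINT s|lborel. k (x, s) * brep e s)" using elim that by simp
      also have "\<dots> = cinner e \<kappa>" unfolding cinner_brep
        by (rule integral_cong_AE) (use \<kappa> in \<open>auto elim: eventually_mono\<close>)
      finally show ?thesis .
    qed
    then have "(\<Sum>e\<in>E. ennreal ((cmod (brep (K e) x))\<^sup>2)) = ennreal (\<Sum>e\<in>E. (cmod (cinner \<kappa> e))\<^sup>2)"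
      by (simp add: sum_ennreal) (metis cinner_commute complex_mod_cnj)
    also have "\<dots> \<le> ennreal ((norm \<kappa>)\<^sup>2)" by (intro ennreal_leI bessel E)
    also have "\<dots> = sqn (\<lambda>s. k (x, s))"
      unfolding sqn_brep[symmetric] by (rule nn_integral_cong_AE) (use \<kappa> in \<open>auto elim: eventually_mono\<close>)
    finally show ?case .
  qed
  have "ennreal (\<Sum>e\<in>E. (norm (K e))\<^sup>2) = (\<Sum>e\<in>E. sqn (brep (K e)))"
    by (simp add: sqn_brep)
  also have "\<dots> = (\<integral>\<^sup>+x. (\<Sum>e\<in>E. ennreal ((cmod (brep (K e) x))\<^sup>2)) \<partial>lborel)"
    by (rule nn_integral_sum[symmetric]) measurable
  also have "\<dots> \<le> (\<integral>\<^sup>+x. sqn (\<lambda>s. k (x, s)) \<partial>lborel)"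
    using * by (rule nn_integral_mono_AE)
  also have "\<dots> = sqn k"
    by (rule tonelli_borel[symmetric]) measurable
  also have "\<dots> = ennreal (enn2real (sqn k))" using fin by (simp add: less_top)
  finally show ?thesis by (subst (asm) ennreal_le_iff) auto
qed

section \<open>Block operators and their Schur complement\<close>

definition block :: "complex \<Rightarrow> 'a \<Rightarrow> ('a \<Rightarrow> 'a) \<Rightarrow> ('b \<Rightarrow> 'a) \<Rightarrow> ('a \<Rightarrow> 'b) \<Rightarrow> ('b \<Rightarrow> 'b) \<Rightarrow>
    complex \<times> 'a::complex_inner \<times> 'b::complex_inner \<Rightarrow> complex \<times> 'a \<times> 'b"
  where "block c u A B Bs W = (\<lambda>f. (c * fst f + cinner (fst (snd f)) u,
    fst f *\<^sub>C u + A (fst (snd f)) + B (snd (snd f)), Bs (fst (snd f)) + W (snd (snd f))))"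

lemma bounded_clinear_block:
  assumes "bounded_clinear A" "bounded_clinear B" "bounded_clinear Bs" "bounded_clinear W"
  shows "bounded_clinear (block c u A B Bs W)"
  unfolding block_def
  by (intro bounded_clinear_intros bounded_clinear_compose[OF assms(1)] bounded_clinear_compose[OF assms(2)]
      bounded_clinear_compose[OF assms(3)] bounded_clinear_compose[OF assms(4)]
      bounded_clinear_compose[OF bounded_clinear_complex_mult])

lemma block_symmetric:
  assumes "c \<in> \<real>"
    and A: "\<And>f g. f \<in> U1 \<Longrightarrow> g \<in> U1 \<Longrightarrow> cinner (A f) g = cinner f (A g)"
    and B: "\<And>f g. f \<in> U2 \<Longrightarrow> g \<in> U1 \<Longrightarrow> cinner (B f) g = cinner f (Bs g)"
    and W: "\<And>f g. f \<in> U2 \<Longrightarrow> g \<in> U2 \<Longrightarrow> cinner (W f) g = cinner f (W g)"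
    and f: "f \<in> UNIV \<times> U1 \<times> U2" and g: "g \<in> UNIV \<times> U1 \<times> U2"
  shows "cinner (block c u A B Bs W f) g = cinner f (block c u A B Bs W g)"
proof -
  obtain f0 f1 f2 where f': "f = (f0, f1, f2)" "f1 \<in> U1" "f2 \<in> U2" using f by auto
  obtain g0 g1 g2 where g': "g = (g0, g1, g2)" "g1 \<in> U1" "g2 \<in> U2" using g by auto
  have "cinner (Bs f1) g2 = cinner f1 (B g2)"
    using B[of g2 f1] f' g' cinner_commute[of "Bs f1" g2] cinner_commute[of f1 "B g2"] by simp
  moreover have "cinner u g1 = cnj (cinner g1 u)" by (rule cinner_commute)
  ultimately show ?thesis
    using \<open>c \<in> \<real>\<close> f' g' A B W
    by (simp add: block_def cinner_prod_def cinner_complex_def cinner_add_left cinner_add_right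
        cinner_scaleC_left cinner_scaleC_right Reals_cnj_iff algebra_simps)
qed

lemma norm_triple_le: "norm (a, b, c) \<le> norm a + (norm b + norm c)"
  using norm_Pair_le[of a "(b, c)"] norm_Pair_le[of b c] by linarith

lemma norm_triple_ge:
  "norm a \<le> norm (a, b, c)" "norm b \<le> norm (a, b, c)" "norm c \<le> norm (a, b, c)"
proof -
  show "norm a \<le> norm (a, b, c)" by (rule norm_fst_le)
  have "norm (b, c) \<le> norm (a, b, c)" by (rule norm_snd_le)
  moreover have "norm b \<le> norm (b, c)" by (rule norm_fst_le)
  moreover have "norm c \<le> norm (b, c)" by (rule norm_snd_le)
  ultimately show "norm b \<le> norm (a, b, c)" "norm c \<le> norm (a, b, c)" by auto
qed

text \<open>
  Splitting \<open>K\<close> into a finite-rank and a small part turns \<open>D - K\<close> into an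
  invertible operator up to finite rank; by elimination of the last component the same holds for
  the block operator.
\<close>

lemma block_fredholm:
  fixes U1 :: "'a::{complex_inner, banach} set" and U2 :: "'b::complex_inner set"
  assumes U1: "complex_vector.subspace U1" "closed U1" and U2: "complex_vector.subspace U2"
    and u: "u \<in> U1"
    and bA: "bounded_clinear A" and bB: "bounded_clinear B" and bBs: "bounded_clinear Bs"
    and bW: "bounded_clinear W" and bWi: "bounded_clinear Wi" and bD: "bounded_clinear D"
    and bDi: "bounded_clinear Di" and bK: "bounded_clinear K"
    and mA: "\<And>f. f \<in> U1 \<Longrightarrow> A f \<in> U1" and mB: "\<And>f. f \<in> U2 \<Longrightarrow> B f \<in> U1"
    and mBs: "\<And>f. f \<in> U1 \<Longrightarrow> Bs f \<in> U2" and mW: "\<And>f. f \<in> U2 \<Longrightarrow> W f \<in> U2"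
    and mWi: "\<And>f. f \<in> U2 \<Longrightarrow> Wi f \<in> U2" and mDi: "\<And>f. f \<in> U1 \<Longrightarrow> Di f \<in> U1"
    and mK: "\<And>f. f \<in> U1 \<Longrightarrow> K f \<in> U1"
    and WWi: "\<And>f. f \<in> U2 \<Longrightarrow> W (Wi f) = f" and WiW: "\<And>f. f \<in> U2 \<Longrightarrow> Wi (W f) = f"
    and DDi: "\<And>f. f \<in> U1 \<Longrightarrow> D (Di f) = f" and DiD: "\<And>f. f \<in> U1 \<Longrightarrow> Di (D f) = f"
    and schur: "\<And>f. f \<in> U1 \<Longrightarrow> A f - B (Wi (Bs f)) = D f - K f"
    and small: "\<And>\<epsilon>. \<epsilon> > 0 \<Longrightarrow> \<exists>E. orthonormal E \<and> E \<subseteq> U1 \<and>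
      (\<forall>f\<in>U1. (\<forall>e\<in>E. cinner f e = 0) \<longrightarrow> norm (K f) \<le> \<epsilon> * norm f)"
  shows "fredholm_on (UNIV \<times> U1 \<times> U2) (block c u A B Bs W)"
proof -
  obtain d where d: "d > 0" "\<And>f. norm (Di f) \<le> d * norm f"
    using bounded_clinear_bound[OF bDi] by blast
  define \<epsilon> where "\<epsilon> = 1 / (2 * d)"
  have \<epsilon>: "\<epsilon> > 0" "d * \<epsilon> = 1/2" using d by (auto simp: \<epsilon>_def)
  obtain E where E: "orthonormal E" "E \<subseteq> U1"
    "\<And>f. f \<in> U1 \<Longrightarrow> (\<And>e. e \<in> E \<Longrightarrow> cinner f e = 0) \<Longrightarrow> norm (K f) \<le> \<epsilon> * norm f"
    using small[OF \<epsilon>(1)] by auto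
  define P where "P = proj E"
  have bP: "bounded_clinear P" unfolding P_def by (rule bounded_clinear_proj[OF E(1)])
  have mP: "P f \<in> U1" for f
    using proj_in_cspan[of E f] complex_vector.span_minimal[OF E(2) U1(1)] by (auto simp: P_def)
  define R where "R f = K (f - P f)" for f
  have bR: "bounded_clinear R"
    unfolding R_def by (intro bounded_clinear_compose[OF bK] bounded_clinear_intros bP)
  have mR: "R f \<in> U1" if "f \<in> U1" for f
    unfolding R_def using that mP U1(1) by (intro mK) (simp add: complex_vector.subspace_diff)
  have R: "norm (R f) \<le> \<epsilon> * norm f" if "f \<in> U1" for f
  proof -
    have "norm (R f) \<le> \<epsilon> * norm (f - P f)"
      unfolding R_def P_def
      by (rule E(3)) (use that mP U1(1) E(1) in \<open>auto simp: complex_vector.subspace_diff cinner_diff_proj P_def\<close>)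
    also have "\<dots> \<le> \<epsilon> * norm f"
      unfolding P_def using \<epsilon> by (intro mult_left_mono norm_diff_proj_le E) auto
    finally show ?thesis .
  qed
  have KP: "K (P f) = K f - R f" for f by (simp add: R_def bounded_clinear_diff[OF bK])
  define T where "T f = (fst f, A (fst (snd f)) + B (snd (snd f)) + K (P (fst (snd f))),
      Bs (fst (snd f)) + W (snd (snd f)))" for f :: "complex \<times> 'a \<times> 'b"
  define F where "F f = (c * fst f + cinner (fst (snd f)) u - fst f, fst f *\<^sub>C u - K (P (fst (snd f))), 0 :: 'b)"
    for f :: "complex \<times> 'a \<times> 'b"
  have bT: "bounded_clinear T"
    unfolding T_def
    by (intro bounded_clinear_intros bounded_clinear_compose[OF bA] bounded_clinear_compose[OF bB]
      bounded_clinear_compose[OF bBs] bounded_clinear_compose[OF bW] bounded_clinear_compose[OF bK]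
      bounded_clinear_compose[OF bP])
  have bF: "bounded_clinear F"
    unfolding F_def
    by (intro bounded_clinear_intros bounded_clinear_compose[OF bK] bounded_clinear_compose[OF bP]
      bounded_clinear_compose[OF bounded_clinear_complex_mult])
  have "block c u A B Bs W = (\<lambda>f. T f + F f)"
    by (auto simp: block_def T_def F_def)
  moreover have "fredholm_on (UNIV \<times> U1 \<times> U2) (\<lambda>f. T f + F f)"
  proof -
    obtain b where b: "b > 0" "\<And>f. norm (B f) \<le> b * norm f" using bounded_clinear_bound[OF bB] by blast
    obtain s where s: "s > 0" "\<And>f. norm (Bs f) \<le> s * norm f" using bounded_clinear_bound[OF bBs] by blast
    obtain w where w: "w > 0" "\<And>f. norm (Wi f) \<le> w * norm f" using bounded_clinear_bound[OF bWi] by blast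
    define C1 where "C1 = 2 * d * (1 + b * w)"
    define C2 where "C2 = w * (1 + s * C1)"
    define \<iota> where "\<iota> x = (0 :: complex, x :: 'a, 0 :: 'b)" for x
    have b\<iota>: "bounded_clinear \<iota>" unfolding \<iota>_def by (intro bounded_clinear_intros)
    define G where "G = insert (1, 0, 0) (insert (\<iota> u) ((\<lambda>e. \<iota> (K e)) ` E))"
    have U: "complex_vector.subspace (UNIV \<times> U1 \<times> U2)"
      using U1(1) U2 by (auto simp: complex_vector.subspace_def scaleC_prod_def zero_prod_def)
    show ?thesis
    proof (rule fredholm_on_finite_rank_perturbation[where B = G and C = "1 + C1 + C2", OF U bT bF])
      show "finite G" using E(1) by (simp add: G_def orthonormal_def)
      show "G \<subseteq> UNIV \<times> U1 \<times> U2"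
        using E(2) u U1(1) U2 mK by (auto simp: G_def \<iota>_def complex_vector.subspace_0)
      show "T f \<in> UNIV \<times> U1 \<times> U2" if "f \<in> UNIV \<times> U1 \<times> U2" for f
        using that U1(1) U2 mA mB mBs mW mK mP
        by (auto simp: T_def intro!: complex_vector.subspace_add)
      show "F f \<in> cspan G" if "f \<in> UNIV \<times> U1 \<times> U2" for f
      proof -
        have "\<iota> (K (P (fst (snd f)))) \<in> cspan ((\<lambda>e. \<iota> (K e)) ` E)"
          using proj_in_cspan[of E "fst (snd f)"]
            bounded_clinear_span_image[OF bounded_clinear_compose[OF b\<iota> bK], of E]
          by (auto simp: P_def)
        also have "\<dots> \<subseteq> cspan G" by (rule complex_vector.span_mono) (auto simp: G_def)
        finally have 1: "\<iota> (K (P (fst (snd f)))) \<in> cspan G" .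
        have 2: "(1, 0, 0) \<in> cspan G" "\<iota> u \<in> cspan G"
          by (auto simp: G_def intro: complex_vector.span_base)
        have "(c * fst f + cinner (fst (snd f)) u - fst f) *\<^sub>C (1, 0, 0) + fst f *\<^sub>C \<iota> u - \<iota> (K (P (fst (snd f)))) \<in> cspan G"
          by (intro complex_vector.span_add complex_vector.span_diff complex_vector.span_scale 1 2)
        also have "(c * fst f + cinner (fst (snd f)) u - fst f) *\<^sub>C (1, 0, 0) + fst f *\<^sub>C \<iota> u - \<iota> (K (P (fst (snd f)))) = F f"
          by (simp add: F_def \<iota>_def scaleC_prod_def scaleC_complex_def)
        finally show ?thesis .
      qed
      show "\<exists>f\<in>UNIV \<times> U1 \<times> U2. T f = g" if "g \<in> UNIV \<times> U1 \<times> U2" for g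
      proof -
        obtain g0 g1 g2 where g: "g = (g0, g1, g2)" "g1 \<in> U1" "g2 \<in> U2" using \<open>g \<in> _\<close> by auto
        define h where "h = g1 - B (Wi g2)"
        have h: "h \<in> U1" using g mB mWi U1(1) by (simp add: h_def complex_vector.subspace_diff)
        have "\<exists>!f\<in>U1. Di (h + R f) = f"
        proof (rule Banach_fix[where c = "1/2"])
          show "complete U1" using U1(2) by (simp add: complete_eq_closed)
          show "U1 \<noteq> {}" using h by auto
          show "(\<lambda>f. Di (h + R f)) ` U1 \<subseteq> U1"
            using h mR mDi U1(1) by (auto intro: complex_vector.subspace_add)
          show "dist (Di (h + R x)) (Di (h + R y)) \<le> 1/2 * dist x y" if "x \<in> U1" "y \<in> U1" for x y
          proof -
            have "Di (h + R x) - Di (h + R y) = Di (R (x - y))"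
              by (simp add: bounded_clinear_diff[OF bDi, symmetric] bounded_clinear_diff[OF bR])
            then have "dist (Di (h + R x)) (Di (h + R y)) \<le> d * norm (R (x - y))"
              using d by (simp add: dist_norm)
            also have "\<dots> \<le> d * (\<epsilon> * norm (x - y))"
              using d that U1(1) by (intro mult_left_mono R complex_vector.subspace_diff) auto
            also have "\<dots> = 1/2 * dist x y"
              using \<epsilon>(2) by (simp add: dist_norm mult.assoc[symmetric])
            finally show ?thesis .
          qed
        qed auto
        then obtain f1 where f1: "f1 \<in> U1" "Di (h + R f1) = f1" by blast
        have Df1: "D f1 = h + R f1"
          using DDi[of "h + R f1"] f1 h mR U1(1) by (simp add: complex_vector.subspace_add)
        define f2 where "f2 = Wi (g2 - Bs f1)"
        have gB: "g2 - Bs f1 \<in> U2" using g f1 mBs U2 by (simp add: complex_vector.subspace_diff)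
        have f2: "f2 \<in> U2" "W f2 = g2 - Bs f1" using gB mWi WWi by (auto simp: f2_def)
        have "A f1 + B f2 + K (P f1) = g1"
        proof -
          have "B f2 = B (Wi g2) - B (Wi (Bs f1))"
            by (simp add: f2_def bounded_clinear_diff[OF bWi] bounded_clinear_diff[OF bB])
          moreover have "A f1 = D f1 - K f1 + B (Wi (Bs f1))"
            using schur[OF f1(1)] by (simp add: algebra_simps)
          ultimately show ?thesis
            using Df1 by (simp add: KP h_def)
        qed
        then have "T (g0, f1, f2) = g" using f2 g by (simp add: T_def)
        then show ?thesis using f1 f2 by (intro bexI[of _ "(g0, f1, f2)"]) auto
      qed
      show "norm f \<le> (1 + C1 + C2) * norm (T f)" if "f \<in> UNIV \<times> U1 \<times> U2" for f
      proof -
        obtain f0 f1 f2 where f: "f = (f0, f1, f2)" "f1 \<in> U1" "f2 \<in> U2" using \<open>f \<in> _\<close> by auto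
        obtain g0 g1 g2 where g: "T f = (g0, g1, g2)" by (metis surj_pair)
        have g': "f0 = g0" "A f1 + B f2 + K (P f1) = g1" "Bs f1 + W f2 = g2"
          using g f by (auto simp: T_def)
        define N where "N = norm (T f)"
        have N: "norm g0 \<le> N" "norm g1 \<le> N" "norm g2 \<le> N" "N \<ge> 0"
          unfolding N_def g using norm_triple_ge by auto
        have Wig: "Wi g2 = Wi (Bs f1) + f2"
          using g'(3) WiW[OF f(3)] by (auto simp: bounded_clinear_add[OF bWi])
        then have Bf2: "B f2 = B (Wi g2) - B (Wi (Bs f1))"
          by (simp add: bounded_clinear_add[OF bB])
        have "D f1 = A f1 + K f1 - B (Wi (Bs f1))"
          using schur[OF f(2)] by (simp add: algebra_simps)
        moreover have "A f1 = g1 - B f2 - (K f1 - R f1)"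
          using g'(2) by (simp add: KP[symmetric] algebra_simps)
        ultimately have "D f1 = g1 - B (Wi g2) + R f1"
          by (simp add: Bf2)
        then have "f1 = Di (g1 - B (Wi g2) + R f1)" using DiD[OF f(2)] by metis
        then have "norm f1 \<le> d * norm (g1 - B (Wi g2) + R f1)" using d(2) by metis
        also have "\<dots> \<le> d * (N + b * (w * N) + \<epsilon> * norm f1)"
        proof (rule mult_left_mono)
          have "norm (B (Wi g2)) \<le> b * (w * N)"
            using b(2)[of "Wi g2"] w(2)[of g2] N b(1) w(1)
            by (meson mult_left_mono less_imp_le order_trans)
          then show "norm (g1 - B (Wi g2) + R f1) \<le> N + b * (w * N) + \<epsilon> * norm f1"
            using norm_triangle_ineq[of "g1 - B (Wi g2)" "R f1"] norm_triangle_ineq4[of g1 "B (Wi g2)"]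
              R[OF f(2)] N by linarith
        qed (use d in simp)
        also have "\<dots> = d * (1 + b * w) * N + 1/2 * norm f1"
        proof -
          have "d * (\<epsilon> * norm f1) = 1/2 * norm f1"
            using \<epsilon>(2) by (simp add: mult.assoc[symmetric])
          then show ?thesis by (simp add: algebra_simps)
        qed
        finally have f1N: "norm f1 \<le> C1 * N" by (simp add: C1_def)
        have "f2 = Wi (g2 - Bs f1)" using Wig by (simp add: bounded_clinear_diff[OF bWi])
        then have "norm f2 \<le> w * norm (g2 - Bs f1)" using w(2)[of "g2 - Bs f1"] by simp
        also have "\<dots> \<le> w * (N + s * (C1 * N))"
        proof (rule mult_left_mono)
          have "norm (Bs f1) \<le> s * (C1 * N)"
            using s(2)[of f1] mult_left_mono[OF f1N, of s] s(1) by linarith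
          then show "norm (g2 - Bs f1) \<le> N + s * (C1 * N)"
            using norm_triangle_ineq4[of g2 "Bs f1"] N by linarith
        qed (use w in simp)
        also have "\<dots> = C2 * N" by (simp add: C2_def algebra_simps)
        finally have f2N: "norm f2 \<le> C2 * N" .
        have "norm f \<le> norm f0 + (norm f1 + norm f2)"
          unfolding f by (rule norm_triple_le)
        also have "\<dots> \<le> N + (C1 * N + C2 * N)"
          unfolding g'(1) by (intro add_mono f1N f2N N)
        finally show ?thesis by (simp add: N_def algebra_simps)
      qed
    qed
  qed
  ultimately show ?thesis by simp
qed

text \<open>
  A vector \<open>f\<close> on which \<open>D\<close> and \<open>K\<close> are small extends by \<open>- Wi (Bs f)\<close> to a vector on which the
  block operator is small, because the elimination makes the last component vanish.
\<close>

lemma block_not_fredholm: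
  fixes U1 :: "'a::{complex_inner, banach} set" and U2 :: "'b::{complex_inner, banach} set"
  assumes U1: "complex_vector.subspace U1" "closed U1" and U2: "complex_vector.subspace U2" "closed U2"
    and bA: "bounded_clinear A" and bB: "bounded_clinear B" and bBs: "bounded_clinear Bs"
    and bW: "bounded_clinear W" and bWi: "bounded_clinear Wi"
    and mBs: "\<And>f. f \<in> U1 \<Longrightarrow> Bs f \<in> U2" and mWi: "\<And>f. f \<in> U2 \<Longrightarrow> Wi f \<in> U2"
    and WWi: "\<And>f. f \<in> U2 \<Longrightarrow> W (Wi f) = f"
    and schur: "\<And>f. f \<in> U1 \<Longrightarrow> A f - B (Wi (Bs f)) = D f - K f"
    and small: "\<And>\<epsilon>. \<epsilon> > 0 \<Longrightarrow> \<exists>E. orthonormal E \<and> E \<subseteq> U1 \<and>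
      (\<forall>f\<in>U1. (\<forall>e\<in>E. cinner f e = 0) \<longrightarrow> norm (K f) \<le> \<epsilon> * norm f)"
    and sing: "\<And>\<epsilon>. \<epsilon> > 0 \<Longrightarrow> \<exists>V. complex_vector.subspace V \<and> inf_dim V \<and> V \<subseteq> U1 \<and>
      (\<forall>f\<in>V. norm (D f) \<le> \<epsilon> * norm f)"
    and sym: "\<And>f g. f \<in> UNIV \<times> U1 \<times> U2 \<Longrightarrow> g \<in> UNIV \<times> U1 \<times> U2 \<Longrightarrow>
      cinner (block c u A B Bs W f) g = cinner f (block c u A B Bs W g)"
  shows "\<not> fredholm_on (UNIV \<times> U1 \<times> U2) (block c u A B Bs W)"
proof (rule not_fredholm_on_singular)
  show "complex_vector.subspace (UNIV \<times> U1 \<times> U2)"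
    using U1(1) U2(1) by (auto simp: complex_vector.subspace_def scaleC_prod_def zero_prod_def)
  show "closed (UNIV \<times> U1 \<times> U2)" by (intro closed_Times U1 U2 closed_UNIV)
  show "bounded_clinear (block c u A B Bs W)" by (intro bounded_clinear_block bA bB bBs bW)
  show "cinner (block c u A B Bs W f) g = cinner f (block c u A B Bs W g)"
    if "f \<in> UNIV \<times> U1 \<times> U2" "g \<in> UNIV \<times> U1 \<times> U2" for f g
    using that by (rule sym)
  fix F :: "(complex \<times> 'a \<times> 'b) set" and \<epsilon> :: real
  assume F: "finite F" and \<epsilon>: "\<epsilon> > 0"
  obtain E where E: "orthonormal E"
    "\<And>f. f \<in> U1 \<Longrightarrow> (\<And>e. e \<in> E \<Longrightarrow> cinner f e = 0) \<Longrightarrow> norm (K f) \<le> \<epsilon> / 2 * norm f"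
    using small[of "\<epsilon> / 2"] \<epsilon> by auto
  obtain V where V: "complex_vector.subspace V" "inf_dim V" "V \<subseteq> U1"
    "\<And>f. f \<in> V \<Longrightarrow> norm (D f) \<le> \<epsilon> / 2 * norm f"
    using sing[of "\<epsilon> / 2"] \<epsilon> by auto
  define \<iota> where "\<iota> f = (0 :: complex, f, 0 - Wi (Bs f))" for f
  have b\<iota>: "bounded_clinear \<iota>"
    unfolding \<iota>_def
    by (intro bounded_clinear_intros bounded_clinear_compose[OF bWi] bounded_clinear_compose[OF bBs])
  define \<Phi> where "\<Phi> = insert (\<lambda>f. cinner f u) ((\<lambda>e f. cinner f e) ` E \<union> (\<lambda>h f. cinner (\<iota> f) h) ` F)"
  have "\<exists>f\<in>V. f \<noteq> 0 \<and> (\<forall>\<phi>\<in>\<Phi>. \<phi> f = 0)"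
  proof (rule inf_dim_common_kernel)
    show "finite \<Phi>" using F E(1) by (simp add: \<Phi>_def orthonormal_def)
    show "bounded_clinear \<phi>" if "\<phi> \<in> \<Phi>" for \<phi>
      using that bounded_clinear_cinner bounded_clinear_compose[OF bounded_clinear_cinner b\<iota>]
      by (auto simp: \<Phi>_def)
  qed (rule V)+
  then obtain f where f: "f \<in> V" "f \<noteq> 0" "cinner f u = 0" "\<And>e. e \<in> E \<Longrightarrow> cinner f e = 0"
    "\<And>h. h \<in> F \<Longrightarrow> cinner (\<iota> f) h = 0"
    by (auto simp: \<Phi>_def ball_Un)
  have fU: "f \<in> U1" using f V by auto
  have "block c u A B Bs W (\<iota> f) = (0, D f - K f, 0)"
    using f(3) schur[OF fU] WWi[OF mBs[OF fU]]
    by (simp add: block_def \<iota>_def bounded_clinear_minus[OF bB] bounded_clinear_minus[OF bW])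
  then have "norm (block c u A B Bs W (\<iota> f)) = norm (D f - K f)" by (simp add: norm_prod_def)
  also have "\<dots> \<le> \<epsilon> / 2 * norm f + \<epsilon> / 2 * norm f"
    using norm_triangle_ineq4[of "D f" "K f"] V(4)[OF f(1)] E(2)[OF fU f(4)] by linarith
  also have "\<dots> \<le> \<epsilon> * norm (\<iota> f)"
    using \<epsilon> norm_triple_ge(2)[of f "0 :: complex"] by (simp add: \<iota>_def)
  finally have "norm (block c u A B Bs W (\<iota> f)) \<le> \<epsilon> * norm (\<iota> f)" .
  moreover have "\<iota> f \<in> UNIV \<times> U1 \<times> U2"
    using fU mBs mWi U2(1) by (auto simp: \<iota>_def intro: complex_vector.subspace_neg)
  moreover have "\<iota> f \<noteq> 0" using f(2) by (simp add: \<iota>_def zero_prod_def)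
  ultimately show "\<exists>e\<in>UNIV \<times> U1 \<times> U2. e \<noteq> 0 \<and> (\<forall>h\<in>F. cinner e h = 0) \<and>
      norm (block c u A B Bs W e) \<le> \<epsilon> * norm e"
    using f(5) by (intro bexI[of _ "\<iota> f"]) auto
qed

section \<open>The coordinate swap and symmetric functions\<close>

lemma borel_measurable_swap [measurable]:
  "prod.swap \<in> measurable (borel :: ('a::euclidean_space \<times> 'b::euclidean_space) measure) borel"
proof -
  have "(\<lambda>p :: 'a \<times> 'b. (snd p, fst p)) \<in> borel_measurable borel"
    by measurable
  then show ?thesis by (simp add: prod.swap_def[abs_def])
qed

lemma distr_lborel_swap:
  "distr lborel borel prod.swap = (lborel :: ('a::euclidean_space \<times> 'a) measure)"
proof -
  have "(lborel :: ('a \<times> 'a) measure) = lborel \<Otimes>\<^sub>M lborel"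
    by (rule lborel_prod[symmetric])
  also have "\<dots> = distr (lborel \<Otimes>\<^sub>M lborel) (lborel \<Otimes>\<^sub>M lborel) (\<lambda>(x, y). (y, x))"
    by (rule lborel_pair.distr_pair_swap)
  also have "\<dots> = distr lborel borel prod.swap"
  proof (rule distr_cong)
    show "sets (lborel \<Otimes>\<^sub>M lborel) = sets (borel :: ('a \<times> 'a) measure)"
      by (simp only: lborel_prod sets_lborel)
  qed (auto simp: lborel_prod)
  finally show ?thesis by simp
qed

lemma AE_swap:
  fixes P :: "'a::euclidean_space \<times> 'a \<Rightarrow> bool"
  assumes "AE p in lborel. P p"
  shows "AE p in lborel. P (prod.swap p)"
proof (rule AE_distrD[of prod.swap lborel borel P])
  show "AE p in distr lborel borel prod.swap. P p"
    unfolding distr_lborel_swap by (rule assms)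
qed simp

lemma nn_integral_swap:
  fixes f :: "'a::euclidean_space \<times> 'a \<Rightarrow> ennreal"
  assumes "f \<in> borel_measurable borel"
  shows "(\<integral>\<^sup>+p. f (prod.swap p) \<partial>lborel) = (\<integral>\<^sup>+p. f p \<partial>lborel)"
  using nn_integral_distr[of prod.swap lborel borel f] assms by (simp add: distr_lborel_swap)

lemma integral_swap:
  fixes f :: "'a::euclidean_space \<times> 'a \<Rightarrow> complex"
  assumes "f \<in> borel_measurable borel"
  shows "(LINT p|lborel. f (prod.swap p)) = (LINT p|lborel. f p)"
  using integral_distr[of prod.swap lborel borel f] assms by (simp add: distr_lborel_swap)

definition swp :: "('a::euclidean_space \<times> 'a) l2 \<Rightarrow> ('a \<times> 'a) l2"
  where "swp f = abs_l2 (\<lambda>p. brep f (prod.swap p))"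

lemma sqn_swap:
  fixes f :: "'a::euclidean_space \<times> 'a \<Rightarrow> complex"
  assumes [measurable]: "f \<in> borel_measurable borel"
  shows "sqn (\<lambda>p. f (prod.swap p)) = sqn f"
  by (rule nn_integral_swap[of "\<lambda>p. ennreal ((cmod (f p))\<^sup>2)"]) measurable

lemma brep_swp: "AE p in lborel. brep (swp f) p = brep f (prod.swap p)"
  unfolding swp_def by (intro brep_abs) (simp_all add: sqn_swap sqn_brep)

lemma norm_swp: "norm (swp f) = norm f"
proof -
  have "sqn (brep (swp f)) = sqn (\<lambda>p. brep f (prod.swap p))"
    by (rule sqn_cong_AE) (rule brep_swp)
  also have "\<dots> = sqn (brep f)" by (rule sqn_swap) measurable
  finally have "(norm (swp f))\<^sup>2 = (norm f)\<^sup>2" by (simp add: sqn_brep)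
  then show ?thesis by (simp add: power2_eq_iff_nonneg)
qed

lemma bounded_clinear_swp: "bounded_clinear swp"
proof (rule bounded_clinearI)
  fix f g :: "('a \<times> 'a) l2" and c
  show "swp (f + g) = swp f + swp g"
    by (rule l2_eqI_brep, use brep_swp[of "f + g"] brep_swp[of f] brep_swp[of g] AE_swap[OF brep_add[of f g]]
        brep_add[of "swp f" "swp g"] in eventually_elim) simp
  show "swp (c *\<^sub>C f) = c *\<^sub>C swp f"
    by (rule l2_eqI_brep, use brep_swp[of "c *\<^sub>C f"] brep_swp[of f] AE_swap[OF brep_scaleC[of c f]]
        brep_scaleC[of c "swp f"] in eventually_elim) simp
  show "norm (swp f) \<le> 1 * norm f" by (simp add: norm_swp)
qed

lemma swp_swp [simp]: "swp (swp f) = f"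
  by (rule l2_eqI_brep, use brep_swp[of "swp f"] AE_swap[OF brep_swp[of f]] in eventually_elim) simp

lemma cinner_swp: "cinner (swp f) g = cinner f (swp g)"
proof -
  define k where "k p = brep f (prod.swap p) * cnj (brep g p)" for p
  have [measurable]: "k \<in> borel_measurable borel" unfolding k_def by measurable
  have "cinner (swp f) g = (LINT p|lborel. k p)"
    unfolding cinner_brep
    by (rule integral_cong_AE) (use brep_swp[of f] in \<open>auto simp: k_def elim: eventually_mono\<close>)
  also have "\<dots> = (LINT p|lborel. k (prod.swap p))"
    by (rule integral_swap[symmetric]) measurable
  also have "\<dots> = cinner f (swp g)"
    unfolding cinner_brep
    by (rule integral_cong_AE) (use brep_swp[of g] in \<open>auto simp: k_def elim: eventually_mono\<close>)
  finally show ?thesis .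
qed

text \<open>
  The orthogonal projection onto the symmetric functions. The adjoint of an operator restricted to
  symmetric functions is the full adjoint followed by this projection.
\<close>

definition symmetrize :: "('a::euclidean_space \<times> 'a) l2 \<Rightarrow> ('a \<times> 'a) l2"
  where "symmetrize f = (1/2) *\<^sub>C (f + swp f)"

lemma bounded_clinear_symmetrize: "bounded_clinear symmetrize"
  unfolding symmetrize_def by (intro bounded_clinear_intros bounded_clinear_swp)

lemma swp_symmetrize: "swp (symmetrize f) = symmetrize f"
  by (simp add: symmetrize_def bounded_clinear_scaleC[OF bounded_clinear_swp]
      bounded_clinear_add[OF bounded_clinear_swp] add.commute)

lemma cinner_symmetrize_right:
  assumes "swp f = f"
  shows "cinner f (symmetrize g) = cinner f g"
  using cinner_swp[of f g] assms
  by (simp add: symmetrize_def cinner_scaleC_right cinner_add_right)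

section \<open>Function spaces on subsets\<close>

lemma subspace_L2_on: "complex_vector.subspace (L2_on S)"
  unfolding complex_vector.subspace_def
proof (intro conjI ballI allI)
  show "0 \<in> L2_on S"
    unfolding L2_on_brep using brep_zero by eventually_elim simp
  fix f g c assume "f \<in> L2_on S"
  then have f: "AE x in lborel. x \<notin> S \<longrightarrow> brep f x = 0" by (simp add: L2_on_brep)
  show "c *\<^sub>C f \<in> L2_on S"
    unfolding L2_on_brep using f brep_scaleC[of c f] by eventually_elim simp
  assume "g \<in> L2_on S"
  then have g: "AE x in lborel. x \<notin> S \<longrightarrow> brep g x = 0" by (simp add: L2_on_brep)
  show "f + g \<in> L2_on S"
    unfolding L2_on_brep using f g brep_add[of f g] by eventually_elim simp
qed

lemma L2_on_mono: "S \<subseteq> T \<Longrightarrow> L2_on S \<subseteq> L2_on T"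
  by (auto simp: L2_on_brep elim!: eventually_mono)

lemma bounded_mult_indicator:
  "S \<in> sets borel \<Longrightarrow> bounded_mult (indicator S :: _ \<Rightarrow> complex)"
  by (rule bounded_multI[where C = 1]) (auto simp: indicator_def)

lemma L2_on_iff_mul_indicator:
  assumes "S \<in> sets borel"
  shows "f \<in> L2_on S \<longleftrightarrow> mul (indicator S) f = f"
proof
  assume "f \<in> L2_on S"
  then have "AE x in lborel. x \<notin> S \<longrightarrow> brep f x = 0" by (simp add: L2_on_brep)
  then show "mul (indicator S) f = f"
    using brep_mul[OF bounded_mult_indicator[OF assms], of f]
    by (intro l2_eqI_brep, eventually_elim) (auto simp: indicator_def)
next
  assume "mul (indicator S) f = f"
  then have "AE x in lborel. brep f x = indicator S x * brep f x"
    using brep_mul[OF bounded_mult_indicator[OF assms], of f] by simp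
  then show "f \<in> L2_on S"
    unfolding L2_on_brep by eventually_elim (auto simp: indicator_def)
qed

lemma closed_L2_on:
  assumes "S \<in> sets borel"
  shows "closed (L2_on S)"
proof -
  have "L2_on S = {f. mul (indicator S) f = f}"
    using L2_on_iff_mul_indicator[OF assms] by blast
  also have "closed \<dots>"
    by (intro closed_Collect_eq continuous_on_bounded_clinear bounded_clinear_mul
        bounded_mult_indicator assms continuous_on_id)
  finally show ?thesis .
qed

lemma L2_sym_iff:
  fixes S :: "'a::euclidean_space set"
  assumes "S \<in> sets borel"
  shows "f \<in> L2_sym S \<longleftrightarrow> f \<in> L2_on (S \<times> S) \<and> swp f = f"
proof -
  have SS: "S \<times> S \<in> sets (borel :: ('a \<times> 'a) measure)"
    using assms by (simp add: borel_prod[symmetric])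
  then have SS': "S \<times> S \<in> sets lebesgue" by simp
  have sym: "f \<in> L2_sym S \<longleftrightarrow> f \<in> L2_on (S \<times> S) \<and>
      (AE p in lborel. p \<in> S \<times> S \<longrightarrow> rep_l2 f p = rep_l2 f (prod.swap p))"
    unfolding L2_sym_def using SS'
    by (auto simp: AE_restrict_space_iff case_prod_beta' AE_lebesgue_iff prod.swap_def)
  have rep: "AE p in lborel. rep_l2 f p = brep f p \<and> rep_l2 f (prod.swap p) = brep f (prod.swap p)"
    using AE_rep_eq_brep[of f] AE_swap[OF AE_rep_eq_brep[of f]] by eventually_elim simp
  show ?thesis
    unfolding sym
  proof (rule conj_cong[OF refl])
    assume "f \<in> L2_on (S \<times> S)"
    then have out: "AE p in lborel. p \<notin> S \<times> S \<longrightarrow> brep f p = 0" by (simp add: L2_on_brep)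
    show "(AE p in lborel. p \<in> S \<times> S \<longrightarrow> rep_l2 f p = rep_l2 f (prod.swap p)) \<longleftrightarrow> swp f = f"
    proof
      assume "AE p in lborel. p \<in> S \<times> S \<longrightarrow> rep_l2 f p = rep_l2 f (prod.swap p)"
      then show "swp f = f"
        using rep out AE_swap[OF out] brep_swp[of f]
        by (intro l2_eqI_brep, eventually_elim) auto
    next
      assume "swp f = f"
      with brep_swp[of f] have "AE p in lborel. brep f p = brep f (prod.swap p)" by simp
      with rep show "AE p in lborel. p \<in> S \<times> S \<longrightarrow> rep_l2 f p = rep_l2 f (prod.swap p)"
        by eventually_elim auto
    qed
  qed
qed

lemma subspace_L2_sym:
  assumes "S \<in> sets borel"
  shows "complex_vector.subspace (L2_sym S)"
  using subspace_L2_on[of "S \<times> S"]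
  by (auto simp: complex_vector.subspace_def L2_sym_iff[OF assms] bounded_clinear_swp
      bounded_clinear_add[OF bounded_clinear_swp] bounded_clinear_scaleC[OF bounded_clinear_swp])

lemma closed_L2_sym:
  fixes S :: "'a::euclidean_space set"
  assumes "S \<in> sets borel"
  shows "closed (L2_sym S)"
proof -
  have SS: "S \<times> S \<in> sets (borel :: ('a \<times> 'a) measure)"
    using assms by (simp add: borel_prod[symmetric])
  have "L2_sym S = L2_on (S \<times> S) \<inter> {f. swp f = f}"
    using L2_sym_iff[OF assms] by blast
  also have "closed \<dots>"
    by (intro closed_Int closed_L2_on SS closed_Collect_eq continuous_on_bounded_clinear
        bounded_clinear_swp continuous_on_id)
  finally show ?thesis .
qed

lemma mul_in_L2_on:
  assumes "bounded_mult \<phi>" "f \<in> L2_on S"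
  shows "mul \<phi> f \<in> L2_on S"
  using assms(2) unfolding L2_on_brep
  by (rule eventually_elim2[OF _ brep_mul[OF assms(1), of f]]) simp

lemma swp_mul:
  assumes "bounded_mult \<phi>" "\<And>p. \<phi> (prod.swap p) = \<phi> p"
  shows "swp (mul \<phi> f) = mul \<phi> (swp f)"
  by (rule l2_eqI_brep, use brep_swp[of "mul \<phi> f"] brep_mul[OF assms(1), of "swp f"] brep_swp[of f]
      AE_swap[OF brep_mul[OF assms(1), of f]] in eventually_elim) (simp add: assms(2))

lemma mul_in_L2_sym:
  assumes "S \<in> sets borel" "bounded_mult \<phi>" "\<And>p. \<phi> (prod.swap p) = \<phi> p" "f \<in> L2_sym S"
  shows "mul \<phi> f \<in> L2_sym S"
  using assms(4) by (simp add: L2_sym_iff[OF assms(1)] mul_in_L2_on[OF assms(2)] swp_mul[OF assms(2,3)])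

lemma symmetrize_in_L2_sym:
  assumes "S \<in> sets borel" "f \<in> L2_on (S \<times> S)"
  shows "symmetrize f \<in> L2_sym S"
proof -
  have "swp f \<in> L2_on (S \<times> S)"
    using assms(2) unfolding L2_on_brep
    by (rule eventually_elim2[OF AE_swap brep_swp[of f]]) auto
  then have "symmetrize f \<in> L2_on (S \<times> S)"
    unfolding symmetrize_def using assms(2)
    by (intro complex_vector.subspace_add[OF subspace_L2_on] complex_vector.subspace_scale[OF subspace_L2_on])
  then show ?thesis by (simp add: L2_sym_iff[OF assms(1)] swp_symmetrize)
qed

lemma mul_comp:
  assumes "bounded_mult \<phi>" "bounded_mult \<psi>"
    and "AE x in lborel. brep f x = 0 \<or> \<phi> x * \<psi> x = 1"
  shows "mul \<phi> (mul \<psi> f) = f"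
  by (rule l2_eqI_brep, use brep_mul[OF assms(1), of "mul \<psi> f"] brep_mul[OF assms(2), of f] assms(3)
      in eventually_elim) (auto simp: mult.assoc[symmetric])

section \<open>Function spaces are infinite-dimensional\<close>

lemma small_ball:
  assumes "\<eta> > 0"
  shows "\<exists>r>0. \<forall>c :: 'a::euclidean_space. \<forall>s. 0 < s \<longrightarrow> s \<le> r \<longrightarrow> emeasure lborel (ball c s) \<le> ennreal \<eta>"
proof -
  define V where "V = unit_ball_vol (real DIM('a))"
  define r where "r = min 1 (\<eta> / V)"
  have V: "V > 0" by (simp add: V_def)
  have r: "r > 0" "r \<le> 1" using assms V by (auto simp: r_def)
  have "emeasure lborel (ball c s) \<le> ennreal \<eta>" if "0 < s" "s \<le> r" for c :: 'a and s
  proof -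
    have "s ^ DIM('a) \<le> s ^ 1"
      using that r by (intro power_decreasing) (auto simp: Suc_le_eq)
    then have "V * s ^ DIM('a) \<le> V * r" using that V by simp
    also have "\<dots> \<le> \<eta>" using V by (simp add: r_def min_def field_simps)
    finally show ?thesis
      using that by (simp add: emeasure_ball V_def ennreal_leI)
  qed
  with r show ?thesis by blast
qed

text \<open>
  Countably many balls of small measure cover the space, and one of them must carry a positive part
  of \<open>E\<close> without exhausting it.
\<close>

lemma split_positive_measure:
  fixes E :: "'a::euclidean_space set"
  assumes "E \<in> sets borel" "0 < emeasure lborel E" "emeasure lborel E < \<infinity>"
  shows "\<exists>E'\<in>sets borel. E' \<subseteq> E \<and> 0 < emeasure lborel E' \<and> 0 < emeasure lborel (E - E')"
proof -
  obtain m where m: "emeasure lborel E = ennreal m" "m > 0"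
    using assms(2,3) by (cases "emeasure lborel E") auto
  from small_ball[of "m / 2", where ?'a = 'a] m(2) obtain r where r: "r > 0"
    "\<And>c :: 'a. emeasure lborel (ball c r) \<le> ennreal (m / 2)"
    by auto
  have half: "emeasure lborel (ball c r) < emeasure lborel E" for c :: 'a
    unfolding m(1) by (rule le_less_trans[OF r(2)[of c]]) (use m(2) in \<open>simp add: ennreal_less_iff\<close>)
  obtain Q :: "'a set" where Q: "countable Q" "\<And>x. \<exists>q\<in>Q. dist q x < r"
  proof -
    obtain Q :: "'a set" where "countable Q" "\<And>X. open X \<Longrightarrow> X \<noteq> {} \<Longrightarrow> \<exists>d\<in>Q. d \<in> X"
      using countable_dense_setE by blast
    then show ?thesis
      using that[of Q] r(1) by (metis ball_eq_empty dist_commute mem_ball not_le open_ball)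
  qed
  have "\<exists>q\<in>Q. 0 < emeasure lborel (E \<inter> ball q r)"
  proof (rule ccontr)
    assume "\<not> ?thesis"
    then have "(\<Union>q\<in>Q. E \<inter> ball q r) \<in> null_sets lborel"
      using Q(1) assms(1) by (intro null_sets_UN') (auto simp: null_sets_def)
    moreover have "(\<Union>q\<in>Q. E \<inter> ball q r) = E" using Q(2) by auto
    ultimately show False using assms(2) by (simp add: null_sets_def)
  qed
  then obtain q where q: "0 < emeasure lborel (E \<inter> ball q r)" by blast
  have "emeasure lborel (E - E \<inter> ball q r) \<noteq> 0"
  proof
    assume "emeasure lborel (E - E \<inter> ball q r) = 0"
    then have "emeasure lborel E \<le> 0 + emeasure lborel (ball q r)"
      using emeasure_subadditive[of "E - E \<inter> ball q r" lborel "ball q r"] assms(1)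
        emeasure_mono[of E "(E - E \<inter> ball q r) \<union> ball q r" lborel]
      by (auto intro: order_trans)
    with half[of q] show False by simp
  qed
  with q assms(1) show ?thesis
    by (intro bexI[of _ "E \<inter> ball q r"]) (auto simp: zero_less_iff_neq_zero)
qed

text \<open>
  Splitting again and again produces infinitely many disjoint subsets of positive measure, whose indicator
  functions are orthogonal.
\<close>

lemma inf_dim_L2_on:
  fixes E :: "'a::euclidean_space set"
  assumes "E \<in> sets borel" "0 < emeasure lborel E"
  shows "inf_dim (L2_on E)"
proof -
  have "\<exists>n :: nat. 0 < emeasure lborel (E \<inter> ball 0 (real n))"
  proof (rule ccontr)
    assume "\<not> ?thesis"
    then have "(\<Union>n :: nat. E \<inter> ball 0 (real n)) \<in> null_sets lborel"
      using assms(1) by (intro null_sets_UN) (auto simp: null_sets_def)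
    moreover have "(\<Union>n :: nat. E \<inter> ball 0 (real n)) = E"
      using reals_Archimedean2 by auto
    ultimately show False using assms(2) by (simp add: null_sets_def)
  qed
  then obtain n :: nat where n: "0 < emeasure lborel (E \<inter> ball 0 (real n))" by blast
  define E0 where "E0 = E \<inter> ball 0 (real n)"
  have E0: "E0 \<in> sets borel" "0 < emeasure lborel E0" "emeasure lborel E0 < \<infinity>"
    using n assms(1) emeasure_bounded_finite[of E0] bounded_subset[OF bounded_ball, of E0 0 "real n"]
    by (auto simp: E0_def)
  have "\<exists>A :: nat \<Rightarrow> 'a set. \<forall>k. (A k \<in> sets borel \<and> A k \<subseteq> E0 \<and> 0 < emeasure lborel (A k)) \<and>
      (A (Suc k) \<subseteq> A k \<and> 0 < emeasure lborel (A k - A (Suc k)))"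
  proof (rule dependent_nat_choice)
    show "\<exists>A. A \<in> sets borel \<and> A \<subseteq> E0 \<and> 0 < emeasure lborel A" using E0 by blast
    fix A :: "'a set" and k :: nat
    assume A: "A \<in> sets borel \<and> A \<subseteq> E0 \<and> 0 < emeasure lborel A"
    then have "emeasure lborel A < \<infinity>"
      using E0 emeasure_mono[of A E0 lborel] by (auto intro: le_less_trans)
    with A obtain A' where "A' \<in> sets borel" "A' \<subseteq> A" "0 < emeasure lborel A'" "0 < emeasure lborel (A - A')"
      using split_positive_measure[of A] by blast
    with A show "\<exists>A'. (A' \<in> sets borel \<and> A' \<subseteq> E0 \<and> 0 < emeasure lborel A') \<and>
        A' \<subseteq> A \<and> 0 < emeasure lborel (A - A')"
      by (intro exI[of _ A']) auto
  qed
  then obtain A :: "nat \<Rightarrow> 'a set" where A: "\<And>k. A k \<in> sets borel" "\<And>k. A k \<subseteq> E0"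
    "\<And>k. A (Suc k) \<subseteq> A k" "\<And>k. 0 < emeasure lborel (A k - A (Suc k))"
    by blast
  define R where "R k = A k - A (Suc k)" for k
  have R: "R k \<in> sets borel" "R k \<subseteq> E0" "0 < emeasure lborel (R k)" for k
    using A by (auto simp: R_def)
  have disj: "R i \<inter> R j = {}" if "i < j" for i j
    using lift_Suc_antimono_le[of A, OF A(3), of "Suc i" j] that by (auto simp: R_def)
  have disj': "R i \<inter> R j = {}" if "i \<noteq> j" for i j
    using that disj[of i j] disj[of j i] by (cases i j rule: linorder_cases) auto
  define g where "g k = abs_l2 (indicator (R k) :: 'a \<Rightarrow> complex)" for k
  have sq: "sqn (indicator (R k)) = emeasure lborel (R k)" for k
  proof -
    have "(\<lambda>x. ennreal ((cmod (indicator (R k) x))\<^sup>2)) = indicator (R k)"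
      by (auto simp: indicator_def)
    then show ?thesis using R(1) by simp
  qed
  have fin: "sqn (indicator (R k)) < \<infinity>" for k
    unfolding sq using emeasure_mono[OF R(2)[of k], of lborel] E0 by (auto intro: le_less_trans)
  have g: "AE x in lborel. brep (g k) x = indicator (R k) x" for k
    unfolding g_def by (rule brep_abs[OF _ fin]) (use R(1) in measurable)
  show ?thesis
  proof (rule inf_dim_orthogonal_sequence[of g])
    show "cinner (g i) (g j) = 0" if "i \<noteq> j" for i j
    proof -
      have "AE x in lborel. brep (g i) x * cnj (brep (g j) x) = 0"
        using g[of i] g[of j] by eventually_elim (use disj'[OF that] in \<open>auto simp: indicator_def\<close>)
      then show ?thesis
        unfolding cinner_brep by (rule integral_eq_zero_AE)
    qed
    show "g i \<noteq> 0" for i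
    proof
      assume "g i = 0"
      then have "sqn (brep (g i)) = 0" by (simp add: sqn_brep)
      moreover have "sqn (brep (g i)) = emeasure lborel (R i)"
        unfolding sq[symmetric] by (rule sqn_cong_AE) (rule g)
      ultimately show False using R(3)[of i] by simp
    qed
    show "range g \<subseteq> L2_on E"
    proof clarify
      fix k
      show "g k \<in> L2_on E"
        unfolding L2_on_brep using g[of k]
        by eventually_elim (use R(2)[of k] in \<open>auto simp: indicator_def E0_def\<close>)
    qed
  qed
qed

section \<open>Products of partial integral and multiplication operators\<close>

definition row_weight :: "('a::euclidean_space \<times> 'a \<Rightarrow> complex) \<Rightarrow> ('a \<times> 'a \<Rightarrow> complex) \<Rightarrow> 'a \<Rightarrow> complex"
  where "row_weight v \<phi> x = (LINT s|lborel. \<phi> (x, s) * complex_of_real ((cmod (v (x, s)))\<^sup>2))"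

lemma row_weight_bound:
  fixes v :: "'a::euclidean_space \<times> 'a \<Rightarrow> complex"
  assumes v: "row_bounded v C" and [measurable]: "\<phi> \<in> borel_measurable borel"
    and \<phi>: "AE p in lborel. v p = 0 \<or> cmod (\<phi> p) \<le> c"
  shows "AE x in lborel. integrable lborel (\<lambda>s. \<phi> (x, s) * complex_of_real ((cmod (v (x, s)))\<^sup>2)) \<and>
    cmod (row_weight v \<phi> x) \<le> \<bar>c\<bar> * C"
proof -
  note [measurable] = row_bounded_measurable[OF v]
  have C: "C \<ge> 0" and "AE x in lborel. sqn (\<lambda>s. v (x, s)) \<le> ennreal C"
    using v by (auto simp: row_bounded_def)
  from this(2) AE_slices[OF \<phi>] show ?thesis
  proof eventually_elim
    case (elim x)
    let ?h = "\<lambda>s. \<phi> (x, s) * complex_of_real ((cmod (v (x, s)))\<^sup>2)"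
    have "ennreal (norm (?h s)) \<le> ennreal \<bar>c\<bar> * ennreal ((cmod (v (x, s)))\<^sup>2)"
      if "v (x, s) = 0 \<or> cmod (\<phi> (x, s)) \<le> c" for s
    proof (cases "v (x, s) = 0")
      case False
      with that show ?thesis
        by (auto simp: norm_mult norm_power ennreal_mult[symmetric] intro!: ennreal_leI mult_right_mono)
    qed simp
    with elim(2) have "(\<integral>\<^sup>+s. ennreal (norm (?h s)) \<partial>lborel) \<le>
        (\<integral>\<^sup>+s. ennreal \<bar>c\<bar> * ennreal ((cmod (v (x, s)))\<^sup>2) \<partial>lborel)"
      by (intro nn_integral_mono_AE) (auto elim!: eventually_mono)
    also have "\<dots> = ennreal \<bar>c\<bar> * sqn (\<lambda>s. v (x, s))" by (simp add: nn_integral_cmult)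
    also have "\<dots> \<le> ennreal \<bar>c\<bar> * ennreal C" by (intro mult_left_mono elim) simp
    also have "\<dots> = ennreal (\<bar>c\<bar> * C)" using C by (simp add: ennreal_mult)
    finally have le: "(\<integral>\<^sup>+s. ennreal (norm (?h s)) \<partial>lborel) \<le> ennreal (\<bar>c\<bar> * C)" .
    then have int: "integrable lborel ?h"
      by (intro integrableI_bounded) (auto intro: le_less_trans)
    have "ennreal (cmod (row_weight v \<phi> x)) \<le> ennreal (\<bar>c\<bar> * C)"
      unfolding row_weight_def using integral_norm_bound_ennreal[OF int] le by (rule order_trans)
    then have "cmod (row_weight v \<phi> x) \<le> \<bar>c\<bar> * C"
      using C by (subst (asm) ennreal_le_iff) auto
    with int show ?case by blast
  qed
qed

lemma measurable_row_weight:
  assumes [measurable]: "v \<in> borel_measurable borel" "\<phi> \<in> borel_measurable borel"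
  shows "row_weight v \<phi> \<in> borel_measurable borel"
  unfolding row_weight_def[abs_def]
  by (rule measurable_integral_slice[of "\<lambda>p. \<phi> p * complex_of_real ((cmod (v p))\<^sup>2)"]) measurable

lemma bounded_mult_row_weight:
  assumes v: "row_bounded v C" and \<phi>: "bounded_mult \<phi>"
  shows "bounded_mult (row_weight v \<phi>)"
proof -
  obtain c where [measurable]: "\<phi> \<in> borel_measurable borel" and c: "AE p in lborel. cmod (\<phi> p) \<le> c"
    using \<phi> by (auto simp: bounded_mult_def)
  have "AE p in lborel. v p = 0 \<or> cmod (\<phi> p) \<le> c" using c by eventually_elim simp
  from row_weight_bound[OF v _ this] show ?thesis
    by (intro bounded_multI[where C = "\<bar>c\<bar> * C"] measurable_row_weight row_bounded_measurable[OF v])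
      (auto elim: eventually_mono)
qed

text \<open>
  The function \<open>g\<close> is evaluated at the outer variable, so it leaves the integral and only
  a multiplication operator remains.
\<close>

lemma row_integral_mul_row_extend:
  assumes v: "row_bounded v C" and \<phi>: "bounded_mult \<phi>"
  shows "row_integral v (mul \<phi> (row_extend v g)) = mul (row_weight v \<phi>) g"
proof -
  note [measurable] = row_bounded_measurable[OF v]
  have [measurable]: "\<phi> \<in> borel_measurable borel" using \<phi> by (simp add: bounded_mult_def)
  let ?f = "mul \<phi> (row_extend v g)"
  have "AE p in lborel. v p * brep ?f p = \<phi> p * complex_of_real ((cmod (v p))\<^sup>2) * brep g (fst p)"
    using brep_mul[OF \<phi>, of "row_extend v g"] brep_row_extend[OF v, of g]
    by eventually_elim (simp only: complex_norm_square mult_ac)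
  then have "AE x in lborel. (LINT s|lborel. v (x, s) * brep ?f (x, s)) =
      (LINT s|lborel. \<phi> (x, s) * complex_of_real ((cmod (v (x, s)))\<^sup>2) * brep g x)"
    using integral_slice_cong[of "\<lambda>p. v p * brep ?f p"
        "\<lambda>p. \<phi> p * complex_of_real ((cmod (v p))\<^sup>2) * brep g (fst p)"] by simp
  then show ?thesis
    using brep_row_integral[OF v, of ?f] brep_mul[OF bounded_mult_row_weight[OF v \<phi>], of g]
    by (intro l2_eqI_brep, eventually_elim) (simp add: row_weight_def)
qed

text \<open>After the swap \<open>g\<close> is evaluated at the inner variable, which gives a genuine integral operator.\<close>

lemma brep_row_integral_mul_swp_row_extend:
  assumes v: "row_bounded v C" and \<phi>: "bounded_mult \<phi>"
  shows "AE x in lborel. brep (row_integral v (mul \<phi> (swp (row_extend v g)))) x =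
    (LINT s|lborel. v (x, s) * \<phi> (x, s) * cnj (v (s, x)) * brep g s)"
proof -
  note [measurable] = row_bounded_measurable[OF v]
  have [measurable]: "\<phi> \<in> borel_measurable borel" using \<phi> by (simp add: bounded_mult_def)
  let ?f = "mul \<phi> (swp (row_extend v g))"
  have "AE p in lborel. v p * brep ?f p = v p * \<phi> p * cnj (v (prod.swap p)) * brep g (snd p)"
    using brep_mul[OF \<phi>, of "swp (row_extend v g)"] brep_swp[of "row_extend v g"]
      AE_swap[OF brep_row_extend[OF v, of g]]
    by eventually_elim simp
  then have "AE x in lborel. (LINT s|lborel. v (x, s) * brep ?f (x, s)) =
      (LINT s|lborel. v (x, s) * \<phi> (x, s) * cnj (v (s, x)) * brep g s)"
    using integral_slice_cong[of "\<lambda>p. v p * brep ?f p"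
        "\<lambda>p. v p * \<phi> p * cnj (v (prod.swap p)) * brep g (snd p)"] by simp
  then show ?thesis
    using brep_row_integral[OF v, of ?f] by eventually_elim simp
qed

section \<open>The operator matrix with Borel coefficients\<close>

text \<open>
  The assumption \<open>hs\<close> is the square-integrability of the kernel of the exchange term in the Schur
  complement.
\<close>

locale fock_model =
  fixes S :: "'a::euclidean_space set" and v :: "'a \<times> 'a \<Rightarrow> complex" and C :: real
  assumes S: "S \<in> sets borel" and v: "row_bounded v C" and v_out: "\<And>p. p \<notin> S \<times> S \<Longrightarrow> v p = 0"
    and hs: "(\<integral>\<^sup>+p. ennreal ((cmod (v p))\<^sup>2 * (cmod (v (prod.swap p)))\<^sup>2) \<partial>lborel) < \<infinity>"
begin

text \<open>The creation operator is the adjoint of \<open>row_integral v\<close> on symmetric functions.\<close>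

abbreviation "create f \<equiv> symmetrize (row_extend v f)"

abbreviation "Hop c u \<phi>1 \<phi>2 \<equiv> block c u (mul \<phi>1) (row_integral v) (\<lambda>f. create f) (mul \<phi>2)"

abbreviation "Fock \<equiv> UNIV \<times> L2_on S \<times> L2_sym S"

text \<open>
  For \<open>\<phi>1 = w\<^sub>1 - z\<close> and \<open>\<rho> = 1 / (w\<^sub>2 - z)\<close>, the function \<open>schur_symbol \<phi>1 \<rho>\<close> is \<open>\<Delta>(\<cdot>; z)\<close>. The part of the Schur
  complement in which the two particles trade places is \<open>exchange \<rho>\<close>.
\<close>

definition schur_symbol :: "('a \<Rightarrow> complex) \<Rightarrow> ('a \<times> 'a \<Rightarrow> complex) \<Rightarrow> 'a \<Rightarrow> complex"
  where "schur_symbol \<phi>1 \<rho> x = \<phi>1 x - 1/2 * row_weight v \<rho> x"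

definition exchange :: "('a \<times> 'a \<Rightarrow> complex) \<Rightarrow> 'a l2 \<Rightarrow> 'a l2"
  where "exchange \<rho> f = (1/2) *\<^sub>C row_integral v (mul \<rho> (swp (row_extend v f)))"

lemma v_measurable [measurable]: "v \<in> borel_measurable borel"
  by (rule row_bounded_measurable[OF v])

lemma row_integral_in_L2_on: "row_integral v f \<in> L2_on S"
proof -
  have "(LINT s|lborel. v (x, s) * brep f (x, s)) = 0" if "x \<notin> S" for x
    using that v_out by simp
  then show ?thesis
    unfolding L2_on_brep using brep_row_integral[OF v, of f] by (auto elim: eventually_mono)
qed

lemma create_in_L2_sym: "create f \<in> L2_sym S"
proof (rule symmetrize_in_L2_sym[OF S])
  show "row_extend v f \<in> L2_on (S \<times> S)"
    unfolding L2_on_brep using brep_row_extend[OF v, of f]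
    by eventually_elim (use v_out in auto)
qed

lemma bounded_clinear_create: "bounded_clinear (\<lambda>f. create f)"
  by (rule bounded_clinear_compose[OF bounded_clinear_symmetrize bounded_clinear_row_extend[OF v]])

lemma cinner_row_integral_create:
  "f \<in> L2_sym S \<Longrightarrow> cinner (row_integral v f) g = cinner f (create g)"
  by (simp add: cinner_row_integral[OF v] cinner_symmetrize_right L2_sym_iff[OF S])

lemma bounded_clinear_exchange: "bounded_mult \<rho> \<Longrightarrow> bounded_clinear (exchange \<rho>)"
  unfolding exchange_def[abs_def]
  by (intro bounded_clinear_scale bounded_clinear_compose[OF bounded_clinear_row_integral[OF v]]
      bounded_clinear_compose[OF bounded_clinear_mul] bounded_clinear_compose[OF bounded_clinear_swp]
      bounded_clinear_row_extend[OF v])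

lemma exchange_in_L2_on: "exchange \<rho> f \<in> L2_on S"
  unfolding exchange_def by (intro complex_vector.subspace_scale subspace_L2_on row_integral_in_L2_on)

lemma bounded_mult_schur_symbol:
  assumes "bounded_mult \<phi>1" "bounded_mult \<rho>"
  shows "bounded_mult (schur_symbol \<phi>1 \<rho>)"
proof -
  have rw: "bounded_mult (row_weight v \<rho>)" by (rule bounded_mult_row_weight[OF v assms(2)])
  obtain c c' where "AE x in lborel. cmod (\<phi>1 x) \<le> c" "AE x in lborel. cmod (row_weight v \<rho> x) \<le> c'"
    using assms(1) rw by (auto simp: bounded_mult_def)
  then have "AE x in lborel. cmod (schur_symbol \<phi>1 \<rho> x) \<le> c + c'"
  proof eventually_elim
    case (elim x)
    have "cmod (schur_symbol \<phi>1 \<rho> x) \<le> cmod (\<phi>1 x) + 1/2 * cmod (row_weight v \<rho> x)"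
      unfolding schur_symbol_def using norm_triangle_ineq4[of "\<phi>1 x" "1/2 * row_weight v \<rho> x"]
      by (simp add: norm_divide)
    then show ?case using elim norm_ge_zero[of "row_weight v \<rho> x"] by linarith
  qed
  then show ?thesis
    using assms(1) rw
    by (intro bounded_multI) (auto simp: bounded_mult_def schur_symbol_def[abs_def])
qed

lemma schur_complement:
  assumes "bounded_mult \<phi>1" "bounded_mult \<rho>"
  shows "mul \<phi>1 f - row_integral v (mul \<rho> (create f)) = mul (schur_symbol \<phi>1 \<rho>) f - exchange \<rho> f"
proof -
  note rw = bounded_mult_row_weight[OF v assms(2)]
  note bs = bounded_mult_schur_symbol[OF assms]
  have "row_integral v (mul \<rho> (create f)) = (1/2) *\<^sub>C mul (row_weight v \<rho>) f + exchange \<rho> f"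
    unfolding symmetrize_def exchange_def
    by (simp add: bounded_clinear_scaleC[OF bounded_clinear_mul[OF assms(2)]]
        bounded_clinear_add[OF bounded_clinear_mul[OF assms(2)]]
        bounded_clinear_scaleC[OF bounded_clinear_row_integral[OF v]]
        bounded_clinear_add[OF bounded_clinear_row_integral[OF v]]
        row_integral_mul_row_extend[OF v assms(2)] scaleC_add_right)
  moreover have "mul (schur_symbol \<phi>1 \<rho>) f = mul \<phi>1 f - (1/2) *\<^sub>C mul (row_weight v \<rho>) f"
    by (rule l2_eqI_brep, use brep_mul[OF bs, of f] brep_mul[OF assms(1), of f] brep_mul[OF rw, of f]
        brep_scaleC[of "1/2" "mul (row_weight v \<rho>) f"]
        brep_diff[of "mul \<phi>1 f" "(1/2) *\<^sub>C mul (row_weight v \<rho>) f"] in eventually_elim)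
      (simp add: schur_symbol_def left_diff_distrib)
  ultimately show ?thesis by simp
qed

lemma exchange_small_complement:
  assumes \<rho>: "bounded_mult \<rho>" and \<epsilon>: "\<epsilon> > 0"
  shows "\<exists>E. orthonormal E \<and> E \<subseteq> L2_on S \<and>
    (\<forall>f\<in>L2_on S. (\<forall>e\<in>E. cinner f e = 0) \<longrightarrow> norm (exchange \<rho> f) \<le> \<epsilon> * norm f)"
proof -
  obtain c where [measurable]: "\<rho> \<in> borel_measurable borel" and c: "AE p in lborel. cmod (\<rho> p) \<le> c"
    using \<rho> by (auto simp: bounded_mult_def)
  define k where "k p = 1/2 * (v p * \<rho> p * cnj (v (prod.swap p)))" for p
  have [measurable]: "k \<in> borel_measurable borel" unfolding k_def by measurable
  have "sqn k \<le> (\<integral>\<^sup>+p. ennreal ((c / 2)\<^sup>2) * ennreal ((cmod (v p))\<^sup>2 * (cmod (v (prod.swap p)))\<^sup>2) \<partial>lborel)"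
  proof (rule nn_integral_mono_AE, use c in eventually_elim)
    case (elim p)
    have "(cmod (k p))\<^sup>2 = (cmod (\<rho> p) / 2)\<^sup>2 * ((cmod (v p))\<^sup>2 * (cmod (v (prod.swap p)))\<^sup>2)"
      by (simp add: k_def norm_mult norm_divide power_mult_distrib power_divide)
    also have "\<dots> \<le> (c / 2)\<^sup>2 * ((cmod (v p))\<^sup>2 * (cmod (v (prod.swap p)))\<^sup>2)"
      using elim by (intro mult_right_mono power_mono) auto
    finally show ?case by (simp add: ennreal_mult[symmetric] ennreal_leI)
  qed
  also have "\<dots> = ennreal ((c / 2)\<^sup>2) * (\<integral>\<^sup>+p. ennreal ((cmod (v p))\<^sup>2 * (cmod (v (prod.swap p)))\<^sup>2) \<partial>lborel)"
    by (rule nn_integral_cmult) measurable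
  also have "\<dots> < \<infinity>" using hs by (simp add: ennreal_mult_less_top)
  finally have fin: "sqn k < \<infinity>" .
  have rep: "AE x in lborel. brep (exchange \<rho> f) x = (LINT s|lborel. k (x, s) * brep f s)" for f
    using brep_row_integral_mul_swp_row_extend[OF v \<rho>, of f]
      brep_scaleC[of "1/2" "row_integral v (mul \<rho> (swp (row_extend v f)))"]
  proof eventually_elim
    case (elim x)
    have "(LINT s|lborel. k (x, s) * brep f s) =
        (LINT s|lborel. 1/2 * (v (x, s) * \<rho> (x, s) * cnj (v (s, x)) * brep f s))"
      by (simp add: k_def mult.assoc)
    then show ?case using elim by (simp only: exchange_def integral_mult_right_zero)
  qed
  show ?thesis
  proof (rule hilbert_schmidt_small_complement[OF subspace_L2_on bounded_clinear_exchange[OF \<rho>] _ \<epsilon>])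
    show "(\<Sum>e\<in>E. (norm (exchange \<rho> e))\<^sup>2) \<le> enn2real (sqn k)" if "orthonormal E" for E
      by (rule integral_operator_hilbert_schmidt[OF _ fin rep that]) measurable
  qed
qed

theorem Hop_fredholm:
  assumes u: "u \<in> L2_on S" and \<phi>1: "bounded_mult \<phi>1" and \<phi>2: "bounded_mult \<phi>2" and \<rho>: "bounded_mult \<rho>"
    and sym: "\<And>p. \<phi>2 (prod.swap p) = \<phi>2 p" "\<And>p. \<rho> (prod.swap p) = \<rho> p"
    and inv: "\<And>p. p \<in> S \<times> S \<Longrightarrow> \<phi>2 p * \<rho> p = 1"
    and low: "AE x in lborel. x \<in> S \<longrightarrow> cmod (schur_symbol \<phi>1 \<rho> x) \<ge> d" "d > 0"
  shows "fredholm_on Fock (Hop c u \<phi>1 \<phi>2)"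
proof -
  define \<Delta> where "\<Delta> = schur_symbol \<phi>1 \<rho>"
  have b\<Delta>: "bounded_mult \<Delta>" unfolding \<Delta>_def by (rule bounded_mult_schur_symbol[OF \<phi>1 \<rho>])
  have [measurable]: "\<Delta> \<in> borel_measurable borel" using b\<Delta> by (simp add: bounded_mult_def)
  (* The symbol may vanish outside S and on a null set; the value 0 there keeps the inverse bounded. *)
  define \<Delta>i where "\<Delta>i x = (if d \<le> cmod (\<Delta> x) then 1 / \<Delta> x else 0)" for x
  have b\<Delta>i: "bounded_mult \<Delta>i"
  proof (rule bounded_multI[where C = "1 / d"])
    show "\<Delta>i \<in> borel_measurable borel" unfolding \<Delta>i_def by measurable
    show "AE x in lborel. cmod (\<Delta>i x) \<le> 1 / d"
      using low(2) by (intro AE_I2) (auto simp: \<Delta>i_def norm_divide intro!: frac_le)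
  qed
  have inv\<Delta>: "AE x in lborel. brep f x = 0 \<or> \<Delta> x * \<Delta>i x = 1" if "f \<in> L2_on S" for f
    using that low(1) unfolding L2_on_brep
    by eventually_elim (use low(2) in \<open>auto simp: \<Delta>i_def \<Delta>_def\<close>)
  have inv2: "AE p in lborel. brep f p = 0 \<or> \<phi>2 p * \<rho> p = 1" if "f \<in> L2_sym S" for f
    using that unfolding L2_sym_iff[OF S] L2_on_brep
    by (auto elim!: eventually_mono simp: inv)
  show ?thesis
  proof (rule block_fredholm[where Wi = "mul \<rho>" and D = "mul \<Delta>" and Di = "mul \<Delta>i" and K = "exchange \<rho>"])
    show "mul \<phi>2 (mul \<rho> f) = f" "mul \<rho> (mul \<phi>2 f) = f" if "f \<in> L2_sym S" for f
      using inv2[OF that] by (auto intro!: mul_comp \<phi>2 \<rho> simp: mult.commute)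
    show "mul \<Delta> (mul \<Delta>i f) = f" "mul \<Delta>i (mul \<Delta> f) = f" if "f \<in> L2_on S" for f
      using inv\<Delta>[OF that] by (auto intro!: mul_comp b\<Delta> b\<Delta>i simp: mult.commute)
    show "mul \<phi>1 f - row_integral v (mul \<rho> (create f)) = mul \<Delta> f - exchange \<rho> f" for f
      unfolding \<Delta>_def by (rule schur_complement[OF \<phi>1 \<rho>])
    show "\<exists>E. orthonormal E \<and> E \<subseteq> L2_on S \<and>
        (\<forall>f\<in>L2_on S. (\<forall>e\<in>E. cinner f e = 0) \<longrightarrow> norm (exchange \<rho> f) \<le> \<epsilon> * norm f)" if "\<epsilon> > 0" for \<epsilon>
      by (rule exchange_small_complement[OF \<rho> that])
  qed (auto intro: subspace_L2_on closed_L2_on S subspace_L2_sym u bounded_clinear_mul \<phi>1 \<phi>2 \<rho> b\<Delta> b\<Delta>i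
      bounded_clinear_row_integral[OF v] bounded_clinear_create bounded_clinear_exchange mul_in_L2_on
      row_integral_in_L2_on create_in_L2_sym mul_in_L2_sym sym exchange_in_L2_on)
qed

lemma Hop_symmetric:
  assumes "c \<in> \<real>" "bounded_mult \<phi>1" "bounded_mult \<phi>2" "\<And>x. \<phi>1 x \<in> \<real>" "\<And>p. \<phi>2 p \<in> \<real>"
    and "f \<in> Fock" "g \<in> Fock"
  shows "cinner (Hop c u \<phi>1 \<phi>2 f) g = cinner f (Hop c u \<phi>1 \<phi>2 g)"
  by (rule block_symmetric[OF assms(1) _ _ _ assms(6,7)])
    (auto intro: cinner_mul_real assms cinner_row_integral_create)

theorem Hop_not_fredholm_schur:
  assumes \<phi>1: "bounded_mult \<phi>1" and \<phi>2: "bounded_mult \<phi>2" and \<rho>: "bounded_mult \<rho>"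
    and real: "c \<in> \<real>" "\<And>x. \<phi>1 x \<in> \<real>" "\<And>p. \<phi>2 p \<in> \<real>"
    and sym: "\<And>p. \<rho> (prod.swap p) = \<rho> p"
    and inv: "\<And>p. p \<in> S \<times> S \<Longrightarrow> \<phi>2 p * \<rho> p = 1"
    and sing: "\<And>\<epsilon>. \<epsilon> > 0 \<Longrightarrow> 0 < emeasure lborel {x \<in> S. cmod (schur_symbol \<phi>1 \<rho> x) < \<epsilon>}"
  shows "\<not> fredholm_on Fock (Hop c u \<phi>1 \<phi>2)"
proof -
  define \<Delta> where "\<Delta> = schur_symbol \<phi>1 \<rho>"
  have b\<Delta>: "bounded_mult \<Delta>" unfolding \<Delta>_def by (rule bounded_mult_schur_symbol[OF \<phi>1 \<rho>])
  have [measurable]: "\<Delta> \<in> borel_measurable borel" using b\<Delta> by (simp add: bounded_mult_def)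
  have inv2: "AE p in lborel. brep f p = 0 \<or> \<phi>2 p * \<rho> p = 1" if "f \<in> L2_sym S" for f
    using that unfolding L2_sym_iff[OF S] L2_on_brep
    by (auto elim!: eventually_mono simp: inv)
  show ?thesis
  proof (rule block_not_fredholm[where Wi = "mul \<rho>" and D = "mul \<Delta>" and K = "exchange \<rho>"])
    show "mul \<phi>2 (mul \<rho> f) = f" if "f \<in> L2_sym S" for f
      using inv2[OF that] by (intro mul_comp \<phi>2 \<rho>)
    show "mul \<phi>1 f - row_integral v (mul \<rho> (create f)) = mul \<Delta> f - exchange \<rho> f" for f
      unfolding \<Delta>_def by (rule schur_complement[OF \<phi>1 \<rho>])
    show "\<exists>E. orthonormal E \<and> E \<subseteq> L2_on S \<and>
        (\<forall>f\<in>L2_on S. (\<forall>e\<in>E. cinner f e = 0) \<longrightarrow> norm (exchange \<rho> f) \<le> \<epsilon> * norm f)" if "\<epsilon> > 0" for \<epsilon>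
      by (rule exchange_small_complement[OF \<rho> that])
    show "\<exists>V. complex_vector.subspace V \<and> inf_dim V \<and> V \<subseteq> L2_on S \<and>
        (\<forall>f\<in>V. norm (mul \<Delta> f) \<le> \<epsilon> * norm f)" if "\<epsilon> > 0" for \<epsilon>
    proof (intro exI[of _ "L2_on {x \<in> S. cmod (\<Delta> x) < \<epsilon>}"] conjI ballI subspace_L2_on)
      have "{x \<in> S. cmod (\<Delta> x) < \<epsilon>} = S \<inter> {x \<in> space borel. cmod (\<Delta> x) < \<epsilon>}" by auto
      also have "\<dots> \<in> sets borel" using S by measurable
      finally show "inf_dim (L2_on {x \<in> S. cmod (\<Delta> x) < \<epsilon>})"
        using sing[OF that] by (intro inf_dim_L2_on) (auto simp: \<Delta>_def)
      show "L2_on {x \<in> S. cmod (\<Delta> x) < \<epsilon>} \<subseteq> L2_on S" by (rule L2_on_mono) auto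
      fix f assume "f \<in> L2_on {x \<in> S. cmod (\<Delta> x) < \<epsilon>}"
      then have "AE x in lborel. brep f x = 0 \<or> cmod (\<Delta> x) \<le> \<epsilon>"
        unfolding L2_on_brep by eventually_elim auto
      then show "norm (mul \<Delta> f) \<le> \<epsilon> * norm f"
        using that by (intro norm_mul_le b\<Delta>) auto
    qed
    show "cinner (Hop c u \<phi>1 \<phi>2 f) g = cinner f (Hop c u \<phi>1 \<phi>2 g)" if "f \<in> Fock" "g \<in> Fock" for f g
      using that by (intro Hop_symmetric real \<phi>1 \<phi>2)
  qed (auto intro: subspace_L2_on closed_L2_on S subspace_L2_sym closed_L2_sym bounded_clinear_mul \<phi>1 \<phi>2 \<rho>
      bounded_clinear_row_integral[OF v] bounded_clinear_create
      create_in_L2_sym mul_in_L2_sym sym)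
qed

text \<open>
  The vectors are the symmetrizations of functions on \<open>G\<close>. They do not vanish because \<open>G\<close> is disjoint from
  its mirror image, and the annihilation operator is small on them because it only sees \<open>v\<close> on the thin
  slices of \<open>G\<close> and its mirror image.
\<close>

theorem Hop_not_fredholm_two_particle:
  assumes \<phi>1: "bounded_mult \<phi>1" and \<phi>2: "bounded_mult \<phi>2"
    and real: "c \<in> \<real>" "\<And>x. \<phi>1 x \<in> \<real>" "\<And>p. \<phi>2 p \<in> \<real>"
    and sing: "\<And>\<epsilon>. \<epsilon> > 0 \<Longrightarrow> \<exists>G\<in>sets borel. G \<subseteq> S \<times> S \<and> 0 < emeasure lborel G \<and>
      G \<inter> prod.swap -` G = {} \<and> (\<forall>p\<in>G \<union> prod.swap -` G. cmod (\<phi>2 p) \<le> \<epsilon>) \<and>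
      (AE x in lborel. sqn (\<lambda>s. v (x, s) * indicator (G \<union> prod.swap -` G) (x, s)) \<le> ennreal \<epsilon>)"
  shows "\<not> fredholm_on Fock (Hop c u \<phi>1 \<phi>2)"
proof (rule not_fredholm_on_singular)
  show "complex_vector.subspace Fock"
    using subspace_L2_on[of S] subspace_L2_sym[OF S]
    by (auto simp: complex_vector.subspace_def scaleC_prod_def zero_prod_def)
  show "closed Fock" by (intro closed_Times closed_L2_on closed_L2_sym S closed_UNIV)
  show "bounded_clinear (Hop c u \<phi>1 \<phi>2)"
    by (intro bounded_clinear_block bounded_clinear_mul \<phi>1 \<phi>2 bounded_clinear_row_integral[OF v]
        bounded_clinear_create)
  show "cinner (Hop c u \<phi>1 \<phi>2 f) g = cinner f (Hop c u \<phi>1 \<phi>2 g)" if "f \<in> Fock" "g \<in> Fock" for f g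
    using that by (intro Hop_symmetric real \<phi>1 \<phi>2)
  fix F :: "(complex \<times> 'a l2 \<times> ('a \<times> 'a) l2) set" and \<epsilon> :: real
  assume F: "finite F" and \<epsilon>: "\<epsilon> > 0"
  (* The square accounts for the fact that the norm of the row integral is bounded by the square root
     of the bound on the rows. *)
  define \<delta> where "\<delta> = min (\<epsilon> / 2) ((\<epsilon> / 2)\<^sup>2)"
  have \<delta>: "\<delta> > 0" "\<delta> \<le> \<epsilon> / 2" "sqrt \<delta> \<le> \<epsilon> / 2"
  proof -
    show "\<delta> > 0" "\<delta> \<le> \<epsilon> / 2" using \<epsilon> by (auto simp: \<delta>_def)
    have "sqrt \<delta> \<le> sqrt ((\<epsilon> / 2)\<^sup>2)" by (intro real_sqrt_le_mono) (simp add: \<delta>_def)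
    then show "sqrt \<delta> \<le> \<epsilon> / 2" using \<epsilon> by simp
  qed
  obtain G where G: "G \<in> sets borel" "G \<subseteq> S \<times> S" "0 < emeasure lborel G" "G \<inter> prod.swap -` G = {}"
    "\<And>p. p \<in> G \<union> prod.swap -` G \<Longrightarrow> cmod (\<phi>2 p) \<le> \<delta>"
    "AE x in lborel. sqn (\<lambda>s. v (x, s) * indicator (G \<union> prod.swap -` G) (x, s)) \<le> ennreal \<delta>"
    using sing[OF \<delta>(1)] by blast
  define N where "N = G \<union> prod.swap -` G"
  have "prod.swap -` G \<in> sets borel"
    using measurable_sets[OF borel_measurable_swap G(1)] by simp
  then have N [measurable]: "N \<in> sets borel" using G(1) by (simp add: N_def)
  define v' where "v' p = v p * indicator N p" for p
  have v': "row_bounded v' \<delta>"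
    using G(6) \<delta>(1) unfolding row_bounded_def v'_def N_def[symmetric] by auto
  define \<iota> where "\<iota> f = (0 :: complex, 0 :: 'a l2, f + swp f)" for f :: "('a \<times> 'a) l2"
  have b\<iota>: "bounded_clinear \<iota>"
    unfolding \<iota>_def by (intro bounded_clinear_intros bounded_clinear_swp)
  have "\<exists>f\<in>L2_on G. f \<noteq> 0 \<and> (\<forall>\<phi>\<in>(\<lambda>h f. cinner (\<iota> f) h) ` F. \<phi> f = 0)"
  proof (rule inf_dim_common_kernel[OF _ subspace_L2_on inf_dim_L2_on[OF G(1,3)]])
    show "finite ((\<lambda>h f. cinner (\<iota> f) h) ` F)" using F by simp
    show "bounded_clinear \<phi>" if "\<phi> \<in> (\<lambda>h f. cinner (\<iota> f) h) ` F" for \<phi>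
      using that bounded_clinear_compose[OF bounded_clinear_cinner b\<iota>] by auto
  qed
  then obtain f where f: "f \<in> L2_on G" "f \<noteq> 0" "\<And>h. h \<in> F \<Longrightarrow> cinner (\<iota> f) h = 0" by auto
  define h where "h = f + swp f"
  have brf: "AE p in lborel. p \<notin> G \<longrightarrow> brep f p = 0" using f(1) by (simp add: L2_on_brep)
  have brh: "AE p in lborel. brep h p = brep f p + brep f (prod.swap p)"
    unfolding h_def using brep_add[of f "swp f"] brep_swp[of f] by eventually_elim simp
  have hN: "AE p in lborel. p \<notin> N \<longrightarrow> brep h p = 0"
    using brh brf AE_swap[OF brf] by eventually_elim (auto simp: N_def)
  have h0: "h \<noteq> 0"
  proof
    assume "h = 0"
    then have "AE p in lborel. brep f p + brep f (prod.swap p) = 0"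
      using brh brep_zero by (auto elim: eventually_elim2)
    with brf AE_swap[OF brf] have "AE p in lborel. brep f p = brep 0 p"
      using brep_zero[where ?'a = "'a \<times> 'a"] by eventually_elim (use G(4) in auto)
    then have "f = 0" by (rule l2_eqI_brep)
    with f(2) show False ..
  qed
  have "AE p in lborel. p \<notin> S \<times> S \<longrightarrow> brep h p = 0"
    using hN by eventually_elim (use G(2) in \<open>auto simp: N_def\<close>)
  then have hS: "h \<in> L2_sym S"
    by (simp add: L2_sym_iff[OF S] L2_on_brep)
      (simp add: h_def bounded_clinear_add[OF bounded_clinear_swp] add.commute)
  have "row_integral v h = row_integral v' h"
    by (rule row_integral_cong[OF v v'], use hN in eventually_elim) (auto simp: v'_def)
  then have "norm (row_integral v h) \<le> sqrt \<delta> * norm h"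
    using norm_row_integral[OF v', of h] by simp
  also have "\<dots> \<le> \<epsilon> / 2 * norm h" using \<delta>(3) by (rule mult_right_mono) simp
  finally have 1: "norm (row_integral v h) \<le> \<epsilon> / 2 * norm h" .
  have "AE p in lborel. brep h p = 0 \<or> cmod (\<phi>2 p) \<le> \<epsilon> / 2"
    using hN by eventually_elim (use G(5) \<delta>(2) in \<open>force simp: N_def\<close>)
  then have 2: "norm (mul \<phi>2 h) \<le> \<epsilon> / 2 * norm h"
    using \<epsilon> by (intro norm_mul_le \<phi>2) auto
  have "Hop c u \<phi>1 \<phi>2 (\<iota> f) = (0, row_integral v h, mul \<phi>2 h)"
    using bounded_clinear_0[OF bounded_clinear_mul[OF \<phi>1]] bounded_clinear_0[OF bounded_clinear_create]
    by (simp add: block_def \<iota>_def h_def)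
  then have "norm (Hop c u \<phi>1 \<phi>2 (\<iota> f)) \<le> 0 + (norm (row_integral v h) + norm (mul \<phi>2 h))"
    using norm_triple_le[of "0 :: complex"] by simp
  also have "\<dots> \<le> \<epsilon> * norm h" using 1 2 by simp
  also have "norm h = norm (\<iota> f)" by (simp add: \<iota>_def h_def norm_prod_def)
  finally have "norm (Hop c u \<phi>1 \<phi>2 (\<iota> f)) \<le> \<epsilon> * norm (\<iota> f)" .
  moreover have "\<iota> f \<in> Fock"
    using hS complex_vector.subspace_0[OF subspace_L2_on] by (simp add: \<iota>_def h_def)
  moreover have "\<iota> f \<noteq> 0" using h0 by (simp add: \<iota>_def h_def zero_prod_def)
  ultimately show "\<exists>e\<in>Fock. e \<noteq> 0 \<and> (\<forall>h\<in>F. cinner e h = 0) \<and>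
      norm (Hop c u \<phi>1 \<phi>2 e) \<le> \<epsilon> * norm e"
    using f(3) by (intro bexI[of _ "\<iota> f"]) auto
qed

end

section \<open>From Lebesgue to Borel coefficients\<close>

lemma AE_lebesgue_on_iff:
  assumes "A \<in> sets borel"
  shows "(AE x in lebesgue_on A. P x) \<longleftrightarrow> (AE x in lborel. x \<in> A \<longrightarrow> P x)"
  using assms by (subst AE_restrict_space_iff) (auto simp: AE_lebesgue_iff)

lemma measurable_lebesgue_AE:
  fixes f g :: "'a::euclidean_space \<Rightarrow> 'b::euclidean_space"
  assumes "g \<in> borel_measurable borel" "AE x in lborel. f x = g x"
  shows "f \<in> borel_measurable lebesgue"
  by (rule borel_measurable_AE[of g])
    (use assms in \<open>auto simp: AE_lebesgue_iff intro: measurable_completion elim: eventually_mono\<close>)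

lemma complex_borel_version_on:
  fixes f :: "'a::euclidean_space \<Rightarrow> complex"
  assumes "f \<in> borel_measurable (lebesgue_on A)" "A \<in> sets borel"
  shows "\<exists>g\<in>borel_measurable borel. (\<forall>x. x \<notin> A \<longrightarrow> g x = 0) \<and> (AE x in lborel. x \<in> A \<longrightarrow> f x = g x)"
proof -
  have "(\<lambda>x. if x \<in> A then f x else 0) \<in> borel_measurable lebesgue"
    using assms by (intro borel_measurable_if_I) auto
  then obtain g where g: "g \<in> borel_measurable borel" "AE x in lborel. (if x \<in> A then f x else 0) = g x"
    using complex_borel_version[of "\<lambda>x. if x \<in> A then f x else 0"] by auto
  have "(\<lambda>x. indicator A x *\<^sub>R g x) \<in> borel_measurable borel"
    using g(1) assms(2) by measurable
  moreover have "AE x in lborel. x \<in> A \<longrightarrow> f x = indicator A x *\<^sub>R g x"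
    using g(2) by eventually_elim auto
  ultimately show ?thesis
    by (intro bexI[where x = "\<lambda>x. indicator A x *\<^sub>R g x"]) auto
qed

lemma nn_integral_lebesgue_on_borel:
  assumes g: "g \<in> borel_measurable borel" and A: "A \<in> sets borel"
    and eq: "AE x in lborel. x \<in> A \<longrightarrow> f x = g x"
  shows "(\<integral>\<^sup>+x. f x \<partial>lebesgue_on A) = (\<integral>\<^sup>+x. g x * indicator A x \<partial>lborel)"
proof -
  have "(\<integral>\<^sup>+x. f x \<partial>lebesgue_on A) = (\<integral>\<^sup>+x. g x \<partial>lebesgue_on A)"
    by (rule nn_integral_cong_AE) (use eq in \<open>simp add: AE_lebesgue_on_iff[OF A]\<close>)
  also have "\<dots> = (\<integral>\<^sup>+x. g x * indicator A x \<partial>lebesgue)"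
    using A by (intro nn_integral_restrict_space) auto
  also have "\<dots> = (\<integral>\<^sup>+x. g x * indicator A x \<partial>lborel)"
    by (rule nn_integral_completion)
  finally show ?thesis .
qed

lemma integral_lebesgue_on_borel:
  fixes f g :: "'a::euclidean_space \<Rightarrow> 'b::euclidean_space"
  assumes g: "g \<in> borel_measurable borel" and A: "A \<in> sets borel"
    and out: "\<And>x. x \<notin> A \<Longrightarrow> g x = 0"
    and eq: "AE x in lborel. x \<in> A \<longrightarrow> f x = g x"
  shows "(LINT x|lebesgue_on A. f x) = (LINT x|lborel. g x)"
proof -
  have AE: "AE x in lborel. indicator A x *\<^sub>R f x = g x"
    using eq by eventually_elim (auto simp: indicator_def out)
  have "(LINT x|lebesgue_on A. f x) = (LINT x|lebesgue. indicator A x *\<^sub>R f x)"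
    using A by (intro integral_restrict_space) auto
  also have "\<dots> = (LINT x|lebesgue. g x)"
    using measurable_lebesgue_AE[OF g AE] AE g
    by (intro integral_cong_AE) (auto simp: AE_lebesgue_iff intro: measurable_completion)
  also have "\<dots> = (LINT x|lborel. g x)"
    using g by (intro integral_completion) simp
  finally show ?thesis .
qed

text \<open>
  The function \<open>f\<close> only has to agree almost everywhere with a Borel function, since Lebesgue
  measure is complete.
\<close>

lemma abs_l2_cong:
  fixes f g :: "'a::euclidean_space \<Rightarrow> complex"
  assumes g: "g \<in> borel_measurable borel" "sqn g < \<infinity>" and eq: "AE x in lborel. f x = g x"
  shows "abs_l2 f = abs_l2 g"
proof -
  have g': "sq_integrable lebesgue g" by (rule sq_integrable_lebesgueI[OF g])
  have f: "f \<in> borel_measurable lebesgue" by (rule measurable_lebesgue_AE[OF g(1) eq])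
  have "integrable lebesgue (\<lambda>x. (cmod (f x))\<^sup>2)"
  proof (rule Bochner_Integration.integrable_cong_AE_imp)
    show "integrable lebesgue (\<lambda>x. (cmod (g x))\<^sup>2)" using g' by (simp add: sq_integrable_def)
    show "AE x in lebesgue. (cmod (g x))\<^sup>2 = (cmod (f x))\<^sup>2"
      unfolding AE_lebesgue_iff using eq by eventually_elim simp
  qed (use f in simp)
  with f have f': "sq_integrable lebesgue f" by (simp add: sq_integrable_def)
  show ?thesis
    using brep_abs_lebesgue[OF f'] brep_abs_lebesgue[OF g'] eq
    by (intro l2_eqI_brep, eventually_elim) simp
qed

lemma abs_l2_brep: "abs_l2 (brep f) = f"
  by (rule l2_eqI_brep) (rule brep_abs[OF measurable_brep sqn_brep_finite])

lemma l2_class_eqI: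
  assumes "AE x in lborel. x \<in> A \<longrightarrow> g x = brep h x" "h \<in> L2_on A"
  shows "l2_class A g = h"
proof -
  have "AE x in lborel. (if x \<in> A then g x else 0) = brep h x"
    using assms unfolding L2_on_brep by eventually_elim auto
  then have "abs_l2 (\<lambda>x. if x \<in> A then g x else 0) = abs_l2 (brep h)"
    by (rule abs_l2_cong[OF measurable_brep sqn_brep_finite])
  then show ?thesis by (simp add: l2_class_def abs_l2_brep)
qed

lemma adjoint_on_eqI:
  assumes U: "complex_vector.subspace U" and h: "h \<in> U"
    and adj: "\<And>f. f \<in> U \<Longrightarrow> cinner (A f) g = cinner f h"
  shows "adjoint_on U A g = h"
  unfolding adjoint_on_def
proof (rule the_equality)
  show "h \<in> U \<and> (\<forall>f\<in>U. cinner (A f) g = cinner f h)" using h adj by blast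
  fix k assume k: "k \<in> U \<and> (\<forall>f\<in>U. cinner (A f) g = cinner f k)"
  then have "k - h \<in> U" using h U by (simp add: complex_vector.subspace_diff)
  then have "cinner (k - h) k = cinner (k - h) h" using k adj by metis
  then have "cinner (k - h) (k - h) = 0"
    using cinner_add_right[of "k - h" "k - h" h] by simp
  then show "k = h" by (simp add: cinner_self_eq_0_iff)
qed

section \<open>Integrability of the kernel\<close>

text \<open>
  Up to a constant this is Young's inequality for the conjugate exponents \<open>(2 + \<epsilon>) / 2\<close> and \<open>(2 + \<epsilon>) / \<epsilon>\<close>.
  The two cases compare \<open>b\<close> with \<open>a powr (\<epsilon> / 2)\<close>, where both terms on the right balance.
\<close>

lemma power2_mult_le_powr:
  fixes a b \<epsilon> :: real
  assumes "a \<ge> 0" "b \<ge> 0" "\<epsilon> > 0"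
  shows "a\<^sup>2 * b\<^sup>2 \<le> a powr (2 + \<epsilon>) + b powr (2 + 4 / \<epsilon>)"
proof (cases "a = 0 \<or> b = 0")
  case True
  then show ?thesis by auto
next
  case False
  with assms have ab: "a > 0" "b > 0" by auto
  show ?thesis
  proof (cases "b \<le> a powr (\<epsilon> / 2)")
    case True
    then have "b\<^sup>2 \<le> (a powr (\<epsilon> / 2))\<^sup>2" using ab by (intro power_mono) auto
    also have "\<dots> = a powr \<epsilon>" by (simp add: power2_eq_square powr_add[symmetric])
    finally have "a\<^sup>2 * b\<^sup>2 \<le> a powr 2 * a powr \<epsilon>" using ab by (simp add: powr_numeral)
    also have "\<dots> = a powr (2 + \<epsilon>)" by (simp add: powr_add)
    finally show ?thesis using ab by (simp add: add_increasing2)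
  next
    case False
    then have "(a powr (\<epsilon> / 2)) powr (2 / \<epsilon>) \<le> b powr (2 / \<epsilon>)"
      using assms(3) by (intro powr_mono2) auto
    then have "a \<le> b powr (2 / \<epsilon>)" using assms(3) ab by (simp add: powr_powr)
    then have "a\<^sup>2 \<le> (b powr (2 / \<epsilon>))\<^sup>2" using ab by (intro power_mono) auto
    also have "\<dots> = b powr (4 / \<epsilon>)" by (simp add: power2_eq_square powr_add[symmetric])
    finally have "a\<^sup>2 * b\<^sup>2 \<le> b powr (4 / \<epsilon>) * b powr 2" using ab by (simp add: powr_numeral)
    also have "\<dots> = b powr (2 + 4 / \<epsilon>)" by (simp add: powr_add[symmetric] add.commute)
    finally show ?thesis using ab by (simp add: add_increasing)
  qed
qed

lemma power2_le_powr_truncated: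
  fixes a T \<epsilon> :: real
  assumes "a \<ge> 0" "T > 0" "\<epsilon> > 0"
  shows "a\<^sup>2 \<le> T\<^sup>2 + a powr (2 + \<epsilon>) / T powr \<epsilon>"
proof (cases "a \<le> T")
  case True
  then have "a\<^sup>2 \<le> T\<^sup>2" using assms by (intro power_mono) auto
  then show ?thesis by (simp add: add_increasing2)
next
  case False
  then have a: "a > T" "a > 0" using assms by auto
  have "T powr \<epsilon> \<le> a powr \<epsilon>" using a assms by (intro powr_mono2) auto
  then have "a\<^sup>2 * T powr \<epsilon> \<le> a\<^sup>2 * a powr \<epsilon>" by (intro mult_left_mono) auto
  also have "\<dots> = a powr (2 + \<epsilon>)" using a by (simp add: powr_add powr_numeral)
  finally have "a\<^sup>2 \<le> a powr (2 + \<epsilon>) / T powr \<epsilon>" using assms by (simp add: field_simps)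
  then show ?thesis by (simp add: add_increasing)
qed

text \<open>Cutting \<open>g\<close> off at the height \<open>T\<close> leaves a tail that the bound on the higher moment controls.\<close>

lemma row_square_integral_le:
  fixes g :: "'a::euclidean_space \<Rightarrow> complex"
  assumes [measurable]: "g \<in> borel_measurable borel" "B \<in> sets borel"
    and C: "(\<integral>\<^sup>+s. ennreal (cmod (g s) powr (2 + \<epsilon>)) \<partial>lborel) \<le> ennreal C" "C \<ge> 0"
    and T: "T > 0" and \<epsilon>: "\<epsilon> > 0"
  shows "(\<integral>\<^sup>+s. ennreal ((cmod (g s))\<^sup>2) * indicator B s \<partial>lborel) \<le>
    ennreal (T\<^sup>2) * emeasure lborel B + ennreal (C / T powr \<epsilon>)"
proof -
  have "(\<integral>\<^sup>+s. ennreal ((cmod (g s))\<^sup>2) * indicator B s \<partial>lborel) \<le>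
      (\<integral>\<^sup>+s. ennreal (T\<^sup>2) * indicator B s + ennreal (1 / T powr \<epsilon>) * ennreal (cmod (g s) powr (2 + \<epsilon>)) \<partial>lborel)"
  proof (rule nn_integral_mono)
    fix s
    have "ennreal ((cmod (g s))\<^sup>2) \<le> ennreal (T\<^sup>2 + cmod (g s) powr (2 + \<epsilon>) / T powr \<epsilon>)"
      by (intro ennreal_leI power2_le_powr_truncated T \<epsilon>) simp
    also have "\<dots> = ennreal (T\<^sup>2) + ennreal (1 / T powr \<epsilon>) * ennreal (cmod (g s) powr (2 + \<epsilon>))"
      by (simp add: ennreal_mult[symmetric] ennreal_plus[symmetric] del: ennreal_plus)
    finally show "ennreal ((cmod (g s))\<^sup>2) * indicator B s \<le>
        ennreal (T\<^sup>2) * indicator B s + ennreal (1 / T powr \<epsilon>) * ennreal (cmod (g s) powr (2 + \<epsilon>))"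
      by (auto simp: indicator_def)
  qed
  also have "\<dots> = ennreal (T\<^sup>2) * emeasure lborel B +
      ennreal (1 / T powr \<epsilon>) * (\<integral>\<^sup>+s. ennreal (cmod (g s) powr (2 + \<epsilon>)) \<partial>lborel)"
    by (simp add: nn_integral_add nn_integral_cmult)
  also have "\<dots> \<le> ennreal (T\<^sup>2) * emeasure lborel B + ennreal (1 / T powr \<epsilon>) * ennreal C"
    by (intro add_left_mono mult_left_mono C) simp
  also have "ennreal (1 / T powr \<epsilon>) * ennreal C = ennreal (C / T powr \<epsilon>)"
    using C(2) by (simp add: ennreal_mult[symmetric])
  finally show ?thesis .
qed

text \<open>The constants \<open>C1\<close> and \<open>C2\<close> bound the moments of the rows and columns, not their norms.\<close>

locale kernel =
  fixes S :: "'a::euclidean_space set" and v :: "'a \<times> 'a \<Rightarrow> complex" and \<epsilon> C1 C2 :: real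
  assumes S: "S \<in> sets borel" "emeasure lborel S < \<infinity>"
    and v_meas [measurable]: "v \<in> borel_measurable borel"
    and v_out: "\<And>p. p \<notin> S \<times> S \<Longrightarrow> v p = 0"
    and \<epsilon>: "\<epsilon> > 0" and C1: "C1 \<ge> 0" and C2: "C2 \<ge> 0"
    and row: "AE x in lborel. (\<integral>\<^sup>+s. ennreal (cmod (v (x, s)) powr (2 + \<epsilon>)) \<partial>lborel) \<le> ennreal C1"
    and col: "AE x in lborel. (\<integral>\<^sup>+s. ennreal (cmod (v (s, x)) powr (2 + 4 / \<epsilon>)) \<partial>lborel) \<le> ennreal C2"
begin

lemma row_bounded_v: "\<exists>C. row_bounded v C"
proof -
  obtain m where m: "emeasure lborel S = ennreal m" "m \<ge> 0"
    using S(2) by (cases "emeasure lborel S") auto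
  have "AE x in lborel. sqn (\<lambda>s. v (x, s)) \<le> ennreal (m + C1)"
    using row
  proof eventually_elim
    case (elim x)
    have "sqn (\<lambda>s. v (x, s)) = (\<integral>\<^sup>+s. ennreal ((cmod (v (x, s)))\<^sup>2) * indicator S s \<partial>lborel)"
      by (intro nn_integral_cong) (auto simp: indicator_def v_out)
    also have "\<dots> \<le> ennreal (1\<^sup>2) * emeasure lborel S + ennreal (C1 / 1 powr \<epsilon>)"
      by (rule row_square_integral_le[OF _ S(1) elim C1 _ \<epsilon>]) auto
    also have "\<dots> = ennreal (m + C1)" using m C1 by simp
    finally show ?case .
  qed
  then show ?thesis using m C1 v_meas by (auto simp: row_bounded_def intro!: exI[of _ "m + C1"])
qed

lemma swapped_product_integrable:
  "(\<integral>\<^sup>+p. ennreal ((cmod (v p))\<^sup>2 * (cmod (v (prod.swap p)))\<^sup>2) \<partial>lborel) < \<infinity>"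
proof -
  define I where "I f = (\<integral>\<^sup>+x. \<integral>\<^sup>+s. ennreal (f (x, s)) \<partial>lborel \<partial>lborel)" for f :: "'a \<times> 'a \<Rightarrow> real"
  have bound: "I f < \<infinity>" if f: "\<And>x s. x \<notin> S \<Longrightarrow> f (x, s) = 0"
    "AE x in lborel. (\<integral>\<^sup>+s. ennreal (f (x, s)) \<partial>lborel) \<le> ennreal K" for f K
  proof -
    have "I f \<le> (\<integral>\<^sup>+x. ennreal K * indicator S x \<partial>lborel)"
      unfolding I_def using f(2)
      by (intro nn_integral_mono_AE) (auto elim!: eventually_mono simp: indicator_def f(1))
    also have "\<dots> = ennreal K * emeasure lborel S"
      using S(1) by (simp add: nn_integral_cmult)
    also have "\<dots> < \<infinity>" using S(2) by (simp add: ennreal_mult_less_top)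
    finally show ?thesis .
  qed
  have "(\<integral>\<^sup>+p. ennreal ((cmod (v p))\<^sup>2 * (cmod (v (prod.swap p)))\<^sup>2) \<partial>lborel) \<le>
      (\<integral>\<^sup>+p. ennreal (cmod (v p) powr (2 + \<epsilon>)) + ennreal (cmod (v (prod.swap p)) powr (2 + 4 / \<epsilon>)) \<partial>lborel)"
    by (intro nn_integral_mono)
      (simp add: ennreal_plus[symmetric] power2_mult_le_powr \<epsilon> ennreal_leI del: ennreal_plus)
  also have "\<dots> = (\<integral>\<^sup>+p. ennreal (cmod (v p) powr (2 + \<epsilon>)) \<partial>lborel) +
      (\<integral>\<^sup>+p. ennreal (cmod (v (prod.swap p)) powr (2 + 4 / \<epsilon>)) \<partial>lborel)"
    by (rule nn_integral_add) measurable
  also have "(\<integral>\<^sup>+p. ennreal (cmod (v p) powr (2 + \<epsilon>)) \<partial>lborel) = I (\<lambda>p. cmod (v p) powr (2 + \<epsilon>))"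
    unfolding I_def by (rule tonelli_borel) measurable
  also have "(\<integral>\<^sup>+p. ennreal (cmod (v (prod.swap p)) powr (2 + 4 / \<epsilon>)) \<partial>lborel) =
      I (\<lambda>p. cmod (v (prod.swap p)) powr (2 + 4 / \<epsilon>))"
    unfolding I_def by (rule tonelli_borel) measurable
  also have "I (\<lambda>p. cmod (v p) powr (2 + \<epsilon>)) + I (\<lambda>p. cmod (v (prod.swap p)) powr (2 + 4 / \<epsilon>)) < \<infinity>"
    using bound[of "\<lambda>p. cmod (v p) powr (2 + \<epsilon>)" C1] row
      bound[of "\<lambda>p. cmod (v (prod.swap p)) powr (2 + 4 / \<epsilon>)" C2] col
    by (simp add: v_out)
  finally show ?thesis .
qed

lemma row_uniformly_integrable:
  assumes "\<eta> > 0"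
  shows "\<exists>\<delta>>0. \<forall>B\<in>sets borel. emeasure lborel B \<le> ennreal \<delta> \<longrightarrow>
    (AE x in lborel. (\<integral>\<^sup>+s. ennreal ((cmod (v (x, s)))\<^sup>2) * indicator B s \<partial>lborel) \<le> ennreal \<eta>)"
proof -
  (* With this height the tail contributes at most half of \<open>\<eta>\<close>, and \<open>\<delta>\<close> leaves the other half to the
     truncated part. *)
  define T where "T = (2 * (C1 + 1) / \<eta>) powr (1 / \<epsilon>)"
  have T: "T > 0" "C1 / T powr \<epsilon> \<le> \<eta> / 2"
    using assms C1 \<epsilon> by (auto simp: T_def powr_powr field_simps)
  define \<delta> where "\<delta> = \<eta> / (2 * T\<^sup>2)"
  have \<delta>: "\<delta> > 0" "T\<^sup>2 * \<delta> = \<eta> / 2" using T assms by (auto simp: \<delta>_def field_simps)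
  show ?thesis
  proof (intro exI[of _ \<delta>] conjI ballI impI)
    fix B :: "'a set" assume B: "B \<in> sets borel" "emeasure lborel B \<le> ennreal \<delta>"
    show "AE x in lborel. (\<integral>\<^sup>+s. ennreal ((cmod (v (x, s)))\<^sup>2) * indicator B s \<partial>lborel) \<le> ennreal \<eta>"
      using row
    proof eventually_elim
      case (elim x)
      have "(\<integral>\<^sup>+s. ennreal ((cmod (v (x, s)))\<^sup>2) * indicator B s \<partial>lborel) \<le>
          ennreal (T\<^sup>2) * emeasure lborel B + ennreal (C1 / T powr \<epsilon>)"
        by (rule row_square_integral_le[OF _ B(1) elim C1 T(1) \<epsilon>]) measurable
      also have "\<dots> \<le> ennreal (T\<^sup>2) * ennreal \<delta> + ennreal (\<eta> / 2)"
        by (intro add_mono mult_left_mono B ennreal_leI T) simp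
      also have "\<dots> = ennreal \<eta>"
        using \<delta> assms by (simp add: ennreal_mult[symmetric] ennreal_plus[symmetric] del: ennreal_plus)
      finally show ?case .
    qed
  qed (rule \<delta>)
qed

text \<open>
  Near an off-diagonal point of an open set there is a product of two small disjoint balls; its
  symmetrization has thin slices.
\<close>

lemma thin_set_in_open:
  assumes W: "open W" "W \<noteq> {}" "W \<subseteq> S \<times> S" and \<eta>: "\<eta> > 0"
  shows "\<exists>G\<in>sets borel. G \<subseteq> W \<and> 0 < emeasure lborel G \<and> G \<inter> prod.swap -` G = {} \<and>
    (AE x in lborel. sqn (\<lambda>s. v (x, s) * indicator (G \<union> prod.swap -` G) (x, s)) \<le> ennreal \<eta>)"
proof -
  obtain x0 y0 where "(x0, y0) \<in> W" using W(2) by auto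
  then obtain A B where AB: "open A" "open B" "x0 \<in> A" "y0 \<in> B" "A \<times> B \<subseteq> W"
    using open_prod_elim[OF W(1)] by (metis mem_Sigma_iff)
  obtain x1 where x1: "x1 \<in> A" "x1 \<noteq> y0"
  proof -
    have "\<not> A \<subseteq> {y0}"
      using AB(1,3) not_open_singleton by (metis empty_iff subset_singletonD)
    then show ?thesis using that by blast
  qed
  obtain \<delta> where \<delta>: "\<delta> > 0" "\<And>B. B \<in> sets borel \<Longrightarrow> emeasure lborel B \<le> ennreal \<delta> \<Longrightarrow>
      AE x in lborel. (\<integral>\<^sup>+s. ennreal ((cmod (v (x, s)))\<^sup>2) * indicator B s \<partial>lborel) \<le> ennreal \<eta>"
    using row_uniformly_integrable[OF \<eta>] by auto
  from small_ball[of "\<delta> / 2", where ?'a = 'a] \<delta>(1) obtain r0 where r0: "r0 > 0"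
    "\<And>c :: 'a. \<And>s. 0 < s \<Longrightarrow> s \<le> r0 \<Longrightarrow> emeasure lborel (ball c s) \<le> ennreal (\<delta> / 2)" by auto
  obtain r1 where r1: "r1 > 0" "ball x1 r1 \<subseteq> A" using AB(1) x1(1) open_contains_ball by blast
  obtain r2 where r2: "r2 > 0" "ball y0 r2 \<subseteq> B" using AB(2,4) open_contains_ball by blast
  define r where "r = min (min r0 (dist x1 y0 / 2)) (min r1 r2)"
  have r: "r > 0" "r \<le> r0" "r \<le> r1" "r \<le> r2" "2 * r \<le> dist x1 y0"
    using r0 r1 r2 x1(2) by (auto simp: r_def)
  define B1 where "B1 = ball x1 r"
  define B2 where "B2 = ball y0 r"
  have disj: "B1 \<inter> B2 = {}"
    unfolding B1_def B2_def using r(5) by (intro disjoint_ballI) simp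
  define G where "G = B1 \<times> B2"
  have "B1 \<subseteq> A" "B2 \<subseteq> B"
    using r1(2) r2(2) r(3,4) subset_ball[of r r1 x1] subset_ball[of r r2 y0] by (auto simp: B1_def B2_def)
  then have G: "G \<in> sets borel" "G \<subseteq> W"
    using AB(5) by (auto simp: G_def B1_def B2_def intro!: borel_open open_Times)
  have "emeasure lborel G = emeasure lborel B1 * emeasure lborel B2"
    unfolding G_def by (subst lborel_prod[symmetric])
      (rule lborel.emeasure_pair_measure_Times, auto simp: B1_def B2_def)
  also have "\<dots> > 0"
    using r(1) by (simp add: B1_def B2_def emeasure_ball ennreal_mult[symmetric])
  finally have pos: "0 < emeasure lborel G" .
  have B: "B1 \<union> B2 \<in> sets borel" by (auto simp: B1_def B2_def)
  have "emeasure lborel (B1 \<union> B2) \<le> emeasure lborel B1 + emeasure lborel B2"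
    by (rule emeasure_subadditive) (auto simp: B1_def B2_def)
  also have "\<dots> \<le> ennreal (\<delta> / 2) + ennreal (\<delta> / 2)"
    unfolding B1_def B2_def using r by (intro add_mono r0) auto
  also have "\<dots> = ennreal \<delta>" using \<delta>(1) by (simp add: ennreal_plus[symmetric] del: ennreal_plus)
  finally have "AE x in lborel. (\<integral>\<^sup>+s. ennreal ((cmod (v (x, s)))\<^sup>2) * indicator (B1 \<union> B2) s \<partial>lborel) \<le> ennreal \<eta>"
    by (rule \<delta>(2)[OF B])
  then have thin: "AE x in lborel. sqn (\<lambda>s. v (x, s) * indicator (G \<union> prod.swap -` G) (x, s)) \<le> ennreal \<eta>"
  proof eventually_elim
    case (elim x)
    have "sqn (\<lambda>s. v (x, s) * indicator (G \<union> prod.swap -` G) (x, s)) \<le>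
        (\<integral>\<^sup>+s. ennreal ((cmod (v (x, s)))\<^sup>2) * indicator (B1 \<union> B2) s \<partial>lborel)"
      by (rule nn_integral_mono) (auto simp: indicator_def G_def)
    then show ?case using elim by (rule order_trans)
  qed
  have "G \<inter> prod.swap -` G = {}" using disj by (auto simp: G_def)
  with G pos thin show ?thesis by blast
qed

end

section \<open>The operator matrix on the cube\<close>

lemma cube_eq_box: "cube a = box (\<chi> i. - a) (\<chi> i. a)"
  by (auto simp: cube_def mem_box_cart)

lemma open_cube: "open (cube a)"
  by (simp add: cube_eq_box open_box)

lemma borel_cube [measurable]: "cube a \<in> sets borel"
  by (simp add: open_cube)

lemma borel_cube_times [measurable]: "cube a \<times> cube a \<in> sets borel"
  by (simp add: open_cube open_Times)

lemma emeasure_cube_finite: "emeasure lborel (cube a) < \<infinity>"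
  unfolding cube_eq_box by (rule emeasure_bounded_finite) (rule bounded_box)

lemma cube_nonempty: "a > 0 \<Longrightarrow> 0 \<in> cube a"
  by (simp add: cube_def)

lemma connected_cube: "connected (cube a)"
  unfolding cube_eq_box by (intro convex_connected convex_box)

context kernel
begin

definition row_const :: real
  where "row_const = (SOME C. row_bounded v C)"

lemma row_bounded_row_const: "row_bounded v row_const"
  unfolding row_const_def using row_bounded_v by (rule someI_ex)

sublocale fock_model S v row_const
  by unfold_locales (use S row_bounded_row_const v_out swapped_product_integrable in auto)

end

text \<open>
  The functions \<open>v\<close>, \<open>b\<close> and \<open>u1\<close> are Borel versions of the coefficients \<open>v1\<close>, \<open>v0\<close> and \<open>w1\<close> on the cube. The
  entries of the operator matrix are classes of functions, and they depend only on these versions.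
\<close>

locale hamiltonian = kernel "cube a" v \<epsilon> C1 C2
  for a :: real and v :: "(real ^ 'n) \<times> (real ^ 'n) \<Rightarrow> complex" and \<epsilon> C1 C2 :: real +
  fixes w0 :: real and v0 b :: "real ^ 'n \<Rightarrow> complex" and w1 u1 :: "real ^ 'n \<Rightarrow> real"
    and v1 :: "(real ^ 'n) \<times> (real ^ 'n) \<Rightarrow> complex" and w2 :: "(real ^ 'n) \<times> (real ^ 'n) \<Rightarrow> real"
    and K1 K2 :: real
  assumes a_pos: "a > 0"
    and v1_eq: "AE p in lborel. p \<in> cube a \<times> cube a \<longrightarrow> v1 p = v p"
    and b: "b \<in> borel_measurable borel" "\<And>x. x \<notin> cube a \<Longrightarrow> b x = 0" "sqn b < \<infinity>"
    and v0_eq: "AE x in lborel. x \<in> cube a \<longrightarrow> v0 x = b x"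
    and u1 [measurable]: "u1 \<in> borel_measurable borel" and u1_bound: "AE x in lborel. \<bar>u1 x\<bar> \<le> K1"
    and w1_eq: "AE x in lborel. x \<in> cube a \<longrightarrow> w1 x = u1 x"
    and w2_cont: "continuous_on (cube a \<times> cube a) w2"
    and w2_sym: "\<And>x y. x \<in> cube a \<Longrightarrow> y \<in> cube a \<Longrightarrow> w2 (x, y) = w2 (y, x)"
    and w2_bound: "\<And>p. p \<in> cube a \<times> cube a \<Longrightarrow> \<bar>w2 p\<bar> \<le> K2"
begin

definition u2 :: "(real ^ 'n) \<times> (real ^ 'n) \<Rightarrow> real"
  where "u2 p = (if p \<in> cube a \<times> cube a then w2 p else 0)"

definition \<phi>1 :: "complex \<Rightarrow> real ^ 'n \<Rightarrow> complex"
  where "\<phi>1 z x = complex_of_real (u1 x) - z"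

definition \<phi>2 :: "complex \<Rightarrow> (real ^ 'n) \<times> (real ^ 'n) \<Rightarrow> complex"
  where "\<phi>2 z p = complex_of_real (u2 p) - z"

text \<open>
  Extended by zero, the inverse of \<open>\<phi>2 z\<close> stays bounded; on functions supported in the square of the cube it
  is still the inverse.
\<close>

definition resolvent :: "complex \<Rightarrow> (real ^ 'n) \<times> (real ^ 'n) \<Rightarrow> complex"
  where "resolvent z p = (if p \<in> cube a \<times> cube a then 1 / (complex_of_real (w2 p) - z) else 0)"

definition coupling :: "(real ^ 'n) l2"
  where "coupling = abs_l2 (\<lambda>x. cnj (b x))"

text \<open>For real \<open>z\<close> this is \<open>Delta a w1 v1 w2 x z\<close> for almost all \<open>x\<close> in the cube.\<close>

definition symbol :: "complex \<Rightarrow> real ^ 'n \<Rightarrow> complex"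
  where "symbol z = schur_symbol (\<phi>1 z) (resolvent z)"

definition gap :: "complex \<Rightarrow> real \<Rightarrow> bool"
  where "gap z d \<longleftrightarrow> d > 0 \<and> (\<forall>p\<in>cube a \<times> cube a. d \<le> cmod (complex_of_real (w2 p) - z))"

lemma u2_measurable [measurable]: "u2 \<in> borel_measurable borel"
proof -
  have "u2 = (\<lambda>p. indicator (cube a \<times> cube a) p *\<^sub>R w2 p)"
    by (auto simp: u2_def indicator_def)
  also have "\<dots> \<in> borel_measurable borel"
    by (rule borel_measurable_continuous_on_indicator[OF borel_cube_times w2_cont])
  finally show ?thesis .
qed

lemma u2_bound: "\<bar>u2 p\<bar> \<le> \<bar>K2\<bar>"
  using w2_bound[of p] by (auto simp: u2_def)

lemma u2_swap: "u2 (prod.swap p) = u2 p"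
  using w2_sym[of "fst p" "snd p"] by (cases p) (auto simp: u2_def)

lemma bounded_mult_\<phi>1: "bounded_mult (\<phi>1 z)"
proof (rule bounded_multI[where C = "K1 + cmod z"])
  show "\<phi>1 z \<in> borel_measurable borel" unfolding \<phi>1_def[abs_def] by measurable
  show "AE x in lborel. cmod (\<phi>1 z x) \<le> K1 + cmod z"
    using u1_bound
  proof eventually_elim
    case (elim x)
    then show ?case
      using norm_triangle_ineq4[of "complex_of_real (u1 x)" z] by (simp add: \<phi>1_def)
  qed
qed

lemma bounded_mult_\<phi>2: "bounded_mult (\<phi>2 z)"
proof (rule bounded_multI[where C = "\<bar>K2\<bar> + cmod z"])
  show "\<phi>2 z \<in> borel_measurable borel" unfolding \<phi>2_def[abs_def] by measurable
  show "AE p in lborel. cmod (\<phi>2 z p) \<le> \<bar>K2\<bar> + cmod z"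
  proof (rule AE_I2)
    fix p
    show "cmod (\<phi>2 z p) \<le> \<bar>K2\<bar> + cmod z"
      using norm_triangle_ineq4[of "complex_of_real (u2 p)" z] u2_bound[of p] by (simp add: \<phi>2_def)
  qed
qed

lemma resolvent_eq: "resolvent z p = (if p \<in> cube a \<times> cube a then 1 / \<phi>2 z p else 0)"
  by (simp add: resolvent_def \<phi>2_def u2_def)

lemma resolvent_measurable [measurable]: "resolvent z \<in> borel_measurable borel"
  unfolding resolvent_eq[abs_def] \<phi>2_def by measurable

lemma cmod_resolvent_le: "gap z d \<Longrightarrow> cmod (resolvent z p) \<le> 1 / d"
  by (auto simp: resolvent_def gap_def norm_divide intro!: frac_le)

lemma bounded_mult_resolvent: "gap z d \<Longrightarrow> bounded_mult (resolvent z)"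
  by (rule bounded_multI[where C = "1 / d"]) (auto simp: cmod_resolvent_le)

lemma resolvent_swap: "resolvent z (prod.swap p) = resolvent z p"
  using u2_swap[of p] by (cases p) (auto simp: resolvent_eq \<phi>2_def)

lemma \<phi>2_resolvent: "gap z d \<Longrightarrow> p \<in> cube a \<times> cube a \<Longrightarrow> \<phi>2 z p * resolvent z p = 1"
  by (auto simp: resolvent_def \<phi>2_def u2_def gap_def) force

lemma brep_coupling: "AE x in lborel. brep coupling x = cnj (b x)"
  unfolding coupling_def using b by (intro brep_abs) auto

lemma coupling_in_L2_on: "coupling \<in> L2_on (cube a)"
  unfolding L2_on_brep using brep_coupling by eventually_elim (use b(2) in auto)

lemma H01_eq: "H01 a v0 f = cinner f coupling"
proof -
  note [measurable] = b(1)
  have "AE x in lborel. x \<in> cube a \<longrightarrow> v0 x * rep_l2 f x = b x * brep f x"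
    using v0_eq AE_rep_eq_brep[of f] by eventually_elim simp
  then have "H01 a v0 f = (LINT x|lborel. b x * brep f x)"
    unfolding H01_def by (intro integral_lebesgue_on_borel borel_cube) (auto simp: b(2))
  also have "\<dots> = cinner f coupling"
    unfolding cinner_brep
    by (rule integral_cong_AE) (use brep_coupling in \<open>auto elim!: eventually_mono\<close>)
  finally show ?thesis .
qed

lemma adjoint_H01_eq: "adjoint_on (L2_on (cube a)) (H01 a v0) c = c *\<^sub>C coupling"
proof (rule adjoint_on_eqI[OF subspace_L2_on])
  show "c *\<^sub>C coupling \<in> L2_on (cube a)"
    by (intro complex_vector.subspace_scale[OF subspace_L2_on] coupling_in_L2_on)
  show "cinner (H01 a v0 f) c = cinner f (c *\<^sub>C coupling)" for f
    by (simp add: H01_eq cinner_scaleC_right cinner_complex_def mult.commute)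
qed

lemma H11_eq:
  assumes "f \<in> L2_on (cube a)"
  shows "H11 a w1 f = mul (\<phi>1 0) f"
  unfolding H11_def
proof (rule l2_class_eqI)
  show "AE x in lborel. x \<in> cube a \<longrightarrow> complex_of_real (w1 x) * rep_l2 f x = brep (mul (\<phi>1 0) f) x"
    using w1_eq AE_rep_eq_brep[of f] brep_mul[OF bounded_mult_\<phi>1[of 0], of f]
    by eventually_elim (simp add: \<phi>1_def)
qed (intro mul_in_L2_on bounded_mult_\<phi>1 assms)

lemma H22_eq:
  assumes "f \<in> L2_on (cube a \<times> cube a)"
  shows "H22 a w2 f = mul (\<phi>2 0) f"
  unfolding H22_def
proof (rule l2_class_eqI)
  show "AE p in lborel. p \<in> cube a \<times> cube a \<longrightarrow> complex_of_real (w2 p) * rep_l2 f p = brep (mul (\<phi>2 0) f) p"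
    using AE_rep_eq_brep[of f] brep_mul[OF bounded_mult_\<phi>2[of 0], of f]
    by eventually_elim (simp add: \<phi>2_def u2_def)
qed (intro mul_in_L2_on bounded_mult_\<phi>2 assms)

lemma H12_eq: "H12 a v1 f = row_integral v f"
  unfolding H12_def
proof (rule l2_class_eqI)
  have "AE p in lborel. p \<in> cube a \<times> cube a \<longrightarrow> v1 p * rep_l2 f p = v p * brep f p"
    using v1_eq AE_rep_eq_brep[of f] by eventually_elim simp
  from AE_slices[OF this] brep_row_integral[OF row_bounded_row_const, of f]
  show "AE x in lborel. x \<in> cube a \<longrightarrow>
      (LINT s|lebesgue_on (cube a). v1 (x, s) * rep_l2 f (x, s)) = brep (row_integral v f) x"
  proof eventually_elim
    case (elim x)
    show ?case
    proof
      assume "x \<in> cube a"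
      then have "AE s in lborel. s \<in> cube a \<longrightarrow> v1 (x, s) * rep_l2 f (x, s) = v (x, s) * brep f (x, s)"
        using elim(1) by eventually_elim (use \<open>x \<in> cube a\<close> in auto)
      then have "(LINT s|lebesgue_on (cube a). v1 (x, s) * rep_l2 f (x, s)) =
          (LINT s|lborel. v (x, s) * brep f (x, s))"
        by (intro integral_lebesgue_on_borel borel_cube) (auto simp: v_out)
      then show "(LINT s|lebesgue_on (cube a). v1 (x, s) * rep_l2 f (x, s)) = brep (row_integral v f) x"
        using elim(2) by simp
    qed
  qed
qed (rule row_integral_in_L2_on)

lemma adjoint_H12_eq: "adjoint_on (L2_sym (cube a)) (H12 a v1) g = create g"
  by (rule adjoint_on_eqI[OF subspace_L2_sym[OF borel_cube] create_in_L2_sym])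
    (simp add: H12_eq cinner_row_integral_create)

lemma Hmat_eq:
  assumes "f \<in> fock_space a"
  shows "Hmat a w0 v0 w1 v1 w2 f - z *\<^sub>C f = Hop (complex_of_real w0 - z) coupling (\<phi>1 z) (\<phi>2 z) f"
proof -
  obtain f0 f1 f2 where f: "f = (f0, f1, f2)" "f1 \<in> L2_on (cube a)" "f2 \<in> L2_sym (cube a)"
    using assms by (auto simp: fock_space_def)
  have f2: "f2 \<in> L2_on (cube a \<times> cube a)" using f(3) by (simp add: L2_sym_iff)
  have 1: "mul (\<phi>1 z) f1 = mul (\<phi>1 0) f1 - z *\<^sub>C f1"
    using mul_diff_const[of "\<phi>1 0" z f1] bounded_mult_\<phi>1[of 0] bounded_mult_\<phi>1[of z]
    by (simp add: \<phi>1_def[abs_def])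
  have 2: "mul (\<phi>2 z) f2 = mul (\<phi>2 0) f2 - z *\<^sub>C f2"
    using mul_diff_const[of "\<phi>2 0" z f2] bounded_mult_\<phi>2[of 0] bounded_mult_\<phi>2[of z]
    by (simp add: \<phi>2_def[abs_def])
  show ?thesis
    unfolding f(1) Hmat_def block_def
    by (simp add: H00_def H01_eq adjoint_H01_eq H11_eq[OF f(2)] H12_eq adjoint_H12_eq H22_eq[OF f2] 1 2
        scaleC_prod_def scaleC_complex_def left_diff_distrib)
qed

lemma fredholm_Hmat_iff:
  "fredholm_on (fock_space a) (\<lambda>f. Hmat a w0 v0 w1 v1 w2 f - z *\<^sub>C f) \<longleftrightarrow>
    fredholm_on Fock (Hop (complex_of_real w0 - z) coupling (\<phi>1 z) (\<phi>2 z))"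
  using fredholm_on_cong[of "fock_space a", OF Hmat_eq] by (simp add: fock_space_def)

section \<open>The essential spectrum\<close>

lemma fredholm_if_symbol_bounded_below:
  assumes "gap z d" "AE x in lborel. x \<in> cube a \<longrightarrow> e \<le> cmod (symbol z x)" "e > 0"
  shows "fredholm_on (fock_space a) (\<lambda>f. Hmat a w0 v0 w1 v1 w2 f - z *\<^sub>C f)"
  unfolding fredholm_Hmat_iff
proof (rule Hop_fredholm[where \<rho> = "resolvent z"])
  show "AE x in lborel. x \<in> cube a \<longrightarrow> e \<le> cmod (schur_symbol (\<phi>1 z) (resolvent z) x)"
    using assms(2) by (simp add: symbol_def)
  show "\<phi>2 z (prod.swap p) = \<phi>2 z p" for p
    unfolding \<phi>2_def by (simp only: u2_swap)
qed (rule coupling_in_L2_on bounded_mult_\<phi>1 bounded_mult_\<phi>2 bounded_mult_resolvent[OF assms(1)]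
    resolvent_swap \<phi>2_resolvent[OF assms(1)] assms(3) | assumption)+

lemma not_fredholm_if_symbol_degenerate:
  assumes "gap z d" "z \<in> \<real>"
    and "\<And>e. e > 0 \<Longrightarrow> 0 < emeasure lborel {x \<in> cube a. cmod (symbol z x) < e}"
  shows "\<not> fredholm_on (fock_space a) (\<lambda>f. Hmat a w0 v0 w1 v1 w2 f - z *\<^sub>C f)"
  unfolding fredholm_Hmat_iff
proof (rule Hop_not_fredholm_schur[where \<rho> = "resolvent z"])
  show "\<And>e. e > 0 \<Longrightarrow> 0 < emeasure lborel {x \<in> cube a. cmod (schur_symbol (\<phi>1 z) (resolvent z) x) < e}"
    using assms(3) by (simp add: symbol_def)
  show "\<And>p. p \<in> cube a \<times> cube a \<Longrightarrow> \<phi>2 z p * resolvent z p = 1"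
    by (rule \<phi>2_resolvent[OF assms(1)])
qed (use assms(2) in \<open>auto simp: \<phi>1_def \<phi>2_def resolvent_swap
    intro: bounded_mult_\<phi>1 bounded_mult_\<phi>2 bounded_mult_resolvent[OF assms(1)]\<close>)

lemma not_fredholm_Sigma1:
  assumes "z \<in> Sigma1 a w2"
  shows "\<not> fredholm_on (fock_space a) (\<lambda>f. Hmat a w0 v0 w1 v1 w2 f - complex_of_real z *\<^sub>C f)"
  unfolding fredholm_Hmat_iff
proof (rule Hop_not_fredholm_two_particle)
  fix e :: real assume e: "e > 0"
  define W where "W = {p \<in> cube a \<times> cube a. w2 p \<in> ball z e}"
  have "open W"
    using continuous_open_preimage[OF w2_cont open_Times[OF open_cube open_cube] open_ball[of z e]]
    by (simp add: W_def vimage_def Int_def)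
  moreover have "W \<noteq> {}"
    using assms e unfolding Sigma1_def closure_approachable W_def by (force simp: dist_commute)
  moreover have "W \<subseteq> cube a \<times> cube a" by (auto simp: W_def)
  ultimately obtain G where G: "G \<in> sets borel" "G \<subseteq> W" "0 < emeasure lborel G" "G \<inter> prod.swap -` G = {}"
    "AE x in lborel. sqn (\<lambda>s. v (x, s) * indicator (G \<union> prod.swap -` G) (x, s)) \<le> ennreal e"
    using thin_set_in_open[of W e] e by blast
  have small: "cmod (\<phi>2 (complex_of_real z) p) \<le> e" if "p \<in> W" for p
  proof -
    have "\<phi>2 (complex_of_real z) p = complex_of_real (w2 p - z)"
      using that by (auto simp: \<phi>2_def u2_def W_def)
    then show ?thesis using that by (simp only: norm_of_real) (auto simp: W_def dist_real_def)
  qed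
  have "cmod (\<phi>2 (complex_of_real z) p) \<le> e" if "p \<in> G \<union> prod.swap -` G" for p
    using that G(2) small[of p] small[of "prod.swap p"] by (auto simp: \<phi>2_def u2_swap)
  then show "\<exists>G\<in>sets borel. G \<subseteq> cube a \<times> cube a \<and> 0 < emeasure lborel G \<and> G \<inter> prod.swap -` G = {} \<and>
      (\<forall>p\<in>G \<union> prod.swap -` G. cmod (\<phi>2 (complex_of_real z) p) \<le> e) \<and>
      (AE x in lborel. sqn (\<lambda>s. v (x, s) * indicator (G \<union> prod.swap -` G) (x, s)) \<le> ennreal e)"
    using G by (intro bexI[of _ G]) (auto simp: W_def)
qed (auto simp: \<phi>1_def \<phi>2_def intro: bounded_mult_\<phi>1 bounded_mult_\<phi>2)

text \<open>
  The imaginary part of the resolvent has the sign of the imaginary part of \<open>z\<close>, so the two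
  contributions to the imaginary part of the symbol do not cancel.
\<close>

lemma symbol_nonreal:
  assumes "gap z d"
  shows "AE x in lborel. \<bar>Im z\<bar> \<le> cmod (symbol z x)"
proof -
  have "AE p in lborel. v p = 0 \<or> cmod (resolvent z p) \<le> 1 / d"
    using cmod_resolvent_le[OF assms] by simp
  from row_weight_bound[OF row_bounded_row_const resolvent_measurable this] show ?thesis
  proof eventually_elim
    case (elim x)
    define h where "h s = resolvent z (x, s) * complex_of_real ((cmod (v (x, s)))\<^sup>2)" for s
    have int: "integrable lborel h" using elim by (simp add: h_def[abs_def])
    have sgn: "0 \<le> Im z * Im (h s)" for s
    proof -
      have "Im z * Im (resolvent z (x, s)) \<ge> 0"
        by (auto simp: resolvent_def Im_divide power2_eq_square[symmetric])
      then have "0 \<le> (Im z * Im (resolvent z (x, s))) * (cmod (v (x, s)))\<^sup>2" by simp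
      then show ?thesis by (simp add: h_def mult.assoc)
    qed
    have "0 \<le> (LINT s|lborel. Im z * Im (h s))"
      by (intro Bochner_Integration.integral_nonneg sgn)
    also have "\<dots> = Im z * Im (row_weight v (resolvent z) x)"
      unfolding row_weight_def h_def[symmetric] using integral_Im[OF int] by simp
    finally have "0 \<le> Im z * Im (row_weight v (resolvent z) x)" .
    then have "\<bar>Im z\<bar> \<le> \<bar>Im z + 1/2 * Im (row_weight v (resolvent z) x)\<bar>"
      by (auto simp: abs_if zero_le_mult_iff split: if_splits)
    also have "\<dots> = \<bar>Im (symbol z x)\<bar>"
      by (simp add: symbol_def schur_symbol_def \<phi>1_def)
    also have "\<dots> \<le> cmod (symbol z x)" by (rule abs_Im_le_cmod)
    finally show ?case .
  qed
qed

lemma symbol_eq_Delta: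
  "AE x in lborel. x \<in> cube a \<longrightarrow> symbol (complex_of_real z) x = complex_of_real (Delta a w1 v1 w2 x z)"
  using AE_slices[OF v1_eq] w1_eq
proof eventually_elim
  case (elim x)
  show ?case
  proof
    assume x: "x \<in> cube a"
    define g where "g y = (cmod (v (x, y)))\<^sup>2 / (u2 (x, y) - z)" for y
    have [measurable]: "g \<in> borel_measurable borel" unfolding g_def by measurable
    have "AE y in lborel. y \<in> cube a \<longrightarrow> (cmod (v1 (x, y)))\<^sup>2 / (w2 (x, y) - z) = g y"
      using elim(1) by eventually_elim (use x in \<open>auto simp: g_def u2_def\<close>)
    then have "(LINT y|lebesgue_on (cube a). (cmod (v1 (x, y)))\<^sup>2 / (w2 (x, y) - z)) = (LINT y|lborel. g y)"
      by (intro integral_lebesgue_on_borel borel_cube) (auto simp: g_def v_out)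
    moreover have "row_weight v (resolvent (complex_of_real z)) x = (LINT y|lborel. complex_of_real (g y))"
      unfolding row_weight_def
    proof (rule Bochner_Integration.integral_cong[OF refl])
      fix s
      show "resolvent (complex_of_real z) (x, s) * complex_of_real ((cmod (v (x, s)))\<^sup>2) = complex_of_real (g s)"
        using v_out[of "(x, s)"] by (cases "(x, s) \<in> cube a \<times> cube a") (auto simp: resolvent_def g_def u2_def)
    qed
    ultimately show "symbol (complex_of_real z) x = complex_of_real (Delta a w1 v1 w2 x z)"
      using elim(2) x by (simp add: symbol_def schur_symbol_def \<phi>1_def Delta_def)
  qed
qed

lemma symbol_measurable [measurable]: "symbol z \<in> borel_measurable borel"
proof -
  have "(\<lambda>x. \<phi>1 z x - 1/2 * row_weight v (resolvent z) x) \<in> borel_measurable borel"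
    unfolding \<phi>1_def using measurable_row_weight[OF v_meas resolvent_measurable[of z]] by measurable
  then show ?thesis by (simp add: symbol_def schur_symbol_def[abs_def])
qed

lemma zero_in_ess_range_Delta_iff:
  "0 \<in> ess_range (lebesgue_on (cube a)) (\<lambda>x. Delta a w1 v1 w2 x z) \<longleftrightarrow>
    (\<forall>e>0. 0 < emeasure lborel {x \<in> cube a. cmod (symbol (complex_of_real z) x) < e})"
proof -
  let ?D = "\<lambda>x. Delta a w1 v1 w2 x z" and ?s = "symbol (complex_of_real z)"
  have "emeasure (lebesgue_on (cube a)) {x \<in> space (lebesgue_on (cube a)). \<bar>?D x - 0\<bar> < e} =
      emeasure lborel {x \<in> cube a. cmod (?s x) < e}" for e
  proof -
    have "{x \<in> cube a. cmod (?s x) < e} = cube a \<inter> {x \<in> space borel. cmod (?s x) < e}" by auto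
    also have "\<dots> \<in> sets borel" by measurable
    finally have set: "{x \<in> cube a. cmod (?s x) < e} \<in> sets borel" .
    have "emeasure (lebesgue_on (cube a)) {x \<in> space (lebesgue_on (cube a)). \<bar>?D x - 0\<bar> < e} =
        (\<integral>\<^sup>+x. indicator {x. \<bar>?D x\<bar> < e} x \<partial>lebesgue_on (cube a))"
      if "{x \<in> space (lebesgue_on (cube a)). \<bar>?D x\<bar> < e} \<in> sets (lebesgue_on (cube a))"
      unfolding diff_0_right nn_integral_indicator[OF that, symmetric]
      by (rule nn_integral_cong) (simp add: indicator_def)
    moreover have "{x \<in> space (lebesgue_on (cube a)). \<bar>?D x\<bar> < e} \<in> sets (lebesgue_on (cube a))"
    proof -
      have AE: "AE x in lborel. indicator (cube a) x *\<^sub>R ?D x = indicator (cube a) x *\<^sub>R Re (?s x)"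
        using symbol_eq_Delta[of z] by eventually_elim (auto simp: indicator_def)
      have "(\<lambda>x. indicator (cube a) x *\<^sub>R ?D x) \<in> borel_measurable lebesgue"
        by (rule measurable_lebesgue_AE[OF _ AE]) measurable
      then have "?D \<in> borel_measurable (lebesgue_on (cube a))"
        by (subst borel_measurable_restrict_space_iff) auto
      then show ?thesis by measurable
    qed
    moreover have "(\<integral>\<^sup>+x. indicator {x. \<bar>?D x\<bar> < e} x \<partial>lebesgue_on (cube a)) =
        (\<integral>\<^sup>+x. indicator {x. cmod (?s x) < e} x * indicator (cube a) x \<partial>lborel)"
    proof (rule nn_integral_lebesgue_on_borel[OF _ borel_cube])
      show "AE x in lborel. x \<in> cube a \<longrightarrow>
          indicator {x. \<bar>?D x\<bar> < e} x = (indicator {x. cmod (?s x) < e} x :: ennreal)"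
        using symbol_eq_Delta[of z] by eventually_elim (auto simp: indicator_def)
    qed measurable
    moreover have "\<dots> = (\<integral>\<^sup>+x. indicator {x \<in> cube a. cmod (?s x) < e} x \<partial>lborel)"
      by (intro nn_integral_cong) (auto simp: indicator_def)
    ultimately show ?thesis using set by simp
  qed
  then show ?thesis by (simp only: ess_range_def mem_Collect_eq)
qed

text \<open>
  By the resolvent identity the symbol is Lipschitz in \<open>z\<close>, uniformly in \<open>x\<close>, as long as \<open>z\<close> keeps its
  distance from the values of \<open>w2\<close>.
\<close>

lemma symbol_lipschitz:
  assumes "gap z d" "gap z' d'"
  shows "AE x in lborel. cmod (symbol z x - symbol z' x) \<le> cmod (z - z') * (1 + row_const / (2 * (d * d')))"
proof -
  have d: "d > 0" "d' > 0" using assms by (auto simp: gap_def)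
  let ?D = "\<lambda>p. resolvent z p - resolvent z' p"
  have le: "cmod (?D p) \<le> cmod (z - z') / (d * d')" for p
  proof (cases "p \<in> cube a \<times> cube a")
    case True
    let ?w = "complex_of_real (w2 p)"
    have g: "d \<le> cmod (?w - z)" "d' \<le> cmod (?w - z')" using assms True by (auto simp: gap_def)
    then have nz: "?w - z \<noteq> 0" "?w - z' \<noteq> 0" using d by auto
    have "?D p = (z - z') / ((?w - z) * (?w - z'))"
      using True nz by (simp add: resolvent_def field_simps)
    also have "cmod \<dots> \<le> cmod (z - z') / (d * d')"
      unfolding norm_divide norm_mult using d g by (intro frac_le mult_mono mult_pos_pos) auto
    finally show ?thesis .
  next
    case False
    then show ?thesis using d by (simp add: resolvent_def)
  qed
  have "AE p in lborel. v p = 0 \<or> cmod (?D p) \<le> cmod (z - z') / (d * d')" using le by simp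
  from row_weight_bound[OF row_bounded_row_const _ this]
  have D: "AE x in lborel. cmod (row_weight v ?D x) \<le> cmod (z - z') / (d * d') * row_const"
    using d by (auto elim: eventually_mono)
  have int: "AE x in lborel. integrable lborel (\<lambda>s. resolvent z (x, s) * complex_of_real ((cmod (v (x, s)))\<^sup>2))"
    if "gap z d" for z d
  proof -
    have "AE p in lborel. v p = 0 \<or> cmod (resolvent z p) \<le> 1 / d"
      using cmod_resolvent_le[OF that] by simp
    from row_weight_bound[OF row_bounded_row_const resolvent_measurable this]
    show ?thesis by (auto elim: eventually_mono)
  qed
  from D int[OF assms(1)] int[OF assms(2)] show ?thesis
  proof eventually_elim
    case (elim x)
    have "row_weight v ?D x = row_weight v (resolvent z) x - row_weight v (resolvent z') x"
      unfolding row_weight_def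
      by (subst Bochner_Integration.integral_diff[symmetric]) (use elim in \<open>auto simp: left_diff_distrib\<close>)
    then have "symbol z x - symbol z' x = - (z - z') - 1/2 * row_weight v ?D x"
      by (simp add: symbol_def schur_symbol_def \<phi>1_def diff_divide_distrib)
    also have "cmod \<dots> \<le> cmod (z - z') + 1/2 * cmod (row_weight v ?D x)"
      using norm_triangle_ineq4[of "- (z - z')" "1/2 * row_weight v ?D x"]
      by (simp add: norm_mult norm_divide norm_minus_commute)
    also have "\<dots> \<le> cmod (z - z') + 1/2 * (cmod (z - z') / (d * d') * row_const)"
      using elim(1) by simp
    also have "\<dots> = cmod (z - z') * (1 + row_const / (2 * (d * d')))"
      by (simp add: algebra_simps)
    finally show ?case .
  qed
qed

end

context hamiltonian
begin

lemma row_const_nonneg: "row_const \<ge> 0"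
  using row_bounded_row_const by (simp add: row_bounded_def)

lemma gap_nonreal:
  assumes "Im z \<noteq> 0"
  shows "gap z \<bar>Im z\<bar>"
  unfolding gap_def
proof (intro conjI ballI)
  show "\<bar>Im z\<bar> \<le> cmod (complex_of_real (w2 p) - z)" for p
    using abs_Im_le_cmod[of "complex_of_real (w2 p) - z"] by simp
qed (use assms in simp)

lemma gap_real:
  assumes "z \<notin> Sigma1 a w2"
  shows "\<exists>d. gap (complex_of_real z) d"
proof -
  obtain d where d: "d > 0" "\<And>p. p \<in> cube a \<times> cube a \<Longrightarrow> d \<le> dist (w2 p) z"
    using assms unfolding Sigma1_def closure_approachable by (auto simp: not_less)
  have "d \<le> cmod (complex_of_real (w2 p) - complex_of_real z)" if "p \<in> cube a \<times> cube a"
    for p :: "(real ^ 'n) \<times> (real ^ 'n)"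
    using d(2)[OF that] by (simp only: of_real_diff[symmetric] norm_of_real dist_real_def)
  with d(1) show ?thesis unfolding gap_def by blast
qed

text \<open>
  The points at which the symbol degenerates form a set that is relatively closed in the complement of
  \<open>\<Sigma>\<^sub>1\<close>, because the symbol is locally Lipschitz in \<open>z\<close>.
\<close>

lemma Sigma2_symbol_degenerate:
  assumes z: "z \<in> Sigma2 a w1 v1 w2" and g: "gap (complex_of_real z) d" and e: "e > 0"
  shows "0 < emeasure lborel {x \<in> cube a. cmod (symbol (complex_of_real z) x) < e}"
proof -
  have d: "d > 0" using g by (simp add: gap_def)
  define L where "L = 1 + row_const / (2 * (d * (d / 2)))"
  have L: "L > 0" using row_const_nonneg d by (auto simp: L_def intro: add_pos_nonneg)
  (* Within distance d / 2 of z the gap is still d / 2, and then L is the Lipschitz constant. Within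
     e / (2 L) the symbol changes by at most e / 2. *)
  define r where "r = min (d / 2) (e / (2 * L))"
  have r: "r > 0" using d e L by (simp add: r_def)
  obtain z' where z': "0 \<in> ess_range (lebesgue_on (cube a)) (\<lambda>x. Delta a w1 v1 w2 x z')" "dist z' z < r"
    using z r unfolding Sigma2_def closure_approachable by blast
  have dz: "cmod (complex_of_real z - complex_of_real z') < r"
    using z'(2) by (simp only: of_real_diff[symmetric] norm_of_real dist_real_def abs_minus_commute)
  have g': "gap (complex_of_real z') (d / 2)"
    unfolding gap_def
  proof (intro conjI ballI)
    fix p :: "(real ^ 'n) \<times> (real ^ 'n)"
    assume "p \<in> cube a \<times> cube a"
    then have "d \<le> cmod (complex_of_real (w2 p) - complex_of_real z)"
      using g unfolding gap_def by blast
    also have "\<dots> \<le> cmod (complex_of_real (w2 p) - complex_of_real z') + cmod (complex_of_real z' - complex_of_real z)"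
      by (rule norm_diff_triangle_ineq[of "complex_of_real (w2 p)" "complex_of_real z'" "complex_of_real z'", simplified])
    finally show "d / 2 \<le> cmod (complex_of_real (w2 p) - complex_of_real z')"
      using dz by (simp add: r_def norm_minus_commute)
  qed (use d in simp)
  have "cmod (complex_of_real z - complex_of_real z') * L \<le> e / (2 * L) * L"
    using dz L by (intro mult_right_mono) (auto simp: r_def)
  then have le: "cmod (complex_of_real z - complex_of_real z') * L \<le> e / 2"
    using L by simp
  let ?s = "symbol (complex_of_real z)" and ?s' = "symbol (complex_of_real z')"
  have set: "{x \<in> cube a. cmod (symbol c x) < k} \<in> sets borel" for c k
  proof -
    have "{x \<in> cube a. cmod (symbol c x) < k} = cube a \<inter> {x \<in> space borel. cmod (symbol c x) < k}" by auto
    also have "\<dots> \<in> sets borel" by measurable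
    finally show ?thesis .
  qed
  have "0 < emeasure lborel {x \<in> cube a. cmod (?s' x) < e / 2}"
    by (rule z'(1)[unfolded zero_in_ess_range_Delta_iff, rule_format]) (use e in simp)
  also have "\<dots> \<le> emeasure lborel {x \<in> cube a. cmod (?s x) < e}"
  proof (rule emeasure_mono_AE)
    show "AE x in lborel. x \<in> {x \<in> cube a. cmod (?s' x) < e / 2} \<longrightarrow> x \<in> {x \<in> cube a. cmod (?s x) < e}"
      using symbol_lipschitz[OF g g']
    proof eventually_elim
      case (elim x)
      then have "cmod (?s x - ?s' x) \<le> e / 2" using le unfolding L_def by linarith
      then show ?case
        using norm_triangle_sub[of "?s x" "?s' x"] by auto
    qed
  qed (use set in simp)
  finally show ?thesis .
qed

lemma ess_spectrum_Hmat:
  "ess_spectrum_on (fock_space a) (Hmat a w0 v0 w1 v1 w2) =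
    complex_of_real ` (Sigma1 a w2 \<union> Sigma2 a w1 v1 w2)"
proof (intro equalityI subsetI)
  fix z assume "z \<in> complex_of_real ` (Sigma1 a w2 \<union> Sigma2 a w1 v1 w2)"
  then obtain x where x: "z = complex_of_real x" "x \<in> Sigma1 a w2 \<or> x \<in> Sigma2 a w1 v1 w2" by auto
  have "\<not> fredholm_on (fock_space a) (\<lambda>f. Hmat a w0 v0 w1 v1 w2 f - complex_of_real x *\<^sub>C f)"
  proof (cases "x \<in> Sigma1 a w2")
    case True
    then show ?thesis by (rule not_fredholm_Sigma1)
  next
    case False
    then obtain d where d: "gap (complex_of_real x) d" using gap_real by blast
    from False x have "x \<in> Sigma2 a w1 v1 w2" by simp
    from Sigma2_symbol_degenerate[OF this d] show ?thesis
      by (intro not_fredholm_if_symbol_degenerate[OF d]) auto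
  qed
  then show "z \<in> ess_spectrum_on (fock_space a) (Hmat a w0 v0 w1 v1 w2)"
    by (simp add: ess_spectrum_on_def x(1))
next
  fix z assume "z \<in> ess_spectrum_on (fock_space a) (Hmat a w0 v0 w1 v1 w2)"
  then have nf: "\<not> fredholm_on (fock_space a) (\<lambda>f. Hmat a w0 v0 w1 v1 w2 f - z *\<^sub>C f)"
    by (simp add: ess_spectrum_on_def)
  have "Im z = 0"
  proof (rule ccontr)
    assume Im: "Im z \<noteq> 0"
    have "AE x in lborel. x \<in> cube a \<longrightarrow> \<bar>Im z\<bar> \<le> cmod (symbol z x)"
      using symbol_nonreal[OF gap_nonreal[OF Im]] by eventually_elim simp
    with fredholm_if_symbol_bounded_below[OF gap_nonreal[OF Im] this] nf Im show False by simp
  qed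
  then have z: "z = complex_of_real (Re z)" by (simp add: complex_eq_iff)
  have "Re z \<in> Sigma1 a w2 \<union> Sigma2 a w1 v1 w2"
  proof (rule ccontr)
    assume not: "Re z \<notin> Sigma1 a w2 \<union> Sigma2 a w1 v1 w2"
    then obtain d where d: "gap z d" using gap_real[of "Re z"] z by auto
    have "0 \<notin> ess_range (lebesgue_on (cube a)) (\<lambda>x. Delta a w1 v1 w2 x (Re z))"
    proof
      assume "0 \<in> ess_range (lebesgue_on (cube a)) (\<lambda>x. Delta a w1 v1 w2 x (Re z))"
      then have "Re z \<in> Sigma2 a w1 v1 w2"
        unfolding Sigma2_def using not by (intro closure_subset[THEN subsetD]) auto
      with not show False by simp
    qed
    then obtain e where e: "e > 0" "emeasure lborel {x \<in> cube a. cmod (symbol z x) < e} = 0"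
      unfolding zero_in_ess_range_Delta_iff z[symmetric] by (auto simp: zero_less_iff_neq_zero)
    have "{x \<in> cube a. cmod (symbol z x) < e} = cube a \<inter> {x \<in> space borel. cmod (symbol z x) < e}" by auto
    also have "\<dots> \<in> sets borel" by measurable
    finally have "{x \<in> cube a. cmod (symbol z x) < e} \<in> null_sets lborel"
      using e(2) by (simp add: null_sets_def)
    then have "AE x in lborel. x \<in> cube a \<longrightarrow> e \<le> cmod (symbol z x)"
      by (rule AE_I') auto
    with fredholm_if_symbol_bounded_below[OF d this e(1)] nf show False by simp
  qed
  with z show "z \<in> complex_of_real ` (Sigma1 a w2 \<union> Sigma2 a w1 v1 w2)" by (metis imageI)
qed

lemma Sigma1_eq_interval:
  "Sigma1 a w2 = {(INF p \<in> cube a \<times> cube a. w2 p) .. (SUP p \<in> cube a \<times> cube a. w2 p)}"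
proof -
  define X where "X = w2 ` (cube a \<times> cube a)"
  have ne: "X \<noteq> {}" using cube_nonempty[OF a_pos] by (auto simp: X_def)
  have "bounded X" using w2_bound by (auto simp: X_def bounded_iff)
  moreover have "connected X"
    unfolding X_def by (intro connected_continuous_image w2_cont connected_Times connected_cube)
  ultimately have "connected (closure X) \<and> compact (closure X)"
    by (simp add: connected_imp_connected_closure compact_closure)
  then have "\<exists>l u. closure X = {l..u}"
    unfolding connected_compact_interval_1 .
  then obtain l u where lu: "closure X = {l..u}" by (elim exE)
  have le: "l \<le> u" using ne lu closure_subset[of X] by force
  have X: "l \<le> x" "x \<le> u" if "x \<in> X" for x using that lu closure_subset[of X] by auto
  have bdd: "bdd_below X" "bdd_above X"
    using bdd_belowI[of X l] bdd_aboveI[of X u] X by auto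
  have "closure X \<subseteq> {Inf X..Sup X}"
    by (rule closure_minimal) (use bdd in \<open>auto intro: cInf_lower cSup_upper\<close>)
  then have "Inf X \<le> l" "u \<le> Sup X" using lu le by auto
  moreover have "l \<le> Inf X" "Sup X \<le> u"
    using X ne by (auto intro: cInf_greatest cSup_least)
  ultimately show ?thesis
    unfolding Sigma1_def X_def[symmetric] lu by simp
qed

end

section \<open>Essential bounds\<close>

lemma AE_le_enn2real_esssup:
  assumes "esssup M f < (\<infinity> :: ennreal)"
  shows "AE x in M. f x \<le> ennreal (enn2real (esssup M f))"
  using esssup_AE[of f M] assms by (auto elim: eventually_mono simp: less_top)

lemma nn_integral_le_Lp_norm:
  assumes "Lp_norm M p f \<le> ennreal K" "p > 0" "K \<ge> 0"
  shows "(\<integral>\<^sup>+x. ennreal (cmod (f x) powr p) \<partial>M) \<le> ennreal (K powr p)"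
proof -
  define I where "I = (\<integral>\<^sup>+x. ennreal (cmod (f x) powr p) \<partial>M)"
  have fin: "I \<noteq> \<infinity>"
    using assms(1) by (auto simp: Lp_norm_def I_def[symmetric] top_unique)
  then have "ennreal (enn2real I powr (1 / p)) \<le> ennreal K"
    using assms(1) by (simp add: Lp_norm_def I_def[symmetric])
  then have "enn2real I powr (1 / p) \<le> K" using assms(3) by simp
  then have "(enn2real I powr (1 / p)) powr p \<le> K powr p"
    using assms(2) by (intro powr_mono2) auto
  then have "enn2real I \<le> K powr p" using assms(2) by (simp add: powr_powr)
  then have le: "ennreal (enn2real I) \<le> ennreal (K powr p)" by (rule ennreal_leI)
  have "ennreal (enn2real I) = I" using fin by (simp add: less_top)
  with le show ?thesis by (simp only: I_def)
qed

text \<open>The set on which the bound fails is open, and a nonempty open set is not a null set.\<close>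

lemma continuous_on_AE_bound:
  fixes w :: "'a::euclidean_space \<Rightarrow> real"
  assumes "open A" "continuous_on A w" "AE x in lborel. x \<in> A \<longrightarrow> w x \<le> K" "x \<in> A"
  shows "w x \<le> K"
proof (rule ccontr)
  assume "\<not> w x \<le> K"
  define W where "W = A \<inter> w -` {K<..}"
  have W: "open W" unfolding W_def by (rule continuous_open_preimage[OF assms(2,1)]) simp
  have "AE x in lborel. x \<notin> W" using assms(3) by eventually_elim (auto simp: W_def)
  then have "W \<in> null_sets lborel" using W by (simp add: AE_iff_null_sets[symmetric])
  then have "negligible W" by (simp add: negligible_iff_null_sets null_sets_completionI)
  then have "W = {}" using open_not_negligible[OF W] by blast
  with assms(4) \<open>\<not> w x \<le> K\<close> show False by (auto simp: W_def)
qed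

theorem theorem3p1:
  fixes a w0 :: real
    and v0 :: "real ^ 'n \<Rightarrow> complex"
    and w1 :: "real ^ 'n \<Rightarrow> real"
    and v1 :: "(real ^ 'n) \<times> (real ^ 'n) \<Rightarrow> complex"
    and w2 :: "(real ^ 'n) \<times> (real ^ 'n) \<Rightarrow> real"
  assumes "a > 0"
    and v0: "sq_integrable (lebesgue_on (cube a)) v0"
    and w1_measurable: "w1 \<in> borel_measurable (lebesgue_on (cube a))"
    and w1_bounded: "esssup (lebesgue_on (cube a)) (\<lambda>x. ennreal \<bar>w1 x\<bar>) < \<infinity>"
    and w2_continuous: "continuous_on (cube a \<times> cube a) w2"
    and w2_bounded: "esssup (lebesgue_on (cube a \<times> cube a)) (\<lambda>p. ennreal \<bar>w2 p\<bar>) < \<infinity>"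
    and w2_sym: "\<And>x y. x \<in> cube a \<Longrightarrow> y \<in> cube a \<Longrightarrow> w2 (x, y) = w2 (y, x)"
    and v1_measurable: "v1 \<in> borel_measurable (lebesgue_on (cube a \<times> cube a))"
    and v1_bounded: "\<exists>\<epsilon>>0.
      esssup (lebesgue_on (cube a))
        (\<lambda>x. Lp_norm (lebesgue_on (cube a)) (2 + \<epsilon>) (\<lambda>y. v1 (x, y))) < \<infinity> \<and>
      esssup (lebesgue_on (cube a))
        (\<lambda>y. Lp_norm (lebesgue_on (cube a)) (2 + 4 / \<epsilon>) (\<lambda>x. v1 (x, y))) < \<infinity>"
  shows "Sigma1 a w2 =
      {(INF p \<in> cube a \<times> cube a. w2 p) .. (SUP p \<in> cube a \<times> cube a. w2 p)} \<and>
    ess_spectrum_on (fock_space a) (Hmat a w0 v0 w1 v1 w2) =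
      complex_of_real ` (Sigma1 a w2 \<union> Sigma2 a w1 v1 w2)"
proof -
  obtain b where b: "b \<in> borel_measurable borel" "\<And>x. x \<notin> cube a \<Longrightarrow> b x = 0"
    "AE x in lborel. x \<in> cube a \<longrightarrow> v0 x = b x"
    using complex_borel_version_on[of v0 "cube a"] v0 by (auto simp: sq_integrable_def)
  have "(\<integral>\<^sup>+x. ennreal ((cmod (v0 x))\<^sup>2) \<partial>lebesgue_on (cube a)) < \<infinity>"
    using v0 unfolding sq_integrable_def by (subst nn_integral_eq_integral) auto
  also have "(\<integral>\<^sup>+x. ennreal ((cmod (v0 x))\<^sup>2) \<partial>lebesgue_on (cube a)) =
      (\<integral>\<^sup>+x. ennreal ((cmod (b x))\<^sup>2) * indicator (cube a) x \<partial>lborel)"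
    by (rule nn_integral_lebesgue_on_borel) (use b in \<open>auto elim: eventually_mono\<close>)
  also have "\<dots> = sqn b"
    by (rule nn_integral_cong) (auto simp: indicator_def b(2))
  finally have b_fin: "sqn b < \<infinity>" .

  define K1 where "K1 = enn2real (esssup (lebesgue_on (cube a)) (\<lambda>x. ennreal \<bar>w1 x\<bar>))"
  have w1_le: "AE x in lborel. x \<in> cube a \<longrightarrow> \<bar>w1 x\<bar> \<le> K1"
    using AE_le_enn2real_esssup[OF w1_bounded]
    by (simp add: AE_lebesgue_on_iff K1_def[symmetric]) (simp add: K1_def)
  have "(\<lambda>x. complex_of_real (w1 x)) \<in> borel_measurable (lebesgue_on (cube a))"
    using w1_measurable by measurable
  from complex_borel_version_on[OF this borel_cube]
  obtain g where g: "g \<in> borel_measurable borel" "\<forall>x. x \<notin> cube a \<longrightarrow> g x = 0"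
    "AE x in lborel. x \<in> cube a \<longrightarrow> complex_of_real (w1 x) = g x"
    by (elim bexE conjE) (rule that)
  define u1 where "u1 x = Re (g x)" for x
  have u1: "u1 \<in> borel_measurable borel" using g(1) unfolding u1_def by measurable
  have w1_eq: "AE x in lborel. x \<in> cube a \<longrightarrow> w1 x = u1 x"
    using g(3) by eventually_elim (auto simp: u1_def complex_eq_iff)
  have u1_bound: "AE x in lborel. \<bar>u1 x\<bar> \<le> K1"
    using w1_le w1_eq
  proof eventually_elim
    case (elim x)
    then show ?case by (cases "x \<in> cube a") (auto simp: u1_def g(2) K1_def)
  qed

  define K2 where "K2 = enn2real (esssup (lebesgue_on (cube a \<times> cube a)) (\<lambda>p. ennreal \<bar>w2 p\<bar>))"
  have "AE p in lborel. p \<in> cube a \<times> cube a \<longrightarrow> \<bar>w2 p\<bar> \<le> K2"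
    using AE_le_enn2real_esssup[OF w2_bounded]
    by (simp add: AE_lebesgue_on_iff K2_def[symmetric]) (simp add: K2_def)
  then have w2_bound: "\<bar>w2 p\<bar> \<le> K2" if "p \<in> cube a \<times> cube a" for p
    using that
    by (intro continuous_on_AE_bound[of "cube a \<times> cube a" "\<lambda>p. \<bar>w2 p\<bar>"] open_Times open_cube
        continuous_intros w2_continuous)

  from complex_borel_version_on[OF v1_measurable borel_cube_times]
  obtain v where v': "v \<in> borel_measurable borel" "\<forall>p. p \<notin> cube a \<times> cube a \<longrightarrow> v p = 0"
    "AE p in lborel. p \<in> cube a \<times> cube a \<longrightarrow> v1 p = v p"
    by (elim bexE conjE) (rule that)
  have v: "v \<in> borel_measurable borel" "\<And>p. p \<notin> cube a \<times> cube a \<Longrightarrow> v p = 0"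
    "AE p in lborel. p \<in> cube a \<times> cube a \<longrightarrow> v1 p = v p"
    using v' by blast+
  (* Stated for a general kernel so that it applies to v1 and to its mirror image. *)
  have slice: "AE x in lborel. (\<integral>\<^sup>+s. ennreal (cmod (k (x, s)) powr p) \<partial>lborel) \<le> ennreal (K powr p)"
    if k: "k \<in> borel_measurable borel" "\<And>p. p \<notin> cube a \<times> cube a \<Longrightarrow> k p = 0"
      "AE p in lborel. p \<in> cube a \<times> cube a \<longrightarrow> h p = k p" and p: "p > 0"
      and le: "esssup (lebesgue_on (cube a)) (\<lambda>x. Lp_norm (lebesgue_on (cube a)) p (\<lambda>s. h (x, s))) < \<infinity>"
      and K: "K = enn2real (esssup (lebesgue_on (cube a)) (\<lambda>x. Lp_norm (lebesgue_on (cube a)) p (\<lambda>s. h (x, s))))"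
    for h k :: "(real ^ 'n) \<times> (real ^ 'n) \<Rightarrow> complex" and p K :: real
  proof -
    note [measurable] = k(1)
    have "AE x in lborel. x \<in> cube a \<longrightarrow> Lp_norm (lebesgue_on (cube a)) p (\<lambda>s. h (x, s)) \<le> ennreal K"
      using AE_le_enn2real_esssup[OF le] by (simp add: AE_lebesgue_on_iff K)
    with AE_slices[OF k(3)] show ?thesis
    proof eventually_elim
      case (elim x)
      show ?case
      proof (cases "x \<in> cube a")
        case True
        have "AE s in lborel. s \<in> cube a \<longrightarrow> ennreal (cmod (h (x, s)) powr p) = ennreal (cmod (k (x, s)) powr p)"
          using elim(1) by eventually_elim (use True in auto)
        then have "(\<integral>\<^sup>+s. ennreal (cmod (h (x, s)) powr p) \<partial>lebesgue_on (cube a)) =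
            (\<integral>\<^sup>+s. ennreal (cmod (k (x, s)) powr p) * indicator (cube a) s \<partial>lborel)"
          by (intro nn_integral_lebesgue_on_borel borel_cube) measurable
        also have "\<dots> = (\<integral>\<^sup>+s. ennreal (cmod (k (x, s)) powr p) \<partial>lborel)"
          by (rule nn_integral_cong) (auto simp: indicator_def k(2))
        finally show ?thesis
          using nn_integral_le_Lp_norm[of "lebesgue_on (cube a)" p "\<lambda>s. h (x, s)" K] elim(2) True p
          by (simp add: K)
      qed (simp add: k(2))
    qed
  qed
  obtain \<epsilon> where \<epsilon>: "\<epsilon> > 0"
    "esssup (lebesgue_on (cube a)) (\<lambda>x. Lp_norm (lebesgue_on (cube a)) (2 + \<epsilon>) (\<lambda>y. v1 (x, y))) < \<infinity>"
    "esssup (lebesgue_on (cube a)) (\<lambda>y. Lp_norm (lebesgue_on (cube a)) (2 + 4 / \<epsilon>) (\<lambda>x. v1 (x, y))) < \<infinity>"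
    using v1_bounded by blast
  have row: "AE x in lborel. (\<integral>\<^sup>+s. ennreal (cmod (v (x, s)) powr (2 + \<epsilon>)) \<partial>lborel) \<le>
      ennreal (enn2real (esssup (lebesgue_on (cube a))
        (\<lambda>x. Lp_norm (lebesgue_on (cube a)) (2 + \<epsilon>) (\<lambda>y. v1 (x, y)))) powr (2 + \<epsilon>))"
    using \<epsilon> by (intro slice[OF v]) auto
  have col: "AE x in lborel. (\<integral>\<^sup>+s. ennreal (cmod (v (prod.swap (x, s))) powr (2 + 4 / \<epsilon>)) \<partial>lborel) \<le>
      ennreal (enn2real (esssup (lebesgue_on (cube a))
        (\<lambda>y. Lp_norm (lebesgue_on (cube a)) (2 + 4 / \<epsilon>) (\<lambda>x. v1 (prod.swap (y, x))))) powr (2 + 4 / \<epsilon>))"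
  proof (rule slice)
    show "(\<lambda>p. v (prod.swap p)) \<in> borel_measurable borel" using v(1) by measurable
    show "v (prod.swap p) = 0" if "p \<notin> cube a \<times> cube a" for p
      using that by (intro v(2)) (cases p, auto)
    show "AE p in lborel. p \<in> cube a \<times> cube a \<longrightarrow> v1 (prod.swap p) = v (prod.swap p)"
      using AE_swap[OF v(3)] by eventually_elim auto
  qed (use \<epsilon> in \<open>auto intro: add_pos_pos\<close>)
  interpret hamiltonian a v \<epsilon>
    "enn2real (esssup (lebesgue_on (cube a))
      (\<lambda>x. Lp_norm (lebesgue_on (cube a)) (2 + \<epsilon>) (\<lambda>y. v1 (x, y)))) powr (2 + \<epsilon>)"
    "enn2real (esssup (lebesgue_on (cube a))
      (\<lambda>y. Lp_norm (lebesgue_on (cube a)) (2 + 4 / \<epsilon>) (\<lambda>x. v1 (x, y)))) powr (2 + 4 / \<epsilon>)"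
    w0 v0 b w1 u1 v1 w2 K1 K2
  proof unfold_locales
    show "AE p in lborel. p \<in> cube a \<times> cube a \<longrightarrow> v1 p = v p" by (rule v(3))
  qed (use assms v(1,2) \<epsilon>(1) row col b b_fin u1 u1_bound w1_eq w2_bound emeasure_cube_finite in auto)
  show ?thesis using Sigma1_eq_interval ess_spectrum_Hmat by blast
qed

end
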